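(* Each of the classes of n-slender groups, of cm-slender groups, and of lcH-slender groups is closed under taking graph products: if $\Gamma$ is a simple graph with vertex set $V$ and $\{G_v\}_{v\in V}$ are groups all belonging to one of these classes, then the graph product $\Gamma(V,\{G_v\}_{v\in V})$ belongs to that class. In particular, each of these classes is closed under (arbitrary) free products and direct sums.
   Context: Given a simple graph $\Gamma$ with vertex set $V$ and groups $G_v$ ($v\in V$), the graph product $\Gamma(V,\{G_v\}_{v\in V})$ is the quotient of the free product $*_{v\in V}G_v$ by the normal subgroup generated by all commutators $[g,h]$ with $g\in G_u$, $h\in G_v$ and $u,v$ adjacent in $\Gamma$. (The free product corresponds to the graph with no edges, the direct sum to the complete graph.) Let $E=\bigcup_{n\in\mathbb{N}}C((0,\tfrac1n),\tfrac1n)\subseteq\mathbb{R}^2$ be the Hawaiian earring and $\mathbb{H}=\pi_1(E,(0,0))$. For $N\in\mathbb{N}$ let $p_N:\mathbb{H}\to\mathbb{H}$ be induced by the retraction of $E$ onto the union of the first $N$ circles collapsing the other circles to the base point. A group $G$ is n-slender if for every homomorphism $\phi:\mathbb{H}\to G$ there is $N$ with $\phi=\phi\circ p_N$. A group is cm-slender if every homomorphism to it from a completely metrizable topological group has open kernel, and lcH-slender if every homomorphism to it from a locally compact Hausdorff topological group has open kernel. *)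

theory Defs
  imports "HOL-Analysis.Analysis" "HOL-Algebra.Algebra"
begin

definition simple_graph :: "'v set \<Rightarrow> ('v \<Rightarrow> 'v \<Rightarrow> bool) \<Rightarrow> bool" where
  "simple_graph V adj \<longleftrightarrow>
     (\<forall>u v. adj u v \<longrightarrow> u \<in> V \<and> v \<in> V) \<and>
     (\<forall>u v. adj u v \<longrightarrow> adj v u) \<and> (\<forall>v. \<not> adj v v)"

definition gp_words :: "'v set \<Rightarrow> ('v \<Rightarrow> ('g, 'm) monoid_scheme) \<Rightarrow> ('v \<times> 'g) list set" where
  "gp_words V G = {w. \<forall>(v, g) \<in> set w. v \<in> V \<and> g \<in> carrier (G v)}"

inductive gp_step :: "('v \<Rightarrow> 'v \<Rightarrow> bool) \<Rightarrow> ('v \<Rightarrow> ('g, 'm) monoid_scheme)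
    \<Rightarrow> ('v \<times> 'g) list \<Rightarrow> ('v \<times> 'g) list \<Rightarrow> bool"
  for adj G where
  gp_one: "gp_step adj G (xs @ [(v, \<one>\<^bsub>G v\<^esub>)] @ ys) (xs @ ys)"
| gp_mult: "gp_step adj G (xs @ [(v, g), (v, h)] @ ys) (xs @ [(v, g \<otimes>\<^bsub>G v\<^esub> h)] @ ys)"
| gp_comm: "adj v u \<Longrightarrow> gp_step adj G (xs @ [(v, g), (u, h)] @ ys) (xs @ [(u, h), (v, g)] @ ys)"

definition gp_equiv :: "'v set \<Rightarrow> ('v \<Rightarrow> 'v \<Rightarrow> bool) \<Rightarrow> ('v \<Rightarrow> ('g, 'm) monoid_scheme)
    \<Rightarrow> ('v \<times> 'g) list \<Rightarrow> ('v \<times> 'g) list \<Rightarrow> bool" where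
  "gp_equiv V adj G =
     equivclp (\<lambda>x y. x \<in> gp_words V G \<and> y \<in> gp_words V G \<and> gp_step adj G x y)"

definition gp_class :: "'v set \<Rightarrow> ('v \<Rightarrow> 'v \<Rightarrow> bool) \<Rightarrow> ('v \<Rightarrow> ('g, 'm) monoid_scheme)
    \<Rightarrow> ('v \<times> 'g) list \<Rightarrow> ('v \<times> 'g) list set" where
  "gp_class V adj G w = {w' \<in> gp_words V G. gp_equiv V adj G w w'}"

text \<open>The graph product \<Gamma>(V, {G_v}): the quotient of the free product of the G v by the normal
  subgroup generated by the commutators [g,h], g \<in> G u, h \<in> G v, u,v adjacent; realised as the
  monoid presented by the above relations (equivalence classes of words, concatenation).\<close>
definition graph_product :: "'v set \<Rightarrow> ('v \<Rightarrow> 'v \<Rightarrow> bool) \<Rightarrow> ('v \<Rightarrow> ('g, 'm) monoid_scheme)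
    \<Rightarrow> (('v \<times> 'g) list set) monoid" where
  "graph_product V adj G =
     \<lparr> carrier = gp_class V adj G ` gp_words V G,
       mult = (\<lambda>A B. gp_class V adj G ((SOME a. a \<in> A) @ (SOME b. b \<in> B))),
       one = gp_class V adj G [] \<rparr>"

text \<open>We identify R^2 with the complex plane; the circle C((0,1/n),1/n) is the sphere of radius 1/n
  centred at \<i>/n.\<close>
definition hawaiian_circle :: "nat \<Rightarrow> complex set" where
  "hawaiian_circle n = sphere (\<i> * of_real (1 / real n)) (1 / real n)"

definition hawaiian_earring :: "complex set" where
  "hawaiian_earring = (\<Union>n\<in>{1..}. hawaiian_circle n)"

definition loops :: "'a::topological_space set \<Rightarrow> 'a \<Rightarrow> (real \<Rightarrow> 'a) set" where
  "loops S a = {p. path p \<and> path_image p \<subseteq> S \<and> pathstart p = a \<and> pathfinish p = a}"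

definition path_class :: "'a::topological_space set \<Rightarrow> (real \<Rightarrow> 'a) \<Rightarrow> (real \<Rightarrow> 'a) set" where
  "path_class S p = {q. homotopic_paths S p q}"

definition fundamental_group :: "'a::real_normed_vector set \<Rightarrow> 'a \<Rightarrow> ((real \<Rightarrow> 'a) set) monoid" where
  "fundamental_group S a =
     \<lparr> carrier = path_class S ` loops S a,
       mult = (\<lambda>A B. path_class S ((SOME p. p \<in> A) +++ (SOME q. q \<in> B))),
       one = path_class S (linepath a a) \<rparr>"

definition HE_group :: "((real \<Rightarrow> complex) set) monoid" where
  "HE_group = fundamental_group hawaiian_earring 0"

definition HE_retraction :: "nat \<Rightarrow> complex \<Rightarrow> complex" where
  "HE_retraction N x = (if x \<in> (\<Union>n\<in>{1..N}. hawaiian_circle n) then x else 0)"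

definition HE_p :: "nat \<Rightarrow> (real \<Rightarrow> complex) set \<Rightarrow> (real \<Rightarrow> complex) set" where
  "HE_p N A = path_class hawaiian_earring (HE_retraction N \<circ> (SOME p. p \<in> A))"

definition n_slender :: "('b, 'n) monoid_scheme \<Rightarrow> bool" where
  "n_slender G \<longleftrightarrow>
     (\<forall>\<phi> \<in> hom HE_group G. \<exists>N::nat. \<forall>x \<in> carrier HE_group. \<phi> x = \<phi> (HE_p N x))"

definition topological_group :: "('a, 'm) monoid_scheme \<Rightarrow> 'a topology \<Rightarrow> bool" where
  "topological_group K T \<longleftrightarrow> group K \<and> topspace T = carrier K \<and>
     continuous_map (prod_topology T T) T (\<lambda>(x, y). x \<otimes>\<^bsub>K\<^esub> y) \<and>
     continuous_map T T (\<lambda>x. inv\<^bsub>K\<^esub> x)"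

text \<open>Since HOL cannot quantify over types inside a definition, the source topological
  groups range over groups whose elements have a given (arbitrary) type 'a.\<close>
definition cm_slender :: "'a itself \<Rightarrow> ('b, 'n) monoid_scheme \<Rightarrow> bool" where
  "cm_slender (_ :: 'a itself) G \<longleftrightarrow>
     (\<forall>(K :: 'a monoid) (T :: 'a topology) \<phi>.
        topological_group K T \<and> completely_metrizable_space T \<and> \<phi> \<in> hom K G
        \<longrightarrow> openin T (kernel K G \<phi>))"

definition lcH_slender :: "'a itself \<Rightarrow> ('b, 'n) monoid_scheme \<Rightarrow> bool" where
  "lcH_slender (_ :: 'a itself) G \<longleftrightarrow>
     (\<forall>(K :: 'a monoid) (T :: 'a topology) \<phi>.
        topological_group K T \<and> locally_compact_space T \<and> Hausdorff_space T \<and> \<phi> \<in> hom K G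
        \<longrightarrow> openin T (kernel K G \<phi>))"

end

(* All three kinds of source groups (completely metrizable, locally compact Hausdorff, the Hawaiian
   earring group) admit solutions near the identity of systems y_k = x_k * y_(k+1)^(n_k) in which the
   x_k are chosen successively and close to the identity, and n_k may depend on x_0, ..., x_k. For a
   homomorphism phi into a graph product this is used twice. For a finite set F of vertices, induction
   on F shows that the retraction of phi to the subgroup spanned by F is trivial near the identity: when
   a vertex v is added, the kernel of the retraction forgetting v is a free product of conjugates of
   G v, and the elements of this kernel that project trivially to G v have powers whose length grows,
   which contradicts the solvability of the system with rapidly growing exponents n_k. For infinitely
   many vertices, a system with n_k = 1 whose x_k involve more and more vertices would have a solution
   y_0 of infinite support. For the Hawaiian earring, triviality near the identity is equivalent to
   factoring through some p_N, since every loop is homotopic to a finite product of loops in the first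
   N circles and loops in the remaining ones. *)
theory Submission
  imports Defs
begin

section \<open>Graph products, retractions and projections\<close>

text \<open>Torsion is the obstacle in the finite case: a free product may contain elements of
  finite order, whose powers cannot grow. They are conjugate into a factor, and the projection to
  \<open>G v\<close> is injective on each factor and its conjugates; so passing to the kernel of
  this projection, which the hypothesis on \<open>G v\<close> permits near the identity, leaves only
  elements with growing powers. The exponents must dominate the lengths of the images of the x_j,
  which are known only once the x_j have been picked; hence the dependence of n_k on the earlier
  choices. The free product structure of the kernel is obtained without normal forms for graph
  products: van der Waerden's method lets words act on reduced sequences whose letters are indexed
  by cosets of the subgroup spanned by the neighbours of v in F. For the earring, a loop may pass
  infinitely often between the first N circles and the others, so compactness alone does not cut it
  into finitely many pieces; a homotopy first collapses a neighbourhood of the base point in the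
  first N circles.\<close>

locale graph_of_groups =
  fixes V :: "'v set" and adj :: "'v \<Rightarrow> 'v \<Rightarrow> bool" and G :: "'v \<Rightarrow> ('g, 'm) monoid_scheme"
  assumes simple: "simple_graph V adj"
    and vertex_group: "v \<in> V \<Longrightarrow> group (G v)"
begin

abbreviation "words \<equiv> gp_words V G"
abbreviation "weq \<equiv> gp_equiv V adj G"
abbreviation "cls \<equiv> gp_class V adj G"
abbreviation "\<Gamma> \<equiv> graph_product V adj G"

section \<open>Equivalence of words and the group structure of the graph product\<close>

lemma words_simps [simp]:
  "[] \<in> words"
  "(v, g) # w \<in> words \<longleftrightarrow> v \<in> V \<and> g \<in> carrier (G v) \<and> w \<in> words"
  "w @ w' \<in> words \<longleftrightarrow> w \<in> words \<and> w' \<in> words"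
  by (auto simp: gp_words_def)

lemma weq_refl [simp]: "weq x x"
  by (simp add: gp_equiv_def)

lemma weq_sym: "weq x y \<Longrightarrow> weq y x"
  by (simp add: gp_equiv_def equivclp_sym)

lemma weq_trans [trans]: "weq x y \<Longrightarrow> weq y z \<Longrightarrow> weq x z"
  unfolding gp_equiv_def by (rule equivclp_trans)

lemma weq_step: "gp_step adj G x y \<Longrightarrow> x \<in> words \<Longrightarrow> y \<in> words \<Longrightarrow> weq x y"
  unfolding gp_equiv_def by (rule r_into_equivclp) simp

lemma weq_invariant:
  assumes "weq x y"
    and "\<And>x y. x \<in> words \<Longrightarrow> y \<in> words \<Longrightarrow> gp_step adj G x y \<Longrightarrow> f x = f y"
  shows "f x = f y"
  using assms(1) unfolding gp_equiv_def
  by (induction rule: equivclp_induct) (use assms(2) in force)+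

lemma weq_map:
  assumes "weq x y"
    and "\<And>x y. x \<in> words \<Longrightarrow> y \<in> words \<Longrightarrow> gp_step adj G x y \<Longrightarrow> weq (f x) (f y)"
  shows "weq (f x) (f y)"
  using assms(1) unfolding gp_equiv_def
  apply (induction rule: equivclp_induct)
  using assms(2) equivclp_trans equivclp_sym unfolding gp_equiv_def
  by (simp, metis (no_types, lifting))

lemma gp_step_append: "gp_step adj G x y \<Longrightarrow> gp_step adj G (a @ x @ b) (a @ y @ b)"
proof (induction rule: gp_step.induct)
  case (gp_one xs v ys)
  show ?case using gp_step.gp_one[of adj G "a @ xs" v "ys @ b"] by simp
next
  case (gp_mult xs v g h ys)
  show ?case using gp_step.gp_mult[of adj G "a @ xs" v g h "ys @ b"] by simp
next
  case (gp_comm v u xs g h ys)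
  then show ?case using gp_step.gp_comm[of adj v u G "a @ xs" g h "ys @ b"] by simp
qed

lemma weq_append:
  assumes "weq x y" "a \<in> words" "b \<in> words"
  shows "weq (a @ x @ b) (a @ y @ b)"
  by (rule weq_map[OF assms(1)]) (intro weq_step gp_step_append; use assms in simp)

lemma weq_words: "weq x y \<Longrightarrow> x \<in> words \<longleftrightarrow> y \<in> words"
  by (rule weq_invariant) auto

lemma weq_cong:
  assumes "weq x x'" "weq y y'" "x \<in> words" "y \<in> words"
  shows "weq (x @ y) (x' @ y')"
proof -
  have "weq (x @ y) (x' @ y)"
    using weq_append[OF assms(1), of "[]" y] assms(4) by simp
  also have "weq (x' @ y) (x' @ y')"
    using weq_append[OF assms(2), of "x'" "[]"] assms(1,3) weq_words by simp
  finally show ?thesis .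
qed

lemma cls_eq_iff: "x \<in> words \<Longrightarrow> y \<in> words \<Longrightarrow> cls x = cls y \<longleftrightarrow> weq x y"
  unfolding gp_class_def using weq_sym weq_trans weq_refl by blast

lemma some_cls: "x \<in> words \<Longrightarrow> (SOME a. a \<in> cls x) \<in> words \<and> weq x (SOME a. a \<in> cls x)"
  using someI[of "\<lambda>a. a \<in> cls x" x] unfolding gp_class_def by auto

definition rep :: "('v \<times> 'g) list set \<Rightarrow> ('v \<times> 'g) list" where
  "rep A = (SOME a. a \<in> A)"

lemma rep_words: "A \<in> carrier \<Gamma> \<Longrightarrow> rep A \<in> words"
  unfolding rep_def graph_product_def using some_cls by auto

lemma cls_rep: "A \<in> carrier \<Gamma> \<Longrightarrow> cls (rep A) = A"
  unfolding rep_def graph_product_def using some_cls cls_eq_iff by auto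

lemma cls_carrier: "w \<in> words \<Longrightarrow> cls w \<in> carrier \<Gamma>"
  by (simp add: graph_product_def)

lemma carrier_E:
  assumes "A \<in> carrier \<Gamma>" obtains w where "w \<in> words" "A = cls w"
  using assms rep_words cls_rep by metis

lemma cls_mult:
  assumes "x \<in> words" "y \<in> words"
  shows "cls x \<otimes>\<^bsub>\<Gamma>\<^esub> cls y = cls (x @ y)"
proof -
  have "weq (x @ y) ((SOME a. a \<in> cls x) @ (SOME a. a \<in> cls y))"
    by (rule weq_cong) (use assms some_cls in auto)
  then show ?thesis
    using assms some_cls by (auto simp: graph_product_def cls_eq_iff weq_sym)
qed

lemma cls_one: "\<one>\<^bsub>\<Gamma>\<^esub> = cls []"
  by (simp add: graph_product_def)

definition inv_word :: "('v \<times> 'g) list \<Rightarrow> ('v \<times> 'g) list" where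
  "inv_word w = rev (map (\<lambda>(v, g). (v, inv\<^bsub>G v\<^esub> g)) w)"

lemma inv_word_words: "w \<in> words \<Longrightarrow> inv_word w \<in> words"
  unfolding inv_word_def gp_words_def by (force intro: group.inv_closed vertex_group)

lemma cls_single_mult:
  assumes "v \<in> V" "g \<in> carrier (G v)" "h \<in> carrier (G v)"
  shows "cls [(v, g)] \<otimes>\<^bsub>\<Gamma>\<^esub> cls [(v, h)] = cls [(v, g \<otimes>\<^bsub>G v\<^esub> h)]"
proof -
  have "g \<otimes>\<^bsub>G v\<^esub> h \<in> carrier (G v)"
    using assms vertex_group by (simp add: group.is_monoid monoid.m_closed)
  then show ?thesis
    using assms gp_step.gp_mult[of adj G "[]" v g h "[]"] by (simp add: cls_mult cls_eq_iff weq_step)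
qed

lemma cls_single_one: "v \<in> V \<Longrightarrow> cls [(v, \<one>\<^bsub>G v\<^esub>)] = \<one>\<^bsub>\<Gamma>\<^esub>"
  using gp_step.gp_one[of adj G "[]" v "[]"] vertex_group
  by (simp add: cls_one cls_eq_iff weq_step group.is_monoid monoid.one_closed)

lemma cls_single_commute:
  assumes "adj u v" "g \<in> carrier (G u)" "h \<in> carrier (G v)"
  shows "cls [(u, g)] \<otimes>\<^bsub>\<Gamma>\<^esub> cls [(v, h)] = cls [(v, h)] \<otimes>\<^bsub>\<Gamma>\<^esub> cls [(u, g)]"
proof -
  have "u \<in> V" "v \<in> V" using assms(1) simple by (auto simp: simple_graph_def)
  then show ?thesis
    using assms gp_step.gp_comm[of adj u v G "[]" g h "[]"] by (simp add: cls_mult cls_eq_iff weq_step)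
qed

lemma monoid_graph_product: "monoid \<Gamma>"
proof (rule monoidI)
  show "x \<otimes>\<^bsub>\<Gamma>\<^esub> y \<in> carrier \<Gamma>" if "x \<in> carrier \<Gamma>" "y \<in> carrier \<Gamma>" for x y
    using that by (auto elim!: carrier_E simp: cls_mult cls_carrier)
  show "x \<otimes>\<^bsub>\<Gamma>\<^esub> y \<otimes>\<^bsub>\<Gamma>\<^esub> z = x \<otimes>\<^bsub>\<Gamma>\<^esub> (y \<otimes>\<^bsub>\<Gamma>\<^esub> z)"
    if "x \<in> carrier \<Gamma>" "y \<in> carrier \<Gamma>" "z \<in> carrier \<Gamma>" for x y z
    using that by (auto elim!: carrier_E simp: cls_mult)
qed (auto elim!: carrier_E simp: cls_mult cls_one cls_carrier)

lemma cls_cons: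
  "v \<in> V \<Longrightarrow> g \<in> carrier (G v) \<Longrightarrow> w \<in> words \<Longrightarrow> cls ((v, g) # w) = cls [(v, g)] \<otimes>\<^bsub>\<Gamma>\<^esub> cls w"
  by (simp add: cls_mult)

lemma cls_inv_word:
  assumes "w \<in> words"
  shows "cls (inv_word w) \<otimes>\<^bsub>\<Gamma>\<^esub> cls w = \<one>\<^bsub>\<Gamma>\<^esub>"
  using assms
proof (induction w)
  case Nil
  then show ?case by (simp add: inv_word_def cls_one cls_mult)
next
  case (Cons a w)
  obtain v g where a: "a = (v, g)" by fastforce
  interpret monoid \<Gamma> by (rule monoid_graph_product)
  interpret Gv: group "G v" using Cons a vertex_group by simp
  have vg: "v \<in> V" "g \<in> carrier (G v)" "w \<in> words" using Cons.prems a by auto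
  have "cls (inv_word (a # w)) \<otimes>\<^bsub>\<Gamma>\<^esub> cls (a # w)
      = (cls (inv_word w) \<otimes>\<^bsub>\<Gamma>\<^esub> cls [(v, inv\<^bsub>G v\<^esub> g)]) \<otimes>\<^bsub>\<Gamma>\<^esub> (cls [(v, g)] \<otimes>\<^bsub>\<Gamma>\<^esub> cls w)"
    using vg by (simp add: a cls_cons[symmetric] cls_mult inv_word_words)
      (simp add: inv_word_def)
  also have "\<dots> = cls (inv_word w) \<otimes>\<^bsub>\<Gamma>\<^esub> ((cls [(v, inv\<^bsub>G v\<^esub> g)] \<otimes>\<^bsub>\<Gamma>\<^esub> cls [(v, g)]) \<otimes>\<^bsub>\<Gamma>\<^esub> cls w)"
    using vg by (simp add: m_assoc cls_carrier inv_word_words)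
  also have "\<dots> = cls (inv_word w) \<otimes>\<^bsub>\<Gamma>\<^esub> cls w"
    using vg by (simp add: cls_single_mult cls_single_one cls_carrier)
  finally show ?case using Cons.IH vg by simp
qed

lemma group_graph_product: "group \<Gamma>"
proof (rule monoid.group_l_invI[OF monoid_graph_product])
  show "\<exists>y\<in>carrier \<Gamma>. y \<otimes>\<^bsub>\<Gamma>\<^esub> x = \<one>\<^bsub>\<Gamma>\<^esub>" if "x \<in> carrier \<Gamma>" for x
    using that cls_inv_word inv_word_words cls_carrier by (metis carrier_E)
qed

sublocale gp: group \<Gamma> by (rule group_graph_product)

section \<open>Retractions to sets of vertices and projections to vertex groups\<close>

definition lift_word :: "(('v \<times> 'g) list \<Rightarrow> 'c) \<Rightarrow> ('v \<times> 'g) list set \<Rightarrow> 'c" where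
  "lift_word f A = f (rep A)"

text \<open>Since \<open>weq\<close> is generated by elementary steps between words in
  \<open>words\<close>, invariance under one step makes the value independent of the
  representative.\<close>

lemma lift_word_cls:
  assumes "\<And>x y. x \<in> words \<Longrightarrow> y \<in> words \<Longrightarrow> gp_step adj G x y \<Longrightarrow> f x = f y" "w \<in> words"
  shows "lift_word f (cls w) = f w"
  unfolding lift_word_def rep_def
  by (rule weq_invariant[OF weq_sym]) (use assms some_cls in auto)

abbreviation restr :: "'v set \<Rightarrow> ('v \<times> 'g) list \<Rightarrow> ('v \<times> 'g) list" where
  "restr F \<equiv> filter (\<lambda>(v, g). v \<in> F)"

lemma restr_words: "w \<in> words \<Longrightarrow> restr F w \<in> words"
  unfolding gp_words_def by auto

text \<open>The retraction is taken as an endomorphism of \<Gamma> rather than as a map to another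
  graph product, so that retractions for different sets of vertices compose and compare inside one
  group.\<close>

definition ret :: "'v set \<Rightarrow> ('v \<times> 'g) list set \<Rightarrow> ('v \<times> 'g) list set" where
  "ret F = lift_word (\<lambda>w. cls (restr F w))"

lemma ret_cls:
  assumes "w \<in> words" shows "ret F (cls w) = cls (restr F w)"
  unfolding ret_def
proof (rule lift_word_cls)
  fix x y assume xy: "x \<in> words" "y \<in> words" "gp_step adj G x y"
  \<comment> \<open>After deleting the letters outside \<open>F\<close>, a step is either still a
    step of the same kind or an equality; for a swap the latter occurs as soon as one of the two
    letters is deleted.\<close>
  from xy(3) have "restr F x = restr F y \<or> gp_step adj G (restr F x) (restr F y)"
    using gp_step.gp_one[of adj G] gp_step.gp_mult[of adj G] gp_step.gp_comm[of adj _ _ G]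
    by cases auto
  then show "cls (restr F x) = cls (restr F y)"
    using xy restr_words by (metis weq_step cls_eq_iff)
qed (use assms in auto)

lemma ret_hom: "ret F \<in> hom \<Gamma> \<Gamma>"
  by (auto intro!: homI elim!: carrier_E simp: ret_cls cls_mult cls_carrier restr_words)

lemma ret_group_hom: "group_hom \<Gamma> \<Gamma> (ret E)"
  by (simp add: group_hom_def group_hom_axioms_def gp.group_axioms ret_hom)

lemma ret_closed: "x \<in> carrier \<Gamma> \<Longrightarrow> ret F x \<in> carrier \<Gamma>"
  using ret_hom by (auto simp: hom_def)

lemma ret_ret:
  assumes "x \<in> carrier \<Gamma>" shows "ret F (ret F' x) = ret (F \<inter> F') x"
proof -
  have "restr F (restr F' w) = restr (F \<inter> F') w" for w :: "('v \<times> 'g) list"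
    by (induction w) auto
  then show ?thesis using assms by (auto elim!: carrier_E simp: ret_cls restr_words)
qed

lemma ret_empty: "x \<in> carrier \<Gamma> \<Longrightarrow> ret {} x = \<one>\<^bsub>\<Gamma>\<^esub>"
  by (auto elim!: carrier_E simp: ret_cls cls_one)

lemma finite_support:
  assumes "x \<in> carrier \<Gamma>"
  shows "\<exists>F. finite F \<and> F \<subseteq> V \<and> ret F x = x"
proof -
  obtain w where w: "w \<in> words" "x = cls w" using assms carrier_E by blast
  have "restr (fst ` set w) w = w" by (rule filter_True) force
  then have "ret (fst ` set w) x = x" using w by (simp add: ret_cls)
  moreover have "fst ` set w \<subseteq> V" using w by (auto simp: gp_words_def)
  ultimately show ?thesis by blast
qed

fun vmult :: "'v \<Rightarrow> ('v \<times> 'g) list \<Rightarrow> 'g" where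
  "vmult v [] = \<one>\<^bsub>G v\<^esub>"
| "vmult v ((u, g) # w) = (if u = v then g \<otimes>\<^bsub>G v\<^esub> vmult v w else vmult v w)"

lemma vmult_closed: "v \<in> V \<Longrightarrow> w \<in> words \<Longrightarrow> vmult v w \<in> carrier (G v)"
  by (induction v w rule: vmult.induct)
    (auto simp: vertex_group group.is_monoid monoid.one_closed monoid.m_closed)

lemma vmult_append:
  "v \<in> V \<Longrightarrow> w \<in> words \<Longrightarrow> w' \<in> words \<Longrightarrow> vmult v (w @ w') = vmult v w \<otimes>\<^bsub>G v\<^esub> vmult v w'"
  by (induction v w rule: vmult.induct)
    (auto simp: vertex_group group.is_monoid monoid.l_one monoid.m_assoc vmult_closed)

definition proj :: "'v \<Rightarrow> ('v \<times> 'g) list set \<Rightarrow> 'g" where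
  "proj v = lift_word (vmult v)"

lemma proj_cls:
  assumes "v \<in> V" "w \<in> words" shows "proj v (cls w) = vmult v w"
  unfolding proj_def
proof (rule lift_word_cls)
  fix x y assume xy: "x \<in> words" "y \<in> words" "gp_step adj G x y"
  interpret Gv: group "G v" using assms vertex_group by simp
  \<comment> \<open>No vertex is adjacent to itself, so a swap never exchanges two letters at
    \<open>v\<close>, and the order of the product in \<open>G v\<close> is preserved.\<close>
  have irr: "\<not> adj u u" for u using simple by (auto simp: simple_graph_def)
  from xy(3,1,2) show "vmult v x = vmult v y"
    by cases (use assms(1) irr in \<open>auto simp: vmult_append vmult_closed Gv.m_assoc\<close>)
qed (use assms in auto)

lemma proj_hom: "v \<in> V \<Longrightarrow> proj v \<in> hom \<Gamma> (G v)"
  by (auto intro!: homI elim!: carrier_E simp: proj_cls cls_mult vmult_append vmult_closed)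

end

section \<open>Normal forms in free products\<close>

text \<open>Normal forms in a free product of copies of one group \<open>H\<close> with index set
  \<open>I\<close>. One group suffices, because all factors will be conjugates of the same vertex
  group.\<close>

definition reduced_words :: "'i set \<Rightarrow> ('h, 'n) monoid_scheme \<Rightarrow> ('i \<times> 'h) list set" where
  "reduced_words I H = {w. (\<forall>(i, z)\<in>set w. i \<in> I \<and> z \<in> carrier H \<and> z \<noteq> \<one>\<^bsub>H\<^esub>) \<and> distinct_adj (map fst w)}"

text \<open>Van der Waerden's action of a factor on normal forms: left multiplication followed by
  reduction at the front.\<close>

fun lmul :: "('h, 'n) monoid_scheme \<Rightarrow> 'i \<times> 'h \<Rightarrow> ('i \<times> 'h) list \<Rightarrow> ('i \<times> 'h) list" where
  "lmul H (i, z) [] = (if z = \<one>\<^bsub>H\<^esub> then [] else [(i, z)])"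
| "lmul H (i, z) ((j, y) # w) =
    (if z = \<one>\<^bsub>H\<^esub> then (j, y) # w
     else if i \<noteq> j then (i, z) # (j, y) # w
     else if z \<otimes>\<^bsub>H\<^esub> y = \<one>\<^bsub>H\<^esub> then w else (i, z \<otimes>\<^bsub>H\<^esub> y) # w)"

lemma reduced_Nil [simp]: "[] \<in> reduced_words I H"
  by (simp add: reduced_words_def)

lemma reduced_Cons:
  "(i, z) # w \<in> reduced_words I H \<longleftrightarrow>
    i \<in> I \<and> z \<in> carrier H \<and> z \<noteq> \<one>\<^bsub>H\<^esub> \<and> w \<in> reduced_words I H \<and> (w = [] \<or> fst (hd w) \<noteq> i)"
  by (cases w) (auto simp: reduced_words_def)

lemma reduced_append:
  "u @ w \<in> reduced_words I H \<longleftrightarrow> u \<in> reduced_words I H \<and> w \<in> reduced_words I H \<and>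
    (u = [] \<or> w = [] \<or> fst (last u) \<noteq> fst (hd w))"
  by (auto simp: reduced_words_def distinct_adj_append_iff last_map hd_map)

context group
begin

lemma lmul_reduced:
  "w \<in> reduced_words I G \<Longrightarrow> i \<in> I \<Longrightarrow> z \<in> carrier G \<Longrightarrow> lmul G (i, z) w \<in> reduced_words I G"
  by (cases w) (auto simp: reduced_Cons)

lemma lmul_one: "lmul G (i, \<one>) w = w"
  by (cases w) auto

lemma lmul_Cons_reduced: "(i, z) # w \<in> reduced_words I G \<Longrightarrow> lmul G (i, z) w = (i, z) # w"
  by (cases w) (auto simp: reduced_Cons)

text \<open>Each factor thereby acts on reduced words. The critical case is cancellation of the
  first letter: the second multiplication then meets the next letter, which belongs to a different
  factor, so nothing further merges.\<close>

lemma lmul_lmul: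
  assumes "w \<in> reduced_words I G" "z \<in> carrier G" "y \<in> carrier G"
  shows "lmul G (i, z) (lmul G (i, y) w) = lmul G (i, z \<otimes> y) w"
proof (cases w)
  case Nil
  then show ?thesis using assms by auto
next
  case (Cons a w')
  obtain j x where a: "a = (j, x)" by fastforce
  have w': "w' = [] \<or> (\<exists>k t w''. w' = (k, t) # w'' \<and> k \<noteq> j)"
    using assms(1) unfolding Cons a reduced_Cons by (cases w') auto
  have x: "x \<in> carrier G" "x \<noteq> \<one>" using assms(1) unfolding Cons a reduced_Cons by auto
  show ?thesis
  proof (cases "i = j")
    case False
    then show ?thesis using assms by (auto simp: Cons a)
  next
    case True
    have *: "y \<otimes> x = \<one> \<Longrightarrow> z \<otimes> y \<otimes> x = z" "y \<otimes> x = \<one> \<Longrightarrow> z \<otimes> y = \<one> \<Longrightarrow> x = z"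
      using assms x by (simp add: m_assoc) (metis assms(2,3) x(1) inv_equality inv_inv inv_unique' local.inv_comm)
    have **: "z \<otimes> y = \<one> \<Longrightarrow> z \<otimes> (y \<otimes> x) = x"
      using assms x by (metis l_one m_assoc)
    from w' show ?thesis
      using True assms x * ** by (auto simp: Cons a m_assoc)
  qed
qed

lemma length_lmul: "length (lmul G (i, z) w) \<le> Suc (length w)"
  by (cases w) auto

text \<open>An injective relabelling sends distinct factors to distinct factors, so
  \<open>lmul\<close> takes the same branch; this serves for the translation of cosets.\<close>

lemma map_lmul:
  assumes "inj_on h I" "w \<in> reduced_words I G" "i \<in> I"
  shows "map (\<lambda>(i, z). (h i, z)) (lmul G (i, z) w) = lmul G (h i, z) (map (\<lambda>(i, z). (h i, z)) w)"
  using assms by (cases w) (auto simp: reduced_Cons inj_on_eq_iff)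

end

text \<open>Says that \<open>N\<close> is the free product of the copies \<iota> i of
  \<open>H\<close>, in the form in which the action on reduced words delivers it: \<open>nf\<close>
  becomes a bijection from \<open>N\<close> to the reduced words, inverse to evaluation. The map
  \<open>p\<close> folds all factors onto \<open>H\<close>, so its kernel contains no conjugate of a
  single nontrivial letter.\<close>

locale free_product_form = P: group P + H: group H
  for P :: "('p, 'k) monoid_scheme" (structure) and H :: "('h, 'n) monoid_scheme" +
  fixes N :: "'p set" and I :: "'i set" and \<iota> :: "'i \<Rightarrow> 'h \<Rightarrow> 'p"
    and nf :: "'p \<Rightarrow> ('i \<times> 'h) list" and p :: "'p \<Rightarrow> 'h"
  assumes subgroup_N: "subgroup N P"
    and \<iota>_hom: "i \<in> I \<Longrightarrow> \<iota> i \<in> hom H P"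
    and \<iota>_N: "i \<in> I \<Longrightarrow> z \<in> carrier H \<Longrightarrow> \<iota> i z \<in> N"
    and nf_reduced: "x \<in> N \<Longrightarrow> nf x \<in> reduced_words I H"
    and nf_one: "nf \<one> = []"
    and nf_\<iota>: "i \<in> I \<Longrightarrow> z \<in> carrier H \<Longrightarrow> x \<in> N \<Longrightarrow> nf (\<iota> i z \<otimes> x) = lmul H (i, z) (nf x)"
    and ev_nf: "x \<in> N \<Longrightarrow> foldr (\<lambda>(i, z) r. \<iota> i z \<otimes> r) (nf x) \<one> = x"
    and p_hom: "p \<in> hom P H"
    and p_\<iota>: "i \<in> I \<Longrightarrow> z \<in> carrier H \<Longrightarrow> p (\<iota> i z) = z"
begin

section \<open>Word length of elements and of their powers\<close>

definition ev :: "('i \<times> 'h) list \<Rightarrow> 'p" where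
  "ev w = foldr (\<lambda>(i, z) r. \<iota> i z \<otimes> r) w \<one>"

abbreviation "lists_over \<equiv> {w. \<forall>(i, z)\<in>set w. i \<in> I \<and> z \<in> carrier H}"

lemma reduced_lists: "w \<in> reduced_words I H \<Longrightarrow> w \<in> lists_over"
  by (auto simp: reduced_words_def)

lemma ev_simps [simp]: "ev [] = \<one>" "ev ((i, z) # w) = \<iota> i z \<otimes> ev w"
  by (simp_all add: ev_def)

lemma N_carrier: "x \<in> N \<Longrightarrow> x \<in> carrier P"
  using subgroup_N subgroup.mem_carrier by metis

lemma ev_N: "w \<in> lists_over \<Longrightarrow> ev w \<in> N"
  by (induction w) (auto simp: subgroup.one_closed[OF subgroup_N] intro!: subgroup.m_closed[OF subgroup_N] \<iota>_N)

lemma \<iota>_carrier: "i \<in> I \<Longrightarrow> z \<in> carrier H \<Longrightarrow> \<iota> i z \<in> carrier P"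
  using N_carrier \<iota>_N by blast

lemma ev_carrier: "w \<in> lists_over \<Longrightarrow> ev w \<in> carrier P"
  using N_carrier ev_N by blast

lemma ev_append: "u \<in> lists_over \<Longrightarrow> w \<in> lists_over \<Longrightarrow> ev (u @ w) = ev u \<otimes> ev w"
  by (induction u) (auto simp: P.m_assoc ev_carrier \<iota>_carrier)

lemma nf_ev: "w \<in> reduced_words I H \<Longrightarrow> nf (ev w) = w"
proof (induction w)
  case (Cons a w)
  obtain i z where a: "a = (i, z)" by fastforce
  then show ?case
    using Cons H.lmul_Cons_reduced[of i z w I] reduced_lists[of w] unfolding a reduced_Cons
    by (simp add: nf_\<iota> ev_N)
qed (simp add: nf_one)

lemma ev_nf': "x \<in> N \<Longrightarrow> ev (nf x) = x"
  using ev_nf by (simp add: ev_def)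

definition len :: "'p \<Rightarrow> nat" where "len x = length (nf x)"

lemma len_ev_mult: "w \<in> lists_over \<Longrightarrow> x \<in> N \<Longrightarrow> len (ev w \<otimes> x) \<le> length w + len x"
proof (induction w)
  case (Cons a w)
  obtain i z where a: "a = (i, z)" by fastforce
  have iz: "i \<in> I" "z \<in> carrier H" "w \<in> lists_over" using Cons.prems a by auto
  have "ev (a # w) \<otimes> x = \<iota> i z \<otimes> (ev w \<otimes> x)"
    using iz Cons.prems by (simp add: a P.m_assoc ev_carrier \<iota>_carrier N_carrier)
  moreover have "ev w \<otimes> x \<in> N"
    using iz Cons.prems ev_N subgroup.m_closed[OF subgroup_N] by blast
  ultimately have "nf (ev (a # w) \<otimes> x) = lmul H (i, z) (nf (ev w \<otimes> x))"
    using iz nf_\<iota> by simp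
  then show ?case
    using Cons iz H.length_lmul[of i z "nf (ev w \<otimes> x)"] by (simp add: len_def)
qed (simp add: N_carrier)

lemma len_mult: "x \<in> N \<Longrightarrow> y \<in> N \<Longrightarrow> len (x \<otimes> y) \<le> len x + len y"
  using len_ev_mult[OF reduced_lists[OF nf_reduced], of x y] by (simp add: ev_nf' len_def)

lemma \<iota>_one: "i \<in> I \<Longrightarrow> \<iota> i \<one>\<^bsub>H\<^esub> = \<one>"
  using \<iota>_hom hom_one P.group_axioms H.group_axioms by metis

lemma \<iota>_mult:
  "i \<in> I \<Longrightarrow> z \<in> carrier H \<Longrightarrow> y \<in> carrier H \<Longrightarrow> \<iota> i (z \<otimes>\<^bsub>H\<^esub> y) = \<iota> i z \<otimes> \<iota> i y"
  using \<iota>_hom by (auto simp: hom_def)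

lemma ev_inv_word:
  "w \<in> lists_over \<Longrightarrow> ev (rev (map (\<lambda>(i, z). (i, inv\<^bsub>H\<^esub> z)) w)) \<otimes> ev w = \<one>"
proof (induction w)
  case (Cons a w)
  obtain i z where a: "a = (i, z)" by fastforce
  let ?r = "rev (map (\<lambda>(i, z). (i, inv\<^bsub>H\<^esub> z)) w)"
  have iz: "i \<in> I" "z \<in> carrier H" "w \<in> lists_over" using Cons.prems a by auto
  have r: "?r \<in> lists_over" using iz by auto
  have "ev (?r @ [(i, inv\<^bsub>H\<^esub> z)]) = ev ?r \<otimes> \<iota> i (inv\<^bsub>H\<^esub> z)"
    using iz r ev_append[OF r, of "[(i, inv\<^bsub>H\<^esub> z)]"] by (simp add: \<iota>_carrier)
  then have "ev (rev (map (\<lambda>(i, z). (i, inv\<^bsub>H\<^esub> z)) (a # w))) \<otimes> ev (a # w)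
      = ev ?r \<otimes> ((\<iota> i (inv\<^bsub>H\<^esub> z) \<otimes> \<iota> i z) \<otimes> ev w)"
    using iz ev_carrier[OF r] ev_carrier[OF iz(3)] by (simp add: a P.m_assoc \<iota>_carrier)
  also have "\<dots> = ev ?r \<otimes> ev w"
    using iz by (simp add: \<iota>_mult[symmetric] \<iota>_one ev_carrier)
  finally show ?case using Cons.IH iz by simp
qed simp

text \<open>Reversing the word and inverting its letters evaluates to the inverse, and
  \<open>len_ev_mult\<close> bounds the length of whatever a word evaluates to.\<close>

lemma len_inv: "x \<in> N \<Longrightarrow> len (inv x) \<le> len x"
proof -
  assume x: "x \<in> N"
  let ?r = "rev (map (\<lambda>(i, z). (i, inv\<^bsub>H\<^esub> z)) (nf x))"
  have n: "nf x \<in> lists_over" using x nf_reduced reduced_lists by blast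
  then have r: "?r \<in> lists_over" by auto
  have "ev ?r \<otimes> x = \<one>" using ev_inv_word[OF n] ev_nf'[OF x] by simp
  then have "inv x = ev ?r" using P.inv_equality N_carrier[OF x] ev_carrier[OF r] by blast
  then show ?thesis
    using len_ev_mult[OF r subgroup.one_closed[OF subgroup_N]] ev_carrier[OF r]
    by (simp add: len_def nf_one)
qed

lemma p_closed: "x \<in> carrier P \<Longrightarrow> p x \<in> carrier H"
  using p_hom by (auto simp: hom_def)

text \<open>The inverse is a separate element \<open>b\<close>, so that two mutually inverse letters
  of a word can be substituted for \<open>a\<close> and \<open>b\<close>.\<close>

lemma conj_pow:
  assumes "a \<in> carrier P" "b \<in> carrier P" "x \<in> carrier P" "a \<otimes> b = \<one>"
  shows "(a \<otimes> (x \<otimes> b)) [^] n = a \<otimes> (x [^] (n::nat) \<otimes> b)"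
proof (induction n)
  case (Suc n)
  have ba: "b \<otimes> a = \<one>" using assms P.inv_comm by blast
  have "x [^] n \<otimes> b \<otimes> (a \<otimes> (x \<otimes> b)) = x [^] n \<otimes> (b \<otimes> a) \<otimes> (x \<otimes> b)"
    using assms by (simp add: P.m_assoc del: P.inv_comm)
  then show ?case using Suc assms by (simp add: P.m_assoc ba)
qed (use assms in simp)

text \<open>A reduced word is conjugated, one outer letter at a time, into a cyclically reduced one, whose
  powers do not cancel; the kernel of \<open>p\<close> excludes the case of a single letter.\<close>
lemma nf_pow:
  assumes "w \<in> reduced_words I H" "w \<noteq> []" "p (ev w) = \<one>\<^bsub>H\<^esub>" "n \<ge> 1"
  shows "nf (ev w [^] n) \<noteq> [] \<and> hd (nf (ev w [^] n)) = hd w \<and> last (nf (ev w [^] n)) = last w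
    \<and> length (nf (ev w [^] n)) \<ge> n \<and> length (nf (ev w [^] n)) \<ge> length w"
  using assms(1-3)
proof (induction "length w" arbitrary: w rule: less_induct)
  case less
  obtain i g w' where w: "w = (i, g) # w'"
    using less.prems(2) by (cases w) auto
  have ig: "i \<in> I" "g \<in> carrier H" "g \<noteq> \<one>\<^bsub>H\<^esub>" "w' \<in> reduced_words I H"
    using less.prems(1) by (auto simp: w reduced_Cons)
  \<comment> \<open>\<open>p\<close> sends a single letter with entry \<open>g\<close> to
    \<open>g\<close>, which is nontrivial.\<close>
  have "w' \<noteq> []"
    using less.prems(3) ig by (auto simp: w \<iota>_carrier p_\<iota>)
  then obtain u j h where w': "w' = u @ [(j, h)]"
    by (metis rev_exhaust surj_pair)
  have jh: "j \<in> I" "h \<in> carrier H" "h \<noteq> \<one>\<^bsub>H\<^esub>" "u \<in> reduced_words I H"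
    using ig(4) by (auto simp: w' reduced_append reduced_Cons)
  have ul: "u \<in> lists_over" using jh(4) reduced_lists by blast
  have evu: "ev u \<in> carrier P" using ul ev_carrier by blast
  have evw: "ev w = \<iota> i g \<otimes> (ev u \<otimes> \<iota> j h)"
    using ig jh ul ev_append[OF ul, of "[(j, h)]"] by (simp add: w w' \<iota>_carrier)
  show ?case
  proof (cases "i = j")
    \<comment> \<open>The outer letters lie in different factors, so copies of \<open>w\<close> can
      be put next to each other without any reduction.\<close>
    case False
    define c where "c = (\<lambda>n. concat (replicate n w))"
    have c: "c n \<in> reduced_words I H \<and> ev w [^] n = ev (c n) \<and> length (c n) = n * length w
        \<and> (n \<ge> 1 \<longrightarrow> c n \<noteq> [] \<and> hd (c n) = hd w \<and> last (c n) = last w)" for n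
    proof (induction n)
      case (Suc n)
      have *: "c (Suc n) = c n @ w" unfolding c_def by (simp flip: replicate_append_same)
      have "fst (last w) \<noteq> fst (hd w)" using False by (simp add: w w')
      then have "c (Suc n) \<in> reduced_words I H"
        using Suc less.prems(1) by (cases n) (auto simp: * reduced_append c_def)
      moreover have "ev w [^] Suc n = ev (c (Suc n))"
        using Suc less.prems(1) reduced_lists by (simp add: * ev_append del: mem_Collect_eq)
      ultimately show ?case
        using Suc less.prems(2) by (cases n) (auto simp: * c_def)
    qed (simp add: c_def)
    have "n * 1 \<le> n * length w" "1 * length w \<le> n * length w"
      using assms(4) less.prems(2) by (auto simp: Suc_le_eq intro: mult_le_mono)
    then show ?thesis using c[of n] nf_ev[of "c n"] assms(4) by simp
  next
    case True
    have une: "u \<noteq> []" using less.prems(1) True by (auto simp: w w' reduced_Cons)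
    have hu: "fst (hd u) \<noteq> i" "fst (last u) \<noteq> i"
      using less.prems(1) une True by (auto simp: w w' reduced_Cons reduced_append)
    show ?thesis
    proof (cases "g \<otimes>\<^bsub>H\<^esub> h = \<one>\<^bsub>H\<^esub>")
      \<comment> \<open>The outer letters are mutually inverse: \<open>w\<close> is a conjugate of
        the shorter \<open>u\<close>, which is again killed by \<open>p\<close>. The induction claim
        on first and last letters ensures that the letters put back around the power of
        \<open>u\<close> neither cancel nor merge.\<close>
      case gh: True
      then have \<iota>gh: "\<iota> i g \<otimes> \<iota> i h = \<one>" using ig jh by (simp add: \<iota>_mult[symmetric] \<iota>_one)
      have "\<one>\<^bsub>H\<^esub> = g \<otimes>\<^bsub>H\<^esub> (p (ev u) \<otimes>\<^bsub>H\<^esub> h)"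
        using less.prems(3) p_hom ig jh evu True by (simp add: evw hom_mult \<iota>_carrier p_\<iota>)
      then have "p (ev u) \<otimes>\<^bsub>H\<^esub> h = \<one>\<^bsub>H\<^esub> \<otimes>\<^bsub>H\<^esub> h"
        using gh ig jh p_closed[OF evu] by (metis H.l_cancel H.l_one H.m_closed)
      then have pu: "p (ev u) = \<one>\<^bsub>H\<^esub>"
        using jh p_closed[OF evu] by (metis H.one_closed H.r_cancel)
      let ?x = "nf (ev u [^] n)"
      have IH: "?x \<noteq> []" "hd ?x = hd u" "last ?x = last u" "n \<le> length ?x" "length u \<le> length ?x"
        using less.hyps[of u] jh(4) une pu by (auto simp: w w')
      have uN: "ev u [^] n \<in> N"
        using subgroup.m_closed[OF subgroup_N] subgroup.one_closed[OF subgroup_N] ev_N[OF ul]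
        by (induction n) auto
      have xr: "?x \<in> reduced_words I H" using uN nf_reduced by blast
      let ?y = "(i, g) # ?x @ [(i, h)]"
      have "?y \<in> reduced_words I H"
        using xr ig jh IH hu True by (auto simp: reduced_Cons reduced_append)
      moreover have "ev w [^] n = ev ?y"
        using conj_pow[OF _ _ evu \<iota>gh, of n] ig jh True ev_nf'[OF uN] reduced_lists[OF xr]
          ev_append[OF reduced_lists[OF xr], of "[(i, h)]"]
        by (simp add: evw \<iota>_carrier)
      ultimately show ?thesis
        using IH True nf_ev[of ?y] by (simp add: w w')
    next
      \<comment> \<open>At each seam \<open>h\<close> and \<open>g\<close> merge into the nontrivial
        letter \<open>m\<close>; the power is \<open>g\<close>, then copies of \<open>u\<close>
        separated by \<open>m\<close>, then \<open>h\<close>.\<close>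
      case gh: False
      define m where "m = h \<otimes>\<^bsub>H\<^esub> g"
      have m: "m \<in> carrier H" "m \<noteq> \<one>\<^bsub>H\<^esub>"
        using gh ig jh H.inv_comm by (auto simp: m_def)
      define c where "c = (\<lambda>n. u @ concat (replicate n ((i, m) # u)))"
      have c: "c n \<in> reduced_words I H \<and> ev w [^] Suc n = \<iota> i g \<otimes> (ev (c n) \<otimes> \<iota> i h)
        \<and> length (c n) = length u + n * Suc (length u)
        \<and> c n \<noteq> [] \<and> hd (c n) = hd u \<and> last (c n) = last u" for n
      proof (induction n)
        case 0
        show ?case using une jh evw evu ig True by (simp add: c_def \<iota>_carrier)
      next
        case (Suc n)
        have *: "c (Suc n) = c n @ (i, m) # u"
          unfolding c_def by (simp flip: replicate_append_same)
        have cl: "c n \<in> lists_over" using Suc reduced_lists by blast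
        have evc: "ev (c n) \<in> carrier P" using cl ev_carrier by blast
        have "c (Suc n) \<in> reduced_words I H"
          using Suc ig jh m hu by (auto simp: * reduced_append reduced_Cons)
        moreover have "ev w [^] Suc (Suc n) = \<iota> i g \<otimes> (ev (c (Suc n)) \<otimes> \<iota> i h)"
        proof -
          have "ev (c (Suc n)) = ev (c n) \<otimes> (\<iota> i m \<otimes> ev u)"
            using ev_append[OF cl, of "(i, m) # u"] ul ig m by (auto simp: *)
          moreover have "\<iota> i m = \<iota> i h \<otimes> \<iota> i g" using ig jh by (simp add: m_def \<iota>_mult)
          moreover have "ev w [^] Suc (Suc n) = ev w [^] Suc n \<otimes> ev w" by simp
          ultimately show ?thesis
            using Suc evw ig jh True evc evu by (simp add: P.m_assoc \<iota>_carrier del: P.nat_pow_Suc)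
        qed
        ultimately show ?case
          using Suc une by (simp add: *)
      qed
      \<comment> \<open>\<open>n\<close> copies of \<open>u\<close> have \<open>n - 1\<close>
        separators.\<close>
      let ?y = "(i, g) # c (n - 1) @ [(i, h)]"
      have "?y \<in> reduced_words I H"
        using c[of "n - 1"] ig jh hu True by (auto simp: reduced_append reduced_Cons)
      moreover have "ev w [^] n = ev ?y"
        using c[of "n - 1"] assms(4) ig jh True ev_append[of "c (n - 1)" "[(i, h)]"]
          reduced_lists[of "c (n - 1)"]
        by (simp add: \<iota>_carrier del: P.nat_pow_Suc)
      moreover have "length (c (n - 1)) \<ge> length u \<and> length (c (n - 1)) \<ge> n - 1"
        using c[of "n - 1"] by simp
      ultimately show ?thesis
        using True nf_ev[of ?y] assms(4) by (auto simp: w w')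
    qed
  qed
qed

lemma len_pow:
  assumes "x \<in> N" "p x = \<one>\<^bsub>H\<^esub>" "x \<noteq> \<one>" "n \<ge> 1"
  shows "len (x [^] n) \<ge> n \<and> len (x [^] n) \<ge> len x"
proof -
  have "nf x \<noteq> []" using ev_nf'[OF assms(1)] assms(3) by (metis ev_simps(1))
  then show ?thesis
    using nf_pow[OF nf_reduced[OF assms(1)] _ _ assms(4)] assms(2) ev_nf'[OF assms(1)]
    by (simp add: len_def)
qed

end

section \<open>Adding a vertex to a graph product\<close>

context graph_of_groups
begin

context
  fixes v :: 'v and F :: "'v set"
  assumes v: "v \<in> V" and v_notin: "v \<notin> F"
begin

interpretation Gv: group "G v" by (rule vertex_group[OF v])

section \<open>Cosets of the link and the action of words on reduced words\<close>

definition spanned :: "'v set \<Rightarrow> ('v \<times> 'g) list set set" where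
  "spanned E = {cls w |w. w \<in> words \<and> fst ` set w \<subseteq> E}"

text \<open>The part of the link of \<open>v\<close> inside \<open>F\<close>. It commutes with the
  letters at \<open>v\<close>, so conjugates of \<open>G v\<close> by elements of
  \<open>spanned F\<close> depend only on the coset of \<open>LK\<close>; these cosets index the
  free factors.\<close>

definition "LK = spanned (F \<inter> {u. adj v u})"

definition shift :: "('v \<times> 'g) list set \<Rightarrow> ('v \<times> 'g) list set set \<Rightarrow> ('v \<times> 'g) list set set" where
  "shift a C = (\<lambda>x. a \<otimes>\<^bsub>\<Gamma>\<^esub> x) ` C"

definition "cosets = (\<lambda>a. shift a LK) ` spanned F"

definition conj_copy :: "('v \<times> 'g) list set set \<Rightarrow> 'g \<Rightarrow> ('v \<times> 'g) list set" where
  "conj_copy C z = (let a = SOME a. a \<in> C in a \<otimes>\<^bsub>\<Gamma>\<^esub> (cls [(v, z)] \<otimes>\<^bsub>\<Gamma>\<^esub> inv\<^bsub>\<Gamma>\<^esub> a))"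

abbreviation "shifts a \<equiv> map (\<lambda>(C, z). (shift a C, z))"

text \<open>Models the subgroup spanned by \<open>insert v F\<close> acting on the kernel of the
  retraction to \<open>F\<close>: \<open>G v\<close> by left multiplication with the factor indexed
  by \<open>LK\<close>, vertices of \<open>F\<close> by conjugation, which permutes the factors as
  left translation permutes the cosets. Other vertices act trivially, as the retraction to
  \<open>insert v F\<close> deletes them.\<close>

definition act1 :: "'v \<times> 'g \<Rightarrow> (('v \<times> 'g) list set set \<times> 'g) list
    \<Rightarrow> (('v \<times> 'g) list set set \<times> 'g) list" where
  "act1 = (\<lambda>(u, g) x. if u = v then lmul (G v) (LK, g) x
     else if u \<in> F then shifts (cls [(u, g)]) x else x)"

definition "act w x = foldr act1 w x"

definition "eval_copies x = foldr (\<lambda>(C, z) r. conj_copy C z \<otimes>\<^bsub>\<Gamma>\<^esub> r) x \<one>\<^bsub>\<Gamma>\<^esub>"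

abbreviation "RW \<equiv> reduced_words cosets (G v)"

lemma spanned_carrier: "spanned E \<subseteq> carrier \<Gamma>"
  by (auto simp: spanned_def cls_carrier)

lemma spanned_mult: "a \<in> spanned E \<Longrightarrow> b \<in> spanned E \<Longrightarrow> a \<otimes>\<^bsub>\<Gamma>\<^esub> b \<in> spanned E"
  unfolding spanned_def by (clarsimp simp: cls_mult) (metis Un_least image_Un set_append words_simps(3))

lemma spanned_one: "\<one>\<^bsub>\<Gamma>\<^esub> \<in> spanned E"
  unfolding spanned_def by (auto simp: cls_one intro!: exI[of _ "[]"])

lemma spanned_single: "u \<in> E \<Longrightarrow> u \<in> V \<Longrightarrow> g \<in> carrier (G u) \<Longrightarrow> cls [(u, g)] \<in> spanned E"
  unfolding spanned_def by (auto intro!: exI[of _ "[(u, g)]"])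

lemma shift_shift:
  "a \<in> carrier \<Gamma> \<Longrightarrow> b \<in> carrier \<Gamma> \<Longrightarrow> C \<subseteq> carrier \<Gamma> \<Longrightarrow> shift a (shift b C) = shift (a \<otimes>\<^bsub>\<Gamma>\<^esub> b) C"
  unfolding shift_def image_image by (rule image_cong) (auto simp: gp.m_assoc)

lemma shift_one: "C \<subseteq> carrier \<Gamma> \<Longrightarrow> shift \<one>\<^bsub>\<Gamma>\<^esub> C = C"
  unfolding shift_def by force

lemma shift_carrier: "a \<in> carrier \<Gamma> \<Longrightarrow> C \<subseteq> carrier \<Gamma> \<Longrightarrow> shift a C \<subseteq> carrier \<Gamma>"
  unfolding shift_def by auto

lemma LK_carrier: "LK \<subseteq> carrier \<Gamma>"
  unfolding LK_def by (rule spanned_carrier)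

lemma cosets_iff: "C \<in> cosets \<longleftrightarrow> (\<exists>a\<in>spanned F. C = shift a LK)"
  by (auto simp: cosets_def)

lemma cosets_carrier: "C \<in> cosets \<Longrightarrow> C \<subseteq> carrier \<Gamma>"
  unfolding cosets_iff using LK_carrier spanned_carrier shift_carrier by blast

lemma inj_shift: "a \<in> carrier \<Gamma> \<Longrightarrow> inj_on (shift a) (Pow (carrier \<Gamma>))"
  by (rule inj_on_inverseI[where g = "shift (inv\<^bsub>\<Gamma>\<^esub> a)"]) (simp add: shift_shift shift_one)

lemma inj_shift_cosets: "a \<in> carrier \<Gamma> \<Longrightarrow> inj_on (shift a) cosets"
  by (rule inj_on_subset[OF inj_shift]) (use cosets_carrier in auto)

lemma shift_cosets: "a \<in> spanned F \<Longrightarrow> C \<in> cosets \<Longrightarrow> shift a C \<in> cosets"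
proof -
  assume a: "a \<in> spanned F" and "C \<in> cosets"
  then obtain b where b: "b \<in> spanned F" "C = shift b LK" by (auto simp: cosets_iff)
  then have "shift a C = shift (a \<otimes>\<^bsub>\<Gamma>\<^esub> b) LK"
    using a spanned_carrier LK_carrier by (simp add: shift_shift subset_iff)
  then show ?thesis using spanned_mult[OF a b(1)] cosets_iff by blast
qed

lemma LK_coset: "LK \<in> cosets"
  unfolding cosets_iff using spanned_one shift_one[OF LK_carrier] by metis

lemma shifts_reduced:
  assumes "a \<in> spanned F" "x \<in> RW" shows "shifts a x \<in> RW"
  using assms(2)
proof (induction x)
  case (Cons c x)
  obtain C z where c: "c = (C, z)" by fastforce
  have inj: "inj_on (shift a) cosets" using assms(1) spanned_carrier inj_shift_cosets by blast
  have "x = [] \<or> shift a (fst (hd x)) \<noteq> shift a C"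
    using Cons.prems inj unfolding c by (cases x) (auto simp: reduced_Cons inj_on_eq_iff)
  then show ?case
    using Cons shift_cosets[OF assms(1)] unfolding c by (cases x) (auto simp: reduced_Cons)
qed simp

lemma act1_reduced:
  assumes "u \<in> V" "g \<in> carrier (G u)" "x \<in> RW" shows "act1 (u, g) x \<in> RW"
  using assms Gv.lmul_reduced[OF assms(3) LK_coset] shifts_reduced spanned_single
  by (auto simp: act1_def)

lemma act_simps: "act [] x = x" "act (a # w) x = act1 a (act w x)" "act (w @ w') x = act w (act w' x)"
  by (simp_all add: act_def)

lemma act_reduced: "w \<in> words \<Longrightarrow> x \<in> RW \<Longrightarrow> act w x \<in> RW"
  by (induction w) (auto simp: act_simps act1_reduced)

lemma RW_mem: "x \<in> RW \<Longrightarrow> (C, z) \<in> set x \<Longrightarrow> C \<subseteq> carrier \<Gamma> \<and> C \<in> cosets \<and> z \<in> carrier (G v)"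
  using cosets_carrier unfolding reduced_words_def by blast

lemma shifts_shifts:
  assumes "a \<in> carrier \<Gamma>" "b \<in> carrier \<Gamma>" "x \<in> RW"
  shows "shifts a (shifts b x) = shifts (a \<otimes>\<^bsub>\<Gamma>\<^esub> b) x"
  using assms RW_mem[OF assms(3)] by (auto simp: shift_shift)

lemma shifts_one: "x \<in> RW \<Longrightarrow> shifts \<one>\<^bsub>\<Gamma>\<^esub> x = x"
  using RW_mem by (auto simp: shift_one intro!: map_idI)

text \<open>The letter and its inverse both belong to \<open>LK\<close>, which is closed under
  products; this gives the two inclusions.\<close>

lemma shift_LK:
  assumes "u \<in> F" "adj v u" "g \<in> carrier (G u)" shows "shift (cls [(u, g)]) LK = LK"
proof -
  have u: "u \<in> V" using assms simple by (auto simp: simple_graph_def)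
  have *: "shift (cls [(u, h)]) LK \<subseteq> LK" if "h \<in> carrier (G u)" for h
    using spanned_mult[OF spanned_single[OF _ u that]] assms by (auto simp: shift_def LK_def)
  interpret Gu: group "G u" using vertex_group u by blast
  have "LK = shift (cls [(u, g)]) (shift (cls [(u, inv\<^bsub>G u\<^esub> g)]) LK)"
    using assms u LK_carrier
    by (simp add: shift_shift cls_carrier cls_single_mult cls_single_one shift_one)
  also have "\<dots> \<subseteq> shift (cls [(u, g)]) LK"
    using *[of "inv\<^bsub>G u\<^esub> g"] assms unfolding shift_def by (intro image_mono) auto
  finally show ?thesis using *[OF assms(3)] by blast
qed

lemma shifts_lmul:
  "a \<in> carrier \<Gamma> \<Longrightarrow> x \<in> RW \<Longrightarrow> C \<in> cosets
    \<Longrightarrow> shifts a (lmul (G v) (C, z) x) = lmul (G v) (shift a C, z) (shifts a x)"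
  by (rule Gv.map_lmul[OF inj_shift_cosets])

text \<open>A vertex adjacent to \<open>v\<close> either lies in \<open>F\<close>, where shifting by
  its letters fixes the index \<open>LK\<close> and so commutes with multiplying at
  \<open>LK\<close>, or acts trivially.\<close>

lemma act1_commute_v:
  assumes "adj v u" "g \<in> carrier (G v)" "h \<in> carrier (G u)" "x \<in> RW"
  shows "act1 (v, g) (act1 (u, h) x) = act1 (u, h) (act1 (v, g) x)"
proof -
  have "u \<in> V" "u \<noteq> v" using assms(1) simple by (auto simp: simple_graph_def)
  then show ?thesis
    using assms shift_LK shifts_lmul[OF cls_carrier assms(4) LK_coset, of "[(u, h)]"]
    by (auto simp: act1_def)
qed

lemma act1_commute:
  assumes "adj u u'" "g \<in> carrier (G u)" "h \<in> carrier (G u')" "x \<in> RW"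
  shows "act1 (u, g) (act1 (u', h) x) = act1 (u', h) (act1 (u, g) x)"
proof -
  have adj: "adj u' u" "u \<in> V" "u' \<in> V" using assms(1) simple by (auto simp: simple_graph_def)
  consider "u = v" | "u' = v" | "u \<noteq> v" "u' \<noteq> v" by blast
  then show ?thesis
  proof cases
    case 3
    then show ?thesis
      using adj assms cls_single_commute[OF assms(1)]
      by (simp add: act1_def shifts_shifts cls_carrier del: map_map)
  qed (use assms adj act1_commute_v[of u h g] act1_commute_v[of u' g h] in auto)
qed

text \<open>\<open>lmul\<close> and \<open>shifts\<close> are actions of the vertex groups, and
  adjacent vertices act by commuting maps; so the action of words factors through \<Gamma>. This
  makes normal forms well defined.\<close>

lemma act_step:
  assumes "x \<in> RW" "w \<in> words" "w' \<in> words" "gp_step adj G w w'"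
  shows "act w x = act w' x"
  using assms(4,2,3)
proof cases
  case (gp_one xs u ys)
  interpret Gu: group "G u" using gp_one assms vertex_group by simp
  have "act ys x \<in> RW" using act_reduced gp_one assms by simp
  then show ?thesis
    using gp_one assms
    by (simp add: act_simps act1_def Gv.lmul_one cls_single_one shifts_one)
next
  case (gp_mult xs u g h ys)
  then have u: "u \<in> V" "g \<in> carrier (G u)" "h \<in> carrier (G u)" using assms by auto
  have "act ys x \<in> RW" using act_reduced gp_mult assms by simp
  then have "act1 (u, g) (act1 (u, h) (act ys x)) = act1 (u, g \<otimes>\<^bsub>G u\<^esub> h) (act ys x)"
    using u by (cases "u = v") (simp_all add: act1_def Gv.lmul_lmul shifts_shifts cls_carrier cls_single_mult del: map_map)
  then show ?thesis using gp_mult by (simp add: act_simps)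
next
  case (gp_comm u u' xs g h ys)
  then have "act ys x \<in> RW" using act_reduced assms by simp
  then show ?thesis using gp_comm assms act1_commute[of u u' g h "act ys x"] by (simp add: act_simps)
qed

lemma act_weq: "x \<in> RW \<Longrightarrow> weq w w' \<Longrightarrow> act w x = act w' x"
  by (rule weq_invariant[where f = "\<lambda>w. act w x"]) (auto intro: act_step)

section \<open>Evaluation of reduced words in the graph product\<close>

lemma LK_commute:
  assumes "l \<in> LK" "z \<in> carrier (G v)"
  shows "l \<otimes>\<^bsub>\<Gamma>\<^esub> cls [(v, z)] = cls [(v, z)] \<otimes>\<^bsub>\<Gamma>\<^esub> l"
proof -
  have "cls w \<otimes>\<^bsub>\<Gamma>\<^esub> cls [(v, z)] = cls [(v, z)] \<otimes>\<^bsub>\<Gamma>\<^esub> cls w"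
    if "w \<in> words" "fst ` set w \<subseteq> {u. adj v u}" for w
    using that
  proof (induction w)
    case Nil
    then show ?case using assms v by (simp add: cls_mult)
  next
    case (Cons a w)
    obtain u g where a: "a = (u, g)" by fastforce
    have *: "u \<in> V" "g \<in> carrier (G u)" "w \<in> words" "adj v u" using Cons.prems a by auto
    have c: "cls [(v, z)] \<in> carrier \<Gamma>" "cls [(u, g)] \<in> carrier \<Gamma>" "cls w \<in> carrier \<Gamma>"
      using * v assms by (auto intro: cls_carrier)
    have IH: "cls w \<otimes>\<^bsub>\<Gamma>\<^esub> cls [(v, z)] = cls [(v, z)] \<otimes>\<^bsub>\<Gamma>\<^esub> cls w"
      using Cons.IH[OF *(3)] Cons.prems(2) by simp
    have "cls (a # w) \<otimes>\<^bsub>\<Gamma>\<^esub> cls [(v, z)]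
        = cls [(u, g)] \<otimes>\<^bsub>\<Gamma>\<^esub> (cls [(v, z)] \<otimes>\<^bsub>\<Gamma>\<^esub> cls w)"
      unfolding a cls_cons[OF *(1-3)] using c by (simp add: gp.m_assoc IH)
    also have "\<dots> = cls [(v, z)] \<otimes>\<^bsub>\<Gamma>\<^esub> cls (a # w)"
      unfolding a cls_cons[OF *(1-3)] using c cls_single_commute[OF *(4) assms(2) *(2)]
      by (simp flip: gp.m_assoc)
    finally show ?case .
  qed
  then show ?thesis using assms(1) by (auto simp: spanned_def LK_def)
qed

text \<open>The coset representative picked by \<open>conj_copy\<close> differs from
  \<open>a\<close> by an element of \<open>LK\<close>, which commutes with the letters at
  \<open>v\<close> and cancels in the conjugate.\<close>

lemma conj_copy_shift:
  assumes "a \<in> carrier \<Gamma>" "z \<in> carrier (G v)"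
  shows "conj_copy (shift a LK) z = a \<otimes>\<^bsub>\<Gamma>\<^esub> (cls [(v, z)] \<otimes>\<^bsub>\<Gamma>\<^esub> inv\<^bsub>\<Gamma>\<^esub> a)"
proof -
  let ?b = "SOME b. b \<in> shift a LK"
  have "a \<in> shift a LK" using assms spanned_one by (force simp: shift_def LK_def)
  then have "?b \<in> shift a LK" by (metis someI)
  then obtain l where l: "l \<in> LK" "?b = a \<otimes>\<^bsub>\<Gamma>\<^esub> l" by (auto simp: shift_def)
  have c: "cls [(v, z)] \<in> carrier \<Gamma>" using v assms by (simp add: cls_carrier)
  have lc: "l \<in> carrier \<Gamma>" using l LK_carrier by blast
  have "l \<otimes>\<^bsub>\<Gamma>\<^esub> (cls [(v, z)] \<otimes>\<^bsub>\<Gamma>\<^esub> (inv\<^bsub>\<Gamma>\<^esub> l \<otimes>\<^bsub>\<Gamma>\<^esub> inv\<^bsub>\<Gamma>\<^esub> a))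
      = (l \<otimes>\<^bsub>\<Gamma>\<^esub> cls [(v, z)]) \<otimes>\<^bsub>\<Gamma>\<^esub> (inv\<^bsub>\<Gamma>\<^esub> l \<otimes>\<^bsub>\<Gamma>\<^esub> inv\<^bsub>\<Gamma>\<^esub> a)"
    using lc c assms by (simp add: gp.m_assoc)
  also have "\<dots> = cls [(v, z)] \<otimes>\<^bsub>\<Gamma>\<^esub> ((l \<otimes>\<^bsub>\<Gamma>\<^esub> inv\<^bsub>\<Gamma>\<^esub> l) \<otimes>\<^bsub>\<Gamma>\<^esub> inv\<^bsub>\<Gamma>\<^esub> a)"
    unfolding LK_commute[OF l(1) assms(2)]
    by (use lc c assms in \<open>simp only: gp.m_assoc gp.inv_closed gp.m_closed\<close>)
  also have "\<dots> = cls [(v, z)] \<otimes>\<^bsub>\<Gamma>\<^esub> inv\<^bsub>\<Gamma>\<^esub> a"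
    using lc assms by simp
  finally show ?thesis
    using lc c assms unfolding conj_copy_def Let_def l(2)
    by (simp add: gp.m_assoc gp.inv_mult_group)
qed

lemma conj_copy_closed: "C \<in> cosets \<Longrightarrow> z \<in> carrier (G v) \<Longrightarrow> conj_copy C z \<in> carrier \<Gamma>"
  unfolding cosets_iff using spanned_carrier v by (auto simp: conj_copy_shift subset_iff cls_carrier)

lemma conj_copy_mult:
  assumes "C \<in> cosets" "y \<in> carrier (G v)" "z \<in> carrier (G v)"
  shows "conj_copy C y \<otimes>\<^bsub>\<Gamma>\<^esub> conj_copy C z = conj_copy C (y \<otimes>\<^bsub>G v\<^esub> z)"
proof -
  obtain a where a: "a \<in> carrier \<Gamma>" "C = shift a LK"
    using assms spanned_carrier cosets_iff by blast
  have c: "cls [(v, y)] \<in> carrier \<Gamma>" "cls [(v, z)] \<in> carrier \<Gamma>" using v assms by (auto simp: cls_carrier)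
  have cancel: "inv\<^bsub>\<Gamma>\<^esub> a \<otimes>\<^bsub>\<Gamma>\<^esub> (a \<otimes>\<^bsub>\<Gamma>\<^esub> x) = x" if "x \<in> carrier \<Gamma>" for x
    using a that by (simp flip: gp.m_assoc)
  have "conj_copy C y \<otimes>\<^bsub>\<Gamma>\<^esub> conj_copy C z
      = a \<otimes>\<^bsub>\<Gamma>\<^esub> ((cls [(v, y)] \<otimes>\<^bsub>\<Gamma>\<^esub> cls [(v, z)]) \<otimes>\<^bsub>\<Gamma>\<^esub> inv\<^bsub>\<Gamma>\<^esub> a)"
    using a c assms by (simp add: conj_copy_shift gp.m_assoc cancel)
  then show ?thesis
    using a c assms v by (simp add: conj_copy_shift cls_single_mult)
qed

lemma conj_copy_one: "C \<in> cosets \<Longrightarrow> conj_copy C \<one>\<^bsub>G v\<^esub> = \<one>\<^bsub>\<Gamma>\<^esub>"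
  unfolding cosets_iff using spanned_carrier v by (auto simp: conj_copy_shift cls_single_one subset_iff)

lemma conj_copy_LK: "z \<in> carrier (G v) \<Longrightarrow> conj_copy LK z = cls [(v, z)]"
  using conj_copy_shift[of "\<one>\<^bsub>\<Gamma>\<^esub>" z] v by (simp add: shift_one LK_carrier cls_carrier)

lemma conj_copy_conj:
  assumes "C \<in> cosets" "b \<in> carrier \<Gamma>" "z \<in> carrier (G v)"
  shows "b \<otimes>\<^bsub>\<Gamma>\<^esub> conj_copy C z = conj_copy (shift b C) z \<otimes>\<^bsub>\<Gamma>\<^esub> b"
proof -
  obtain a where a: "a \<in> carrier \<Gamma>" "C = shift a LK"
    using assms spanned_carrier cosets_iff by blast
  have c: "cls [(v, z)] \<in> carrier \<Gamma>" using v assms by (auto simp: cls_carrier)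
  show ?thesis
    using a c assms LK_carrier
    by (simp add: shift_shift conj_copy_shift gp.m_assoc gp.inv_mult_group)
qed

lemma eval_copies_Cons: "eval_copies ((C, z) # x) = conj_copy C z \<otimes>\<^bsub>\<Gamma>\<^esub> eval_copies x"
  by (simp add: eval_copies_def)

lemma eval_copies_closed: "x \<in> RW \<Longrightarrow> eval_copies x \<in> carrier \<Gamma>"
proof (induction x)
  case (Cons a x)
  then show ?case by (cases a) (auto simp: eval_copies_Cons conj_copy_closed reduced_Cons)
qed (simp add: eval_copies_def)

lemma eval_copies_lmul:
  assumes "x \<in> RW" "C \<in> cosets" "z \<in> carrier (G v)"
  shows "conj_copy C z \<otimes>\<^bsub>\<Gamma>\<^esub> eval_copies x = eval_copies (lmul (G v) (C, z) x)"
proof (cases x)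
  case Nil
  then show ?thesis using assms by (auto simp: eval_copies_def conj_copy_one conj_copy_closed)
next
  case (Cons a y)
  obtain D t where a: "a = (D, t)" by fastforce
  have *: "D \<in> cosets" "t \<in> carrier (G v)" "y \<in> RW"
    using assms(1) unfolding Cons a reduced_Cons by auto
  have e: "eval_copies y \<in> carrier \<Gamma>" using * eval_copies_closed by blast
  have "conj_copy C z \<otimes>\<^bsub>\<Gamma>\<^esub> (conj_copy C t \<otimes>\<^bsub>\<Gamma>\<^esub> eval_copies y)
      = conj_copy C (z \<otimes>\<^bsub>G v\<^esub> t) \<otimes>\<^bsub>\<Gamma>\<^esub> eval_copies y"
    using assms * e by (simp flip: gp.m_assoc add: conj_copy_mult conj_copy_closed)
  then show ?thesis
    using * e assms
    by (cases "z = \<one>\<^bsub>G v\<^esub>"; cases "C = D"; cases "z \<otimes>\<^bsub>G v\<^esub> t = \<one>\<^bsub>G v\<^esub>")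
      (simp_all add: Cons a eval_copies_Cons conj_copy_one conj_copy_closed)
qed

lemma eval_copies_shifts:
  assumes "b \<in> carrier \<Gamma>" "b \<in> spanned F" "x \<in> RW"
  shows "b \<otimes>\<^bsub>\<Gamma>\<^esub> eval_copies x = eval_copies (shifts b x) \<otimes>\<^bsub>\<Gamma>\<^esub> b"
  using assms(3)
proof (induction x)
  case Nil
  then show ?case using assms by (simp add: eval_copies_def)
next
  case (Cons a x)
  obtain C z where a: "a = (C, z)" by fastforce
  have *: "C \<in> cosets" "z \<in> carrier (G v)" "x \<in> RW"
    using Cons.prems unfolding a reduced_Cons by auto
  have c: "conj_copy C z \<in> carrier \<Gamma>" "conj_copy (shift b C) z \<in> carrier \<Gamma>"
    "eval_copies x \<in> carrier \<Gamma>" "eval_copies (shifts b x) \<in> carrier \<Gamma>"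
    using * assms shift_cosets shifts_reduced
    by (auto intro!: conj_copy_closed eval_copies_closed)
  have "b \<otimes>\<^bsub>\<Gamma>\<^esub> eval_copies (a # x) = conj_copy (shift b C) z \<otimes>\<^bsub>\<Gamma>\<^esub> (b \<otimes>\<^bsub>\<Gamma>\<^esub> eval_copies x)"
    using c assms conj_copy_conj[OF *(1) assms(1) *(2)]
    by (simp add: a eval_copies_Cons flip: gp.m_assoc)
  also have "\<dots> = eval_copies (shifts b (a # x)) \<otimes>\<^bsub>\<Gamma>\<^esub> b"
    using c assms Cons.IH[OF *(3)] by (simp add: a eval_copies_Cons gp.m_assoc)
  finally show ?case .
qed

text \<open>The semidirect decomposition: an element of the subgroup spanned by
  \<open>insert v F\<close> is its kernel part times its retraction to \<open>F\<close>, and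
  \<open>act\<close> computes the kernel part. For \<open>x = []\<close> and an element of the
  kernel, evaluating its normal form gives the element back.\<close>

lemma ret_eval_copies:
  assumes "w \<in> words" "x \<in> RW"
  shows "ret (insert v F) (cls w) \<otimes>\<^bsub>\<Gamma>\<^esub> eval_copies x = eval_copies (act w x) \<otimes>\<^bsub>\<Gamma>\<^esub> ret F (cls w)"
  using assms(1)
proof (induction w)
  case Nil
  have "ret E (cls []) = \<one>\<^bsub>\<Gamma>\<^esub>" for E by (simp add: ret_cls cls_one)
  then show ?case using assms by (simp add: act_simps eval_copies_closed)
next
  case (Cons a w)
  obtain u g where a: "a = (u, g)" by fastforce
  have *: "u \<in> V" "g \<in> carrier (G u)" "w \<in> words" using Cons.prems a by auto
  let ?r = "ret (insert v F)" and ?y = "act w x"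
  have y: "?y \<in> RW" using * assms act_reduced by blast
  have c: "ret E (cls w) \<in> carrier \<Gamma>" "ret E (cls [a]) \<in> carrier \<Gamma>" "eval_copies x \<in> carrier \<Gamma>"
    "eval_copies ?y \<in> carrier \<Gamma>" "eval_copies (act1 a ?y) \<in> carrier \<Gamma>" for E
    using * assms y a act1_reduced by (auto intro!: ret_closed cls_carrier eval_copies_closed)
  have hom: "ret E (cls (a # w)) = ret E (cls [a]) \<otimes>\<^bsub>\<Gamma>\<^esub> ret E (cls w)" for E
    unfolding a cls_cons[OF *] using * by (simp add: hom_mult[OF ret_hom] cls_carrier)
  have letter: "?r (cls [a]) \<otimes>\<^bsub>\<Gamma>\<^esub> eval_copies ?y = eval_copies (act1 a ?y) \<otimes>\<^bsub>\<Gamma>\<^esub> ret F (cls [a])"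
  proof -
    consider "u = v" | "u \<noteq> v" "u \<in> F" | "u \<noteq> v" "u \<notin> F" by blast
    then show ?thesis
    proof cases
      case 1
      then show ?thesis
        using * v_notin c(5) eval_copies_lmul[OF y LK_coset, of g]
        by (simp add: a ret_cls act1_def conj_copy_LK cls_one[symmetric])
    next
      case 2
      then show ?thesis
        using * eval_copies_shifts[of "cls [a]" ?y] y by (simp add: a ret_cls act1_def cls_carrier spanned_single)
    next
      case 3
      then show ?thesis using * c(4) by (simp add: a ret_cls act1_def cls_one[symmetric])
    qed
  qed
  have "?r (cls (a # w)) \<otimes>\<^bsub>\<Gamma>\<^esub> eval_copies x = ?r (cls [a]) \<otimes>\<^bsub>\<Gamma>\<^esub> (eval_copies ?y \<otimes>\<^bsub>\<Gamma>\<^esub> ret F (cls w))"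
    unfolding hom Cons.IH[OF *(3), symmetric] using c by (simp add: gp.m_assoc)
  also have "\<dots> = eval_copies (act1 a ?y) \<otimes>\<^bsub>\<Gamma>\<^esub> (ret F (cls [a]) \<otimes>\<^bsub>\<Gamma>\<^esub> ret F (cls w))"
    using c letter by (simp flip: gp.m_assoc)
  finally show ?case by (simp add: act_simps hom)
qed

section \<open>The kernel as a free product of conjugates of \<open>G v\<close>\<close>

definition "normal_form A = act (rep A) []"

lemma normal_form_cls: "w \<in> words \<Longrightarrow> normal_form (cls w) = act w []"
  unfolding normal_form_def
  by (rule act_weq[OF reduced_Nil]) (use cls_rep[OF cls_carrier] rep_words[OF cls_carrier] cls_eq_iff in blast)

abbreviation "kern \<equiv> {x \<in> carrier \<Gamma>. ret (insert v F) x = x \<and> ret F x = \<one>\<^bsub>\<Gamma>\<^esub>}"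

lemma subgroup_kern: "subgroup kern \<Gamma>"
proof (rule gp.subgroupI)
  interpret r: group_hom \<Gamma> \<Gamma> "ret (insert v F)" by (rule ret_group_hom)
  interpret s: group_hom \<Gamma> \<Gamma> "ret F" by (rule ret_group_hom)
  show "kern \<subseteq> carrier \<Gamma>" by blast
  have "\<one>\<^bsub>\<Gamma>\<^esub> \<in> kern" by (simp add: r.hom_one s.hom_one)
  then show "kern \<noteq> {}" by blast
  show "inv\<^bsub>\<Gamma>\<^esub> x \<in> kern" if "x \<in> kern" for x
    using that by (simp add: r.hom_inv s.hom_inv)
  show "x \<otimes>\<^bsub>\<Gamma>\<^esub> y \<in> kern" if "x \<in> kern" "y \<in> kern" for x y
    using that by (simp add: r.hom_mult s.hom_mult)
qed

lemma cls_inv_word_eq: "w \<in> words \<Longrightarrow> inv\<^bsub>\<Gamma>\<^esub> (cls w) = cls (inv_word w)"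
  using cls_inv_word gp.inv_equality cls_carrier inv_word_words by blast

lemma act_spanned:
  "w \<in> words \<Longrightarrow> fst ` set w \<subseteq> F \<Longrightarrow> x \<in> RW \<Longrightarrow> act w x = shifts (cls w) x"
proof (induction w)
  case Nil
  then show ?case by (simp add: act_simps flip: cls_one) (metis shifts_one)
next
  case (Cons a w)
  obtain u g where a: "a = (u, g)" by fastforce
  have *: "u \<in> V" "g \<in> carrier (G u)" "w \<in> words" "u \<in> F" "u \<noteq> v"
    using Cons.prems a v_notin by auto
  have "act (a # w) x = shifts (cls [a]) (shifts (cls w) x)"
    using Cons * by (simp add: act_simps act1_def a)
  then show ?case
    using shifts_shifts[of "cls [a]" "cls w" x] Cons.prems * by (simp add: a cls_carrier cls_mult)
qed

text \<open>The maps \<open>ret\<close>, \<open>proj v\<close> and \<open>act\<close> are computed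
  on words, so each element of a conjugate copy is presented as an explicit conjugated
  letter.\<close>

lemma conj_copy_word:
  assumes "C \<in> cosets" "z \<in> carrier (G v)"
  obtains w where "w \<in> words" "fst ` set w \<subseteq> F" "C = shift (cls w) LK"
    "conj_copy C z = cls (w @ (v, z) # inv_word w)" "weq (w @ inv_word w) []"
proof -
  obtain w where w: "w \<in> words" "fst ` set w \<subseteq> F" "C = shift (cls w) LK"
    using assms by (auto simp: spanned_def cosets_iff)
  have "conj_copy C z = cls (w @ (v, z) # inv_word w)"
    using w assms v by (simp add: conj_copy_shift cls_carrier cls_inv_word_eq cls_mult inv_word_words)
  moreover have "cls w \<otimes>\<^bsub>\<Gamma>\<^esub> inv\<^bsub>\<Gamma>\<^esub> cls w = \<one>\<^bsub>\<Gamma>\<^esub>" using w cls_carrier by simp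
  then have "weq (w @ inv_word w) []"
    using w by (simp add: cls_inv_word_eq cls_mult inv_word_words cls_one cls_eq_iff)
  ultimately show ?thesis using w that by blast
qed

lemma fst_inv_word: "fst ` set (inv_word w) = fst ` set w"
  by (force simp: inv_word_def image_iff)

lemma restr_id: "fst ` set w \<subseteq> E \<Longrightarrow> restr E w = w"
  by (rule filter_True) force

lemma vmult_outside: "fst ` set w \<subseteq> E \<Longrightarrow> v \<notin> E \<Longrightarrow> vmult v w = \<one>\<^bsub>G v\<^esub>"
  by (induction v w rule: vmult.induct) auto

lemma kern_free_product_form:
  "free_product_form \<Gamma> (G v) kern cosets conj_copy normal_form (proj v)"
proof (rule free_product_form.intro[OF gp.group_axioms Gv.group_axioms free_product_form_axioms.intro])
  show "subgroup kern \<Gamma>" by (rule subgroup_kern)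
  show "proj v \<in> hom \<Gamma> (G v)" using v by (rule proj_hom)
  show "normal_form \<one>\<^bsub>\<Gamma>\<^esub> = []"
    using normal_form_cls[of "[]"] by (simp add: cls_one act_simps)
  show "conj_copy C \<in> hom (G v) \<Gamma>" if "C \<in> cosets" for C
    using that by (auto intro!: homI conj_copy_closed simp: conj_copy_mult)
  fix x assume x: "x \<in> kern"
  then obtain w where w: "w \<in> words" "x = cls w" using carrier_E by blast
  show "normal_form x \<in> RW"
    using w act_reduced by (simp add: normal_form_cls)
  show "foldr (\<lambda>(C, z) r. conj_copy C z \<otimes>\<^bsub>\<Gamma>\<^esub> r) (normal_form x) \<one>\<^bsub>\<Gamma>\<^esub> = x"
    using ret_eval_copies[OF w(1), of "[]"] x w eval_copies_closed[OF act_reduced[OF w(1)], of "[]"]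
    by (simp add: normal_form_cls flip: eval_copies_def) (simp add: eval_copies_def)
next
  fix C z assume Cz: "C \<in> cosets" "z \<in> carrier (G v)"
  obtain w where w: "w \<in> words" "fst ` set w \<subseteq> F" "C = shift (cls w) LK"
    "conj_copy C z = cls (w @ (v, z) # inv_word w)" "weq (w @ inv_word w) []"
    using conj_copy_word[OF Cz] .
  have ww: "w @ (v, z) # inv_word w \<in> words" using w Cz v inv_word_words by simp
  have iw: "fst ` set (inv_word w) \<subseteq> F" "inv_word w \<in> words" using w fst_inv_word inv_word_words by auto
  show "proj v (conj_copy C z) = z"
    using w(1,2) ww iw v Cz vmult_outside[OF _ v_notin] by (simp add: w(4) proj_cls vmult_append)
  have "restr F (w @ (v, z) # inv_word w) = w @ inv_word w"
    using restr_id[OF w(2)] restr_id[OF iw(1)] v_notin by simp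
  moreover have "restr (insert v F) (w @ (v, z) # inv_word w) = w @ (v, z) # inv_word w"
    by (rule restr_id) (use w iw in auto)
  moreover have "cls (w @ inv_word w) = \<one>\<^bsub>\<Gamma>\<^esub>" using w iw by (simp add: cls_one cls_eq_iff)
  ultimately show "conj_copy C z \<in> kern"
    using ww by (simp add: w(4) ret_cls cls_carrier)
  fix x assume "x \<in> kern"
  then obtain y where y: "y \<in> words" "x = cls y" using carrier_E by blast
  have yX: "act y [] \<in> RW" using y act_reduced by simp
  have iX: "act (inv_word w) (act y []) \<in> RW" using iw yX act_reduced by blast
  \<comment> \<open>Read from the right, the conjugating word shifts the coset \<open>C\<close> to
    \<open>LK\<close>, the letter multiplies at \<open>LK\<close>, and the word shifts back to
    \<open>C\<close>; the two shifts cancel on all other letters.\<close>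
  have "normal_form (conj_copy C z \<otimes>\<^bsub>\<Gamma>\<^esub> x)
      = act w (lmul (G v) (LK, z) (act (inv_word w) (act y [])))"
    using ww y by (simp add: w(4) cls_mult normal_form_cls act_simps act1_def)
  also have "\<dots> = lmul (G v) (C, z) (act (w @ inv_word w) (act y []))"
    using w act_spanned[OF w(1,2)] Gv.lmul_reduced[OF iX LK_coset Cz(2)] iX
      shifts_lmul[OF cls_carrier[OF w(1)] iX LK_coset]
    by (simp add: act_simps)
  also have "act (w @ inv_word w) (act y []) = act y []"
    using act_weq[OF yX w(5)] by (simp add: act_simps)
  finally show "normal_form (conj_copy C z \<otimes>\<^bsub>\<Gamma>\<^esub> x) = lmul (G v) (C, z) (normal_form x)"
    using y by (simp add: normal_form_cls)
qed

end

text \<open>Triviality of \<open>proj v\<close> excludes the conjugates of nontrivial elements of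
  \<open>G v\<close>, whose powers have bounded length.\<close>

definition kern_length :: "'v \<Rightarrow> 'v set \<Rightarrow> ('v \<times> 'g) list set set" where
  "kern_length v F = {x \<in> carrier \<Gamma>. ret (insert v F) x = x \<and> ret F x = \<one>\<^bsub>\<Gamma>\<^esub> \<and> proj v x = \<one>\<^bsub>G v\<^esub>}"

text \<open>Only the length survives from the normal forms: these three properties are all that the
  argument on growing exponents uses of the free product.\<close>

lemma kern_has_length:
  assumes "v \<in> V" "v \<notin> F"
  obtains len :: "('v \<times> 'g) list set \<Rightarrow> nat" where
    "\<And>x y. x \<in> kern_length v F \<Longrightarrow> y \<in> kern_length v F \<Longrightarrow> len (x \<otimes>\<^bsub>\<Gamma>\<^esub> y) \<le> len x + len y"
    "\<And>x. x \<in> kern_length v F \<Longrightarrow> len (inv\<^bsub>\<Gamma>\<^esub> x) \<le> len x"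
    "\<And>x n. x \<in> kern_length v F \<Longrightarrow> x \<noteq> \<one>\<^bsub>\<Gamma>\<^esub> \<Longrightarrow> n \<ge> 1 \<Longrightarrow> n \<le> len (x [^]\<^bsub>\<Gamma>\<^esub> n) \<and> len x \<le> len (x [^]\<^bsub>\<Gamma>\<^esub> (n::nat))"
proof -
  interpret free_product_form \<Gamma> "G v"
    "{x \<in> carrier \<Gamma>. ret (insert v F) x = x \<and> ret F x = \<one>\<^bsub>\<Gamma>\<^esub>}"
    "cosets v F" "conj_copy v" "normal_form v F" "proj v"
    by (rule kern_free_product_form[OF assms])
  show ?thesis
    by (rule that[of len]) (use len_mult len_inv len_pow in \<open>auto simp: kern_length_def\<close>)
qed

end

section \<open>Homomorphisms that are trivial near the identity\<close>

text \<open>The only property of the source group that the argument uses: equations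
  \<open>y\<^sub>k = x\<^sub>k y\<^sub>k\<^sub>+\<^sub>1\<^bsup>n\<^sub>k\<^esup>\<close> have solutions close to the identity, where closeness is measured by a
  filter base \<open>Us\<close>, the \<open>x\<^sub>k\<close> come from a set \<open>S\<close> that accumulates at the identity, and both
  the exponent \<open>n\<^sub>k\<close> and the required closeness may depend on the earlier \<open>x\<^sub>j\<close>.\<close>
definition diag_base :: "('a, 'm) monoid_scheme \<Rightarrow> 'a set set \<Rightarrow> bool" where
  "diag_base K Us \<longleftrightarrow> Us \<noteq> {} \<and> (\<forall>U\<in>Us. U \<subseteq> carrier K) \<and>
     (\<forall>U\<in>Us. \<forall>U'\<in>Us. \<exists>W\<in>Us. W \<subseteq> U \<inter> U') \<and>
     (\<forall>S Uf n. (\<forall>U\<in>Us. S \<inter> U \<noteq> {}) \<longrightarrow> (\<forall>l. Uf l \<in> Us) \<longrightarrow>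
       (\<exists>x y. \<forall>k. x k \<in> S \<inter> Uf (map x [0..<k]) \<and> y k \<in> Uf (map x [0..<k]) \<and>
          y k = x k \<otimes>\<^bsub>K\<^esub> y (Suc k) [^]\<^bsub>K\<^esub> (n (map x [0..<Suc k]) :: nat)))"

definition trivial_near :: "'a set set \<Rightarrow> ('b, 'n) monoid_scheme \<Rightarrow> ('a \<Rightarrow> 'b) \<Rightarrow> bool" where
  "trivial_near Us H \<phi> \<longleftrightarrow> (\<exists>U\<in>Us. \<forall>x\<in>U. \<phi> x = \<one>\<^bsub>H\<^esub>)"

lemma diag_baseD:
  assumes "diag_base K Us"
  shows "Us \<noteq> {}" "U \<in> Us \<Longrightarrow> U \<subseteq> carrier K" "U \<in> Us \<Longrightarrow> U' \<in> Us \<Longrightarrow> \<exists>W\<in>Us. W \<subseteq> U \<inter> U'"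
  using assms unfolding diag_base_def by (elim conjE, blast)+

text \<open>That \<phi> is not trivial near the identity means that the elements it does not kill
  meet every member of \<open>Us\<close>; so they can serve as the set from which the
  \<open>x k\<close> are drawn.\<close>

lemma diag_base_solve:
  assumes "diag_base K Us" "\<not> trivial_near Us H \<phi>" "\<And>l. Uf l \<in> Us"
  shows "\<exists>x y. \<forall>k. x k \<in> carrier K \<and> \<phi> (x k) \<noteq> \<one>\<^bsub>H\<^esub> \<and> y k \<in> carrier K \<and> y k \<in> Uf (map x [0..<k]) \<and>
    x k \<in> Uf (map x [0..<k]) \<and> y k = x k \<otimes>\<^bsub>K\<^esub> y (Suc k) [^]\<^bsub>K\<^esub> (n (map x [0..<Suc k]) :: nat)"
proof -
  have "\<forall>U\<in>Us. {x. \<phi> x \<noteq> \<one>\<^bsub>H\<^esub>} \<inter> U \<noteq> {}"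
    using assms(2) unfolding trivial_near_def by blast
  moreover have "\<forall>l. Uf l \<in> Us" using assms(3) by blast
  ultimately have "\<exists>x y. \<forall>k. x k \<in> {x. \<phi> x \<noteq> \<one>\<^bsub>H\<^esub>} \<inter> Uf (map x [0..<k]) \<and> y k \<in> Uf (map x [0..<k]) \<and>
      y k = x k \<otimes>\<^bsub>K\<^esub> y (Suc k) [^]\<^bsub>K\<^esub> n (map x [0..<Suc k])"
    by (rule assms(1)[unfolded diag_base_def, THEN conjunct2, THEN conjunct2, THEN conjunct2,
          THEN spec, THEN spec, THEN spec, THEN mp, THEN mp])
  moreover have "Uf l \<subseteq> carrier K" for l
    using assms(1,3) unfolding diag_base_def by blast
  ultimately show ?thesis by blast
qed

lemma (in group_hom) diag_hom:
  assumes "x \<in> carrier G" "y \<in> carrier G"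
  shows "h (x \<otimes> y [^] (n::nat)) = h x \<otimes>\<^bsub>H\<^esub> h y [^]\<^bsub>H\<^esub> n"
  using assms by (simp add: hom_nat_pow)

text \<open>Higman's argument: the exponents outgrow the lengths of all earlier \<open>x\<^sub>j\<close>, so \<open>y\<^sub>0\<close> would have
  infinite length.\<close>
lemma trivial_near_length:
  fixes len :: "'b \<Rightarrow> nat"
  assumes "group K" "group H" "diag_base K Us" "\<phi> \<in> hom K H"
    and N: "subgroup N H" "U0 \<in> Us" "\<phi> ` U0 \<subseteq> N"
    and len_mult: "\<And>x y. x \<in> N \<Longrightarrow> y \<in> N \<Longrightarrow> len (x \<otimes>\<^bsub>H\<^esub> y) \<le> len x + len y"
    and len_inv: "\<And>x. x \<in> N \<Longrightarrow> len (inv\<^bsub>H\<^esub> x) \<le> len x"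
    and len_pow: "\<And>x n. x \<in> N \<Longrightarrow> x \<noteq> \<one>\<^bsub>H\<^esub> \<Longrightarrow> n \<ge> 1 \<Longrightarrow>
      n \<le> len (x [^]\<^bsub>H\<^esub> n) \<and> len x \<le> len (x [^]\<^bsub>H\<^esub> (n::nat))"
  shows "trivial_near Us H \<phi>"
proof (rule ccontr)
  interpret H: group H by fact
  interpret \<phi>: group_hom K H \<phi>
    using assms by (simp add: group_hom_def group_hom_axioms_def)
  interpret N: subgroup N H by fact
  \<comment> \<open>The sum beats the lengths of the images of all elements chosen so far. The term
    \<open>length l\<close> makes the excess unbounded, which finally beats the length of the image
    of \<open>y 0\<close>; that length is not known when the exponents are fixed.\<close>
  define n where "n l = length l + Suc (sum_list (map (len \<circ> \<phi>) l))" for l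
  assume "\<not> trivial_near Us H \<phi>"
  from diag_base_solve[OF assms(3) this, of "\<lambda>_. U0" n] N(2)
  obtain x y where *: "\<forall>k. x k \<in> carrier K \<and> \<phi> (x k) \<noteq> \<one>\<^bsub>H\<^esub> \<and> y k \<in> carrier K \<and> y k \<in> U0 \<and>
    x k \<in> U0 \<and> y k = x k \<otimes>\<^bsub>K\<^esub> y (Suc k) [^]\<^bsub>K\<^esub> n (map x [0..<Suc k])"
    by blast
  have xy: "x k \<in> U0" "y k \<in> U0" "\<phi> (x k) \<noteq> \<one>\<^bsub>H\<^esub>" "x k \<in> carrier K" "y k \<in> carrier K"
    "y k = x k \<otimes>\<^bsub>K\<^esub> y (Suc k) [^]\<^bsub>K\<^esub> n (map x [0..<Suc k])" for k
    using spec[OF *, of k] by iprover+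
  define a b m where "a k = \<phi> (x k)" and "b k = \<phi> (y k)"
    and "m k = Suc k + Suc (\<Sum>j\<le>k. len (a j))" for k
  have aN: "a k \<in> N" "a k \<noteq> \<one>\<^bsub>H\<^esub>" and bN: "b k \<in> N" for k
    using xy(1-3) N by (auto simp: a_def b_def)
  have m: "n (map x [0..<Suc k]) = m k" for k
    unfolding n_def m_def a_def
    by (simp add: interv_sum_list_conv_sum_set_nat lessThan_Suc_atMost[symmetric] comp_def
        atLeast0LessThan del: upt_Suc sum.lessThan_Suc)
  have b: "b k = a k \<otimes>\<^bsub>H\<^esub> b (Suc k) [^]\<^bsub>H\<^esub> m k" for k
    using \<phi>.diag_hom[of "x k" "y (Suc k)" "n (map x [0..<Suc k])"] xy(4-6)
    by (metis a_def b_def m)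
  have c: "a k \<in> carrier H" "b k \<in> carrier H" for k using aN bN by auto
  have b_pow: "b (Suc k) [^]\<^bsub>H\<^esub> m k = inv\<^bsub>H\<^esub> (a k) \<otimes>\<^bsub>H\<^esub> b k" for k
    using b[of k] c H.inv_solve_left by (metis H.nat_pow_closed)
  have le: "len (a k) < m k" for k
    using member_le_sum[of k "{..k}" "\<lambda>j. len (a j)"] by (simp add: m_def)
  have b_next: "b (Suc k) \<noteq> \<one>\<^bsub>H\<^esub>" if "b k = \<one>\<^bsub>H\<^esub>" for k
    using b[of k] that c aN(2)[of k] by (metis H.nat_pow_one H.r_one)
  \<comment> \<open>If \<open>b k\<close> were the identity, the inverse of \<open>a k\<close> would
    be the \<open>m k\<close>-th power of a nontrivial element, of length at least
    \<open>m k\<close>, which exceeds \<open>len (a k)\<close>. Nontriviality is what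
    \<open>len_pow\<close> asks for below.\<close>
  have b1: "b k \<noteq> \<one>\<^bsub>H\<^esub>" for k
  proof
    assume *: "b k = \<one>\<^bsub>H\<^esub>"
    have "m k \<le> len (inv\<^bsub>H\<^esub> (a k))"
      using len_pow[OF bN b_next[OF *], of "m k"] b_pow[of k] * c by (simp add: m_def)
    then show False using len_inv[OF aN(1)[of k]] le[of k] by linarith
  qed
  \<comment> \<open>The same power yields both bounds: it is at least as long as its exponent is
    large and at least as long as its base.\<close>
  have step: "m k \<le> len (a k) + len (b k)" "len (b (Suc k)) \<le> len (a k) + len (b k)" for k
  proof -
    have "len (b (Suc k) [^]\<^bsub>H\<^esub> m k) \<le> len (a k) + len (b k)"
      using len_mult[of "inv\<^bsub>H\<^esub> (a k)" "b k"] len_inv[of "a k"] aN bN b_pow[of k] by force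
    then show "m k \<le> len (a k) + len (b k)" "len (b (Suc k)) \<le> len (a k) + len (b k)"
      using len_pow[OF bN b1, of "m k" "Suc k"] by (auto simp: m_def)
  qed
  have "len (b k) \<le> len (b 0) + (\<Sum>j<k. len (a j))" for k
  proof (induction k)
    case (Suc k)
    then show ?case using step(2)[of k] by simp
  qed simp
  from this have "m k \<le> len (b 0) + (\<Sum>j\<le>k. len (a j))" for k
    using step(1)[of k] unfolding lessThan_Suc_atMost[symmetric] sum.lessThan_Suc
    by (metis add.assoc add.commute add_le_cancel_left order_trans)
  \<comment> \<open>At this index the excess \<open>Suc k\<close> is larger than
    \<open>len (b 0)\<close>.\<close>
  from this[of "len (b 0)"] show False by (simp add: m_def)
qed

context graph_of_groups
begin

lemma subgroup_kern_length:
  assumes "v \<in> V" shows "subgroup (kern_length v F) \<Gamma>"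
proof (rule gp.subgroupI)
  interpret r: group_hom \<Gamma> \<Gamma> "ret (insert v F)" by (rule ret_group_hom)
  interpret s: group_hom \<Gamma> \<Gamma> "ret F" by (rule ret_group_hom)
  interpret p: group_hom \<Gamma> "G v" "proj v"
    using assms by (simp add: group_hom_def group_hom_axioms_def gp.group_axioms vertex_group proj_hom)
  show "kern_length v F \<subseteq> carrier \<Gamma>" by (auto simp: kern_length_def)
  have "\<one>\<^bsub>\<Gamma>\<^esub> \<in> kern_length v F" by (simp add: kern_length_def)
  then show "kern_length v F \<noteq> {}" by blast
  show "inv\<^bsub>\<Gamma>\<^esub> x \<in> kern_length v F" if "x \<in> kern_length v F" for x
    using that by (simp add: kern_length_def r.hom_inv s.hom_inv p.hom_inv)
  show "x \<otimes>\<^bsub>\<Gamma>\<^esub> y \<in> kern_length v F" if "x \<in> kern_length v F" "y \<in> kern_length v F" for x y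
    using that by (simp add: kern_length_def r.hom_mult s.hom_mult p.hom_mult)
qed

lemma trivial_near_ret:
  assumes K: "group K" "diag_base K Us" "\<phi> \<in> hom K \<Gamma>"
    and vertex: "\<And>v \<psi>. v \<in> V \<Longrightarrow> \<psi> \<in> hom K (G v) \<Longrightarrow> trivial_near Us (G v) \<psi>"
    and F: "finite F" "F \<subseteq> V"
  shows "trivial_near Us \<Gamma> (ret F \<circ> \<phi>)"
  using F
proof (induction F rule: finite_induct)
  case empty
  obtain U where "U \<in> Us" "U \<subseteq> carrier K" using diag_baseD(1,2)[OF K(2)] by blast
  then show ?case
    using K(3) ret_empty unfolding trivial_near_def hom_def by (intro bexI[of _ U]) auto
next
  case (insert v F)
  then have v: "v \<in> V" by simp
  let ?\<phi> = "ret (insert v F) \<circ> \<phi>"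
  have hom: "?\<phi> \<in> hom K \<Gamma>" using K(3) ret_hom hom_compose by blast
  \<comment> \<open>The hypothesis on \<open>G v\<close> handles the projection, the induction
    hypothesis the retraction to \<open>F\<close>; near the identity the image then lies in
    \<open>kern_length v F\<close>.\<close>
  have "proj v \<circ> ?\<phi> \<in> hom K (G v)" using hom proj_hom[OF v] hom_compose by blast
  then obtain U2 where U2: "U2 \<in> Us" "\<And>x. x \<in> U2 \<Longrightarrow> proj v (?\<phi> x) = \<one>\<^bsub>G v\<^esub>"
    using vertex[OF v] unfolding trivial_near_def by force
  obtain U1 where U1: "U1 \<in> Us" "\<And>x. x \<in> U1 \<Longrightarrow> ret F (\<phi> x) = \<one>\<^bsub>\<Gamma>\<^esub>"
    using insert unfolding trivial_near_def by auto
  obtain U where U: "U \<in> Us" "U \<subseteq> U1 \<inter> U2" "U \<subseteq> carrier K"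
    using diag_baseD(3)[OF K(2) U1(1) U2(1)] diag_baseD(2)[OF K(2)] by blast
  have sub: "?\<phi> ` U \<subseteq> kern_length v F"
  proof safe
    fix x assume x: "x \<in> U"
    then have "\<phi> x \<in> carrier \<Gamma>" using U K(3) by (auto simp: hom_def)
    moreover have "F \<inter> insert v F = F" by blast
    ultimately show "?\<phi> x \<in> kern_length v F"
      using x U U1(2)[of x] U2(2)[of x] by (auto simp: kern_length_def ret_closed ret_ret)
  qed
  show ?case
  proof (rule kern_has_length[OF v insert.hyps(2)])
    fix len :: "('v \<times> 'g) list set \<Rightarrow> nat"
    assume *: "\<And>x y. x \<in> kern_length v F \<Longrightarrow> y \<in> kern_length v F \<Longrightarrow> len (x \<otimes>\<^bsub>\<Gamma>\<^esub> y) \<le> len x + len y"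
      "\<And>x. x \<in> kern_length v F \<Longrightarrow> len (inv\<^bsub>\<Gamma>\<^esub> x) \<le> len x"
      "\<And>x n. x \<in> kern_length v F \<Longrightarrow> x \<noteq> \<one>\<^bsub>\<Gamma>\<^esub> \<Longrightarrow> n \<ge> 1 \<Longrightarrow> n \<le> len (x [^]\<^bsub>\<Gamma>\<^esub> n) \<and> len x \<le> len (x [^]\<^bsub>\<Gamma>\<^esub> (n::nat))"
    show ?thesis
      by (rule trivial_near_length[OF K(1) gp.group_axioms K(2) hom subgroup_kern_length[OF v] U(1) sub *])
  qed
qed

text \<open>Infinitely many vertices: with all exponents equal to 1, the partial products
  \<open>x\<^sub>0 \<cdots> x\<^sub>k\<close> are the retractions of \<open>y\<^sub>0\<close> to growing sets of vertices, hence eventually constant.\<close>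
theorem trivial_near_graph_product:
  assumes K: "group K" "diag_base K Us" "\<phi> \<in> hom K \<Gamma>"
    and vertex: "\<And>v \<psi>. v \<in> V \<Longrightarrow> \<psi> \<in> hom K (G v) \<Longrightarrow> trivial_near Us (G v) \<psi>"
  shows "trivial_near Us \<Gamma> \<phi>"
proof (rule ccontr)
  interpret \<phi>: group_hom K \<Gamma> \<phi>
    using K by (simp add: group_hom_def group_hom_axioms_def gp.group_axioms)
  define supp where "supp z = (SOME F. finite F \<and> F \<subseteq> V \<and> ret F z = z)" for z
  have supp: "finite (supp z)" "supp z \<subseteq> V" "ret (supp z) z = z" if "z \<in> carrier \<Gamma>" for z
    using someI_ex[OF finite_support[OF that]] unfolding supp_def by auto
  \<comment> \<open>Lists may contain elements outside the carrier of \<open>K\<close>, for which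
    the choice in \<open>supp\<close> has no meaning; these are left out.\<close>
  define E where "E l = (\<Union>x\<in>set l \<inter> carrier K. supp (\<phi> x))" for l
  have E: "finite (E l)" "E l \<subseteq> V" for l
    unfolding E_def using supp \<phi>.hom_closed by (blast intro: finite_UN_I)+
  \<comment> \<open>Membership in this neighbourhood makes the later \<open>x k\<close> and the
    remainders \<open>y k\<close> trivial under the retraction to all vertices used so far.\<close>
  define Uf where "Uf l = (SOME U. U \<in> Us \<and> (\<forall>x\<in>U. ret (E l) (\<phi> x) = \<one>\<^bsub>\<Gamma>\<^esub>))" for l
  have Uf: "Uf l \<in> Us" "x \<in> Uf l \<Longrightarrow> ret (E l) (\<phi> x) = \<one>\<^bsub>\<Gamma>\<^esub>" for l x
  proof -
    have "\<exists>U. U \<in> Us \<and> (\<forall>x\<in>U. ret (E l) (\<phi> x) = \<one>\<^bsub>\<Gamma>\<^esub>)"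
      using trivial_near_ret[OF K vertex E] unfolding trivial_near_def comp_def by blast
    from someI_ex[OF this] show "Uf l \<in> Us" "x \<in> Uf l \<Longrightarrow> ret (E l) (\<phi> x) = \<one>\<^bsub>\<Gamma>\<^esub>"
      unfolding Uf_def by blast+
  qed
  assume "\<not> trivial_near Us \<Gamma> \<phi>"
  from diag_base_solve[OF K(2) this, of Uf "\<lambda>_. 1"] Uf(1)
  obtain x y where *: "\<forall>k. x k \<in> carrier K \<and> \<phi> (x k) \<noteq> \<one>\<^bsub>\<Gamma>\<^esub> \<and> y k \<in> carrier K \<and>
    y k \<in> Uf (map x [0..<k]) \<and> x k \<in> Uf (map x [0..<k]) \<and> y k = x k \<otimes>\<^bsub>K\<^esub> y (Suc k) [^]\<^bsub>K\<^esub> (1::nat)"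
    by blast
  have xy: "y k \<in> Uf (map x [0..<k])" "\<phi> (x k) \<noteq> \<one>\<^bsub>\<Gamma>\<^esub>" "x k \<in> carrier K" "y k \<in> carrier K"
    "y k = x k \<otimes>\<^bsub>K\<^esub> y (Suc k) [^]\<^bsub>K\<^esub> (1::nat)" for k
    using spec[OF *, of k] by iprover+
  define a b D where "a k = \<phi> (x k)" and "b k = \<phi> (y k)" and "D k = E (map x [0..<k])" for k
  have ab: "a k \<in> carrier \<Gamma>" "b k \<in> carrier \<Gamma>" for k using xy(3,4) by (auto simp: a_def b_def)
  have b: "b k = a k \<otimes>\<^bsub>\<Gamma>\<^esub> b (Suc k)" for k
  proof -
    have "y k = x k \<otimes>\<^bsub>K\<^esub> y (Suc k)" using xy(5)[of k] xy(4) by simp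
    then show ?thesis unfolding a_def b_def using xy(3,4) \<phi>.hom_mult by metis
  qed
  have D_Suc: "D (Suc k) = D k \<union> supp (a k)" for k
    using xy(3) by (auto simp: D_def E_def a_def)
  define c where "c = rec_nat \<one>\<^bsub>\<Gamma>\<^esub> (\<lambda>k z. z \<otimes>\<^bsub>\<Gamma>\<^esub> a k)"
  have c_simps: "c 0 = \<one>\<^bsub>\<Gamma>\<^esub>" "c (Suc k) = c k \<otimes>\<^bsub>\<Gamma>\<^esub> a k" for k by (simp_all add: c_def)
  have c: "c k \<in> carrier \<Gamma> \<and> b 0 = c k \<otimes>\<^bsub>\<Gamma>\<^esub> b k \<and> ret (D k) (c k) = c k" for k
  proof (induction k)
    case 0
    then show ?case using ab group_hom.hom_one[OF ret_group_hom] by (simp add: c_simps)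
  next
    case (Suc k)
    have "ret (D (Suc k)) (c k) = c k"
      using ret_ret[of "c k" "D (Suc k)" "D k"] Suc by (simp add: D_Suc Int_absorb1)
    moreover have "ret (D (Suc k)) (a k) = a k"
      using ret_ret[of "a k" "D (Suc k)" "supp (a k)"] supp(3)[OF ab(1), of k] ab
      by (simp add: D_Suc Int_absorb1)
    moreover have "b 0 = c k \<otimes>\<^bsub>\<Gamma>\<^esub> (a k \<otimes>\<^bsub>\<Gamma>\<^esub> b (Suc k))" using Suc b[of k] by simp
    ultimately show ?case
      using Suc ab by (simp add: c_simps hom_mult[OF ret_hom] gp.m_assoc)
  qed
  let ?F = "supp (b 0)"
  \<comment> \<open>Retracting the product of \<open>c k\<close> and \<open>b k\<close> to
    \<open>D k\<close> removes \<open>b k\<close> and fixes \<open>c k\<close>; as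
    \<open>b 0\<close> is supported in the finite set \<open>?F\<close>, only the vertices of
    \<open>D k\<close> in \<open>?F\<close> matter.\<close>
  have c_eq: "c k = ret (D k \<inter> ?F) (b 0)" for k
  proof -
    have "ret (D k) (b k) = \<one>\<^bsub>\<Gamma>\<^esub>" using xy(1) Uf(2) by (auto simp: b_def D_def)
    then have "ret (D k) (b 0) = c k"
      using c[of k] ab hom_mult[OF ret_hom, of "c k" "b k" "D k"] by simp
    then show ?thesis using ret_ret[OF ab(2), of "D k" ?F 0] supp(3)[OF ab(2), of 0] by simp
  qed
  \<comment> \<open>Consecutive partial products differ by the nontrivial \<open>a k\<close>, so
    this set must change at every step, although it stays inside the finite set
    \<open>?F\<close>.\<close>
  have strict: "D k \<inter> ?F \<subset> D (Suc k) \<inter> ?F" for k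
  proof -
    have "c (Suc k) \<noteq> c k"
      using c[of k] ab xy(2)[of k] gp.r_cancel_one'[of "c k" "a k"] by (auto simp: c_simps a_def)
    then show ?thesis using c_eq[of k] c_eq[of "Suc k"] D_Suc[of k] by (metis Int_mono psubsetI subset_refl sup_ge1)
  qed
  have "k \<le> card (D k \<inter> ?F)" for k
  proof (induction k)
    case (Suc k)
    then show ?case using psubset_card_mono[OF _ strict[of k]] supp(1)[OF ab(2), of 0] by simp
  qed simp
  then have "Suc (card ?F) \<le> card ?F"
    using card_mono[OF supp(1)[OF ab(2), of 0], of "D (Suc (card ?F)) \<inter> ?F"] by (meson Int_lower2 order_trans)
  then show False by simp
qed

end

section \<open>Topological groups\<close>

locale top_group =
  fixes K :: "('a, 'm) monoid_scheme" (structure) and T :: "'a topology"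
  assumes top_group: "topological_group K T"
begin

sublocale group K
  using top_group by (simp add: topological_group_def)

lemma topspace_T: "topspace T = carrier K"
  using top_group by (simp add: topological_group_def)

lemma continuous_mult:
  assumes "continuous_map Y T f" "continuous_map Y T g"
  shows "continuous_map Y T (\<lambda>x. f x \<otimes> g x)"
proof -
  have "continuous_map Y T ((\<lambda>(x, y). x \<otimes> y) \<circ> (\<lambda>x. (f x, g x)))"
    using assms top_group
    by (intro continuous_map_compose[where X' = "prod_topology T T"])
      (auto simp: topological_group_def continuous_map_pairedI)
  then show ?thesis by (simp add: o_def)
qed

lemma continuous_pow: "continuous_map Y T f \<Longrightarrow> continuous_map Y T (\<lambda>x. f x [^] (n::nat))"
  by (induction n) (auto simp: continuous_mult topspace_T)

definition nbhds :: "'a set set" where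
  "nbhds = {U. openin T U \<and> \<one> \<in> U}"

section \<open>Systems of equations and their truncations\<close>

definition next_map :: "(nat \<Rightarrow> 'a) \<Rightarrow> ('a list \<Rightarrow> nat) \<Rightarrow> nat \<Rightarrow> 'a \<Rightarrow> 'a" where
  "next_map x n k y = x k \<otimes> y [^] n (map x [0..<Suc k])"

lemma continuous_next_map: "x k \<in> carrier K \<Longrightarrow> continuous_map T T (next_map x n k)"
  unfolding next_map_def by (intro continuous_mult continuous_pow) (auto simp: topspace_T)

text \<open>At the identity this composite is the value \<open>y j\<close> of the system truncated
  by letting \<open>y m\<close> be the identity.\<close>

definition iter_map :: "(nat \<Rightarrow> 'a) \<Rightarrow> ('a list \<Rightarrow> nat) \<Rightarrow> nat \<Rightarrow> nat \<Rightarrow> 'a \<Rightarrow> 'a" where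
  "iter_map x n j m = foldr (\<lambda>k h. next_map x n k \<circ> h) [j..<m] id"

lemma iter_map_simps:
  "m \<le> j \<Longrightarrow> iter_map x n j m = id"
  "j < m \<Longrightarrow> iter_map x n j m = next_map x n j \<circ> iter_map x n (Suc j) m"
  by (simp_all add: iter_map_def upt_conv_Cons)

lemma iter_map_split: "j \<le> m \<Longrightarrow> m \<le> m' \<Longrightarrow> iter_map x n j m' = iter_map x n j m \<circ> iter_map x n m m'"
  by (induction rule: inc_induct) (auto simp: iter_map_simps fun_eq_iff)

lemma continuous_iter_map:
  assumes "\<And>k. k < m \<Longrightarrow> x k \<in> carrier K"
  shows "continuous_map T T (iter_map x n j m)"
proof (cases "j \<le> m")
  case True
  then show ?thesis
    by (induction rule: inc_induct)
      (auto simp: iter_map_simps intro!: continuous_map_compose[OF _ continuous_next_map] assms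
        simp del: o_apply)
qed (simp add: iter_map_simps)

text \<open>The composite up to \<open>m\<close> depends on \<open>x\<close> only below
  \<open>m\<close>, so a requirement on the next neighbourhood can be formulated with the finite
  list of elements chosen so far.\<close>

lemma iter_map_cong:
  assumes "\<And>k. k < m \<Longrightarrow> x k = x' k"
  shows "iter_map x n j m = iter_map x' n j m"
proof -
  have "next_map x n k = next_map x' n k" if "k < m" for k
  proof -
    have "map x [0..<Suc k] = map x' [0..<Suc k]"
      using that assms by (intro map_cong) auto
    then show ?thesis unfolding next_map_def assms[OF that] by presburger
  qed
  then show ?thesis unfolding iter_map_def by (intro foldr_cong) auto
qed

text \<open>The choices are interleaved: once \<open>x k\<close> in \<open>W k\<close> is picked,
  \<open>next_map x n k\<close> is continuous and sends the identity to \<open>x k\<close>, so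
  \<open>W (Suc k)\<close> can be shrunk until its closure is mapped into \<open>W k\<close>. The
  metrizable and the locally compact case share this construction; closures appear because the
  solutions will be limits or points of compact sets.\<close>

lemma nbhd_chain:
  assumes reg: "regular_space T" and S: "\<forall>U\<in>nbhds. S \<inter> U \<noteq> {}"
    and C: "\<forall>l. set l \<subseteq> carrier K \<longrightarrow> C l \<in> nbhds"
  shows "\<exists>x W. \<forall>k. x k \<in> S \<inter> W k \<and> W k \<in> nbhds \<and> T closure_of W k \<subseteq> C (map x [0..<k])
    \<and> next_map x n k ` (T closure_of W (Suc k)) \<subseteq> W k"
proof -
  have shrink: "\<exists>W\<in>nbhds. T closure_of W \<subseteq> U" if "U \<in> nbhds" for U
  proof -
    obtain W C where "openin T W" "closedin T C" "\<one> \<in> W" "W \<subseteq> C" "C \<subseteq> U"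
      using reg \<open>U \<in> nbhds\<close> unfolding neighbourhood_base_of_closedin[symmetric] neighbourhood_base_of nbhds_def
      by (metis (no_types, lifting) mem_Collect_eq)
    then show ?thesis by (intro bexI[of _ W]) (auto simp: nbhds_def dest: closure_of_minimal)
  qed
  have carrier: "U \<subseteq> carrier K" if "U \<in> nbhds" for U
    using that openin_subset topspace_T by (auto simp: nbhds_def)
  define nxt where "nxt l x y = x \<otimes> y [^] n (l @ [x])" for l x y
  \<comment> \<open>The state of the recursion is a list with a neighbourhood, since both
    \<open>C\<close> and \<open>n\<close> are functions of the elements chosen so far.\<close>
  define P where "P = (\<lambda>(k::nat) (l, W). length l = k \<and> set l \<subseteq> carrier K \<and> W \<in> nbhds \<and> T closure_of W \<subseteq> C l)"
  define Q where "Q = (\<lambda>(k::nat) (l, W) (l', W'). \<exists>x. l' = l @ [x] \<and> x \<in> S \<inter> W \<and> nxt l x ` (T closure_of W') \<subseteq> W)"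
  have "\<exists>f. \<forall>k. P k (f k) \<and> Q k (f k) (f (Suc k))"
  proof (rule dependent_nat_choice)
    show "\<exists>s. P 0 s" using shrink[of "C []"] C by (auto simp: P_def)
  next
    fix s k assume P: "P k s"
    obtain l W where s: "s = (l, W)" by fastforce
    have lW: "length l = k" "set l \<subseteq> carrier K" "W \<in> nbhds" using P by (auto simp: P_def s)
    obtain x where x: "x \<in> S" "x \<in> W" using S lW(3) by blast
    have xc: "x \<in> carrier K" using x carrier lW by blast
    have "continuous_map T T (nxt l x)"
      unfolding nxt_def by (intro continuous_mult continuous_pow) (use xc in \<open>auto simp: topspace_T\<close>)
    then have "openin T {y \<in> topspace T. nxt l x y \<in> W}"
      using lW(3) by (simp add: nbhds_def openin_continuous_map_preimage)
    moreover have "nxt l x \<one> = x" using xc by (simp add: nxt_def)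
    ultimately have "{y \<in> topspace T. nxt l x y \<in> W} \<inter> C (l @ [x]) \<in> nbhds"
      using spec[OF C, of "l @ [x]"] x xc lW by (auto simp: nbhds_def topspace_T)
    from shrink[OF this] obtain W' where "W' \<in> nbhds"
      "T closure_of W' \<subseteq> {y \<in> topspace T. nxt l x y \<in> W} \<inter> C (l @ [x])" by blast
    then have "P (Suc k) (l @ [x], W') \<and> Q k s (l @ [x], W')"
      using lW x xc by (auto simp: P_def Q_def s)
    then show "\<exists>t. P (Suc k) t \<and> Q k s t" by blast
  qed
  then obtain f where f: "\<And>k. P k (f k)" "\<And>k. Q k (f k) (f (Suc k))" by blast
  define x where "x k = last (fst (f (Suc k)))" for k
  define W where "W k = snd (f k)" for k
  have "fst (f (Suc k)) = fst (f k) @ [x k]" for k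
    using f(2)[of k] by (auto simp: Q_def x_def split: prod.splits)
  then have l: "fst (f k) = map x [0..<k]" for k
    using f(1)[of 0] by (induction k) (auto simp: P_def split: prod.splits)
  have fk: "f k = (map x [0..<k], W k)" for k by (simp add: W_def flip: l)
  have "x k \<in> S \<inter> W k \<and> next_map x n k ` (T closure_of W (Suc k)) \<subseteq> W k" for k
    using f(2)[of k] unfolding fk Q_def nxt_def next_map_def by auto
  moreover have "W k \<in> nbhds \<and> T closure_of W k \<subseteq> C (map x [0..<k])" for k
    using f(1)[of k] unfolding fk P_def by auto
  ultimately show ?thesis by blast
qed

lemma nbhds_openin: "U \<in> nbhds \<Longrightarrow> openin T U" "U \<in> nbhds \<Longrightarrow> \<one> \<in> U" "U \<in> nbhds \<Longrightarrow> U \<subseteq> carrier K"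
  using openin_subset topspace_T by (auto simp: nbhds_def)

lemma diag_base_nbhds:
  assumes "\<And>S Uf n. (\<And>U. U \<in> nbhds \<Longrightarrow> S \<inter> U \<noteq> {}) \<Longrightarrow> (\<And>l. Uf l \<in> nbhds) \<Longrightarrow>
    \<exists>x y. \<forall>k. x k \<in> S \<inter> Uf (map x [0..<k]) \<and> y k \<in> Uf (map x [0..<k]) \<and> y k = next_map x n k (y (Suc k))"
  shows "diag_base K nbhds"
  unfolding diag_base_def
proof (intro conjI allI impI)
  show "nbhds \<noteq> {}" using openin_topspace[of T] topspace_T by (auto simp: nbhds_def)
  show "\<forall>U\<in>nbhds. U \<subseteq> carrier K" using nbhds_openin by blast
  show "\<forall>U\<in>nbhds. \<forall>U'\<in>nbhds. \<exists>W\<in>nbhds. W \<subseteq> U \<inter> U'"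
    by (intro ballI bexI[of _ "_ \<inter> _"]) (auto simp: nbhds_def)
next
  fix S and Uf :: "'a list \<Rightarrow> 'a set" and n :: "'a list \<Rightarrow> nat"
  assume "\<forall>U\<in>nbhds. S \<inter> U \<noteq> {}" "\<forall>l. Uf l \<in> nbhds"
  then show "\<exists>x y. \<forall>k. x k \<in> S \<inter> Uf (map x [0..<k]) \<and> y k \<in> Uf (map x [0..<k]) \<and>
      y k = x k \<otimes> y (Suc k) [^] n (map x [0..<Suc k])"
    using assms[of S Uf n] unfolding next_map_def by blast
qed

context
  fixes x :: "nat \<Rightarrow> 'a" and W :: "nat \<Rightarrow> 'a set" and n :: "'a list \<Rightarrow> nat"
  assumes W: "\<And>k. W k \<in> nbhds" and xW: "\<And>k. x k \<in> W k"
    and next_W: "\<And>k. next_map x n k ` (T closure_of W (Suc k)) \<subseteq> W k"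
begin

lemma chain_carrier: "x k \<in> carrier K"
  using W xW nbhds_openin(3) by blast

lemma iter_map_W: "j \<le> m \<Longrightarrow> iter_map x n j m \<one> \<in> W j"
proof (induction rule: inc_induct)
  case base
  then show ?case using W nbhds_openin by (simp add: iter_map_simps)
next
  case (step j)
  then have "iter_map x n (Suc j) m \<one> \<in> T closure_of W (Suc j)"
    using closure_of_subset[of "W (Suc j)" T] W nbhds_openin topspace_T by blast
  then show ?case using step next_W[of j] by (auto simp: iter_map_simps)
qed

end

text \<open>The neighbourhoods are chosen so small that later elements hardly move the earlier
  values; the truncated solutions are then Cauchy, and completeness supplies the solution.\<close>

lemma diag_base_completely_metrizable:
  assumes "completely_metrizable_space T"
  shows "diag_base K nbhds"
proof (rule diag_base_nbhds)
  fix S and Uf :: "'a list \<Rightarrow> 'a set" and n :: "'a list \<Rightarrow> nat"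
  assume S: "\<And>U. U \<in> nbhds \<Longrightarrow> S \<inter> U \<noteq> {}" and Uf: "\<And>l. Uf l \<in> nbhds"
  obtain M d where Md: "Metric_space M d" "Metric_space.mcomplete M d" "T = Metric_space.mtopology M d"
    using assms unfolding completely_metrizable_space_def by blast
  interpret Metric_space M d by (rule Md(1))
  have M: "M = carrier K" using Md(3) topspace_T topspace_mtopology by metis
  \<comment> \<open>Requires that continuing beyond the list \<open>l\<close> changes the truncated
    value at \<open>j\<close> by less than \<open>inverse (Suc (length l))\<close>. Only finitely
    many \<open>j\<close> are constrained at each stage, so \<open>C l\<close> remains open.\<close>
  define D where "D l j = {y \<in> topspace T. iter_map (nth l) n j (length l) y
      \<in> mball (iter_map (nth l) n j (length l) \<one>) (inverse (Suc (length l)))}" for l j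
  define C where "C l = Uf l \<inter> (\<Inter>j\<le>length l. D l j)" for l
  have C: "C l \<in> nbhds" if "set l \<subseteq> carrier K" for l
  proof -
    have cont: "continuous_map T T (iter_map (nth l) n j (length l))" for j
      by (rule continuous_iter_map) (use that nth_mem in blast)
    have "openin T (D l j)" "iter_map (nth l) n j (length l) \<one> \<in> carrier K" for j
    proof -
      show "openin T (D l j)"
        unfolding D_def by (rule openin_continuous_map_preimage[where Y = T])
          (use cont[of j] openin_mball Md(3) in auto)
      show "iter_map (nth l) n j (length l) \<one> \<in> carrier K"
        using continuous_map_image_subset_topspace[OF cont[of j]] topspace_T by auto
    qed
    then have "D l j \<in> nbhds" for j
      using one_closed by (simp add: nbhds_def D_def topspace_T flip: M)
    then have "openin T (\<Inter>j\<le>length l. D l j)" "\<one> \<in> (\<Inter>j\<le>length l. D l j)"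
      by (auto simp: nbhds_def)
    then show ?thesis using Uf[of l] by (auto simp: nbhds_def C_def)
  qed
  have "regular_space T"
    using assms completely_metrizable_imp_metrizable_space metrizable_imp_regular_space by blast
  moreover have "\<forall>U\<in>nbhds. S \<inter> U \<noteq> {}" "\<forall>l. set l \<subseteq> carrier K \<longrightarrow> C l \<in> nbhds"
    using S C by blast+
  ultimately obtain x W where *: "\<forall>k. x k \<in> S \<inter> W k \<and> W k \<in> nbhds \<and> T closure_of W k \<subseteq> C (map x [0..<k])
    \<and> next_map x n k ` (T closure_of W (Suc k)) \<subseteq> W k"
    using nbhd_chain[of S C n] by metis
  have xW: "x k \<in> S \<inter> W k" and W: "W k \<in> nbhds" and WC: "T closure_of W k \<subseteq> C (map x [0..<k])"
    and nW: "next_map x n k ` (T closure_of W (Suc k)) \<subseteq> W k" for k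
    using spec[OF *, of k] by blast+
  have xWk: "x k \<in> W k" for k using xW by blast
  note xc = chain_carrier[OF W xWk nW] and iW = iter_map_W[OF W xWk nW]
  have W_cl: "W k \<subseteq> T closure_of W k" for k
    using closure_of_subset[of "W k" T] W nbhds_openin topspace_T by blast
  define z where "z j m = iter_map x n j m \<one>" for j m
  have zM: "z j m \<in> M" for j m
    unfolding z_def using continuous_iter_map[of m x n j] xc M topspace_T
    by (metis continuous_map_image_subset_topspace image_subset_iff one_closed)
  have close: "d (z j m) (z j k) < inverse (Suc k)" if "j \<le> k" "k \<le> m" for j k m
  proof -
    have eq: "iter_map (nth (map x [0..<k])) n j k = iter_map x n j k"
      by (rule iter_map_cong) simp
    have "z k m \<in> C (map x [0..<k])"
      using iW[OF that(2)] W_cl WC unfolding z_def by blast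
    then have "z k m \<in> D (map x [0..<k]) j" using that by (auto simp: C_def)
    then have "iter_map x n j k (z k m) \<in> mball (z j k) (inverse (Suc k))"
      unfolding D_def length_map length_upt eq z_def by (simp add: eq)
    moreover have "iter_map x n j k (z k m) = z j m"
      using iter_map_split[OF that] by (simp add: z_def)
    ultimately show ?thesis by (simp add: commute)
  qed
  have "MCauchy (\<lambda>m. z j m)" for j
    unfolding MCauchy_def
  proof (intro conjI allI impI)
    show "range (z j) \<subseteq> M" using zM by blast
    fix \<epsilon> :: real assume "\<epsilon> > 0"
    then obtain N where N: "inverse (Suc N) < \<epsilon> / 2" using reals_Archimedean[of "\<epsilon> / 2"] by auto
    let ?k = "max j N"
    have le: "inverse (Suc ?k) \<le> inverse (Suc N)" by simp
    have "d (z j m) (z j m') < \<epsilon>" if "?k \<le> m" "?k \<le> m'" for m m'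
    proof -
      have "d (z j m) (z j ?k) < inverse (Suc ?k)" "d (z j m') (z j ?k) < inverse (Suc ?k)"
        using close[of j ?k m] close[of j ?k m'] that by auto
      then show ?thesis
        using N le triangle''[OF zM zM zM, of j m j m' j ?k] commute[of "z j ?k" "z j m"]
          commute[of "z j ?k" "z j m'"] by linarith
    qed
    then show "\<exists>N. \<forall>m m'. N \<le> m \<longrightarrow> N \<le> m' \<longrightarrow> d (z j m) (z j m') < \<epsilon>" by blast
  qed
  then have "\<exists>y. limitin mtopology (z j) y sequentially" for j
    using Md(2) unfolding mcomplete_def by blast
  then obtain y where y: "\<And>j. limitin T (z j) (y j) sequentially"
    using Md(3) by metis
  \<comment> \<open>The truncations satisfy the equation as soon as \<open>m\<close> exceeds
    \<open>j\<close>; continuity and uniqueness of limits carry it over to \<open>y\<close>.\<close>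
  have "y j = next_map x n j (y (Suc j))" for j
  proof -
    have "limitin T (next_map x n j \<circ> z (Suc j)) (next_map x n j (y (Suc j))) sequentially"
      by (rule continuous_map_limit[OF continuous_next_map[OF xc] y])
    moreover have "\<forall>\<^sub>F m in sequentially. (next_map x n j \<circ> z (Suc j)) m = z j m"
      using eventually_gt_at_top[of j] by eventually_elim (simp add: z_def iter_map_simps)
    ultimately have "limitin T (z j) (next_map x n j (y (Suc j))) sequentially"
      by (rule limitin_transform_eventually[rotated])
    then show ?thesis
      using limitin_Hausdorff_unique[OF y] Md(3) Hausdorff_space_mtopology by auto
  qed
  moreover have "y k \<in> Uf (map x [0..<k])" for k
  proof -
    have "y k \<in> T closure_of W k"
    proof (rule limitin_closedin[OF y closedin_closure_of])
      have "z k m \<in> T closure_of W k" if "k \<le> m" for m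
        using iW[OF that] W_cl unfolding z_def by blast
      then show "\<forall>\<^sub>F m in sequentially. z k m \<in> T closure_of W k"
        unfolding eventually_sequentially by blast
    qed simp
    then show ?thesis using WC by (auto simp: C_def)
  qed
  moreover have "x k \<in> S \<inter> Uf (map x [0..<k])" for k
    using xW W_cl WC[of k] by (auto simp: C_def)
  ultimately show "\<exists>x y. \<forall>k. x k \<in> S \<inter> Uf (map x [0..<k]) \<and> y k \<in> Uf (map x [0..<k]) \<and>
      y k = next_map x n k (y (Suc k))" by blast
qed

text \<open>Compactness replaces convergence: in the product of the closures of the
  \<open>W k\<close>, the sequences satisfying the first \<open>m\<close> equations form a
  decreasing family of nonempty closed sets, and a common point solves the whole system.\<close>

lemma diag_base_locally_compact:
  assumes "locally_compact_space T" "Hausdorff_space T"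
  shows "diag_base K nbhds"
proof (rule diag_base_nbhds)
  fix S and Uf :: "'a list \<Rightarrow> 'a set" and n :: "'a list \<Rightarrow> nat"
  assume S: "\<And>U. U \<in> nbhds \<Longrightarrow> S \<inter> U \<noteq> {}" and Uf: "\<And>l. Uf l \<in> nbhds"
  obtain O' B where O: "openin T O'" "\<one> \<in> O'" "O' \<subseteq> B" "compactin T B"
    using assms(1) topspace_T unfolding locally_compact_space_def by (metis one_closed)
  \<comment> \<open>Intersecting with \<open>O'\<close> puts the closures of all \<open>W k\<close>
    inside the compact set \<open>B\<close>, which makes them compact.\<close>
  define C where "C l = Uf l \<inter> O'" for l
  have C: "C l \<in> nbhds" for l using Uf[of l] O by (auto simp: nbhds_def C_def)
  have "regular_space T"
    using assms locally_compact_Hausdorff_imp_regular_space by blast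
  moreover have "\<forall>U\<in>nbhds. S \<inter> U \<noteq> {}" "\<forall>l. set l \<subseteq> carrier K \<longrightarrow> C l \<in> nbhds"
    using S C by blast+
  ultimately obtain x W where *: "\<forall>k. x k \<in> S \<inter> W k \<and> W k \<in> nbhds \<and> T closure_of W k \<subseteq> C (map x [0..<k])
    \<and> next_map x n k ` (T closure_of W (Suc k)) \<subseteq> W k"
    using nbhd_chain[of S C n] by metis
  have xW: "x k \<in> S \<inter> W k" and W: "W k \<in> nbhds" and WC: "T closure_of W k \<subseteq> C (map x [0..<k])"
    and nW: "next_map x n k ` (T closure_of W (Suc k)) \<subseteq> W k" for k
    using spec[OF *, of k] by blast+
  have xWk: "x k \<in> W k" for k using xW by blast
  note xc = chain_carrier[OF W xWk nW] and iW = iter_map_W[OF W xWk nW]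
  have W_cl: "W k \<subseteq> T closure_of W k" for k
    using closure_of_subset[of "W k" T] W nbhds_openin topspace_T by blast
  let ?X = "\<lambda>k. subtopology T (T closure_of W k)"
  let ?P = "product_topology ?X UNIV"
  have top: "topspace (?X k) = T closure_of W k" for k
    by (simp add: closure_of_subset_topspace Int_absorb1)
  have "compactin T (T closure_of W k)" for k
    by (rule closed_compactin[OF O(4)]) (use WC[of k] O in \<open>auto simp: C_def\<close>)
  then have compact: "compact_space ?P"
    by (simp add: compact_space_product_topology compact_space_subtopology)
  have proj: "continuous_map ?P T (\<lambda>y. y k)" for k
    using continuous_map_into_fulltopology[OF continuous_map_product_projection[of k UNIV ?X]] by simp
  define Z where "Z m = {y \<in> topspace ?P. \<forall>k<m. y k = next_map x n k (y (Suc k))}" for m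
  have eqn: "closedin ?P {y \<in> topspace ?P. y k = next_map x n k (y (Suc k))}" for k
    using continuous_map_compose[OF proj[of "Suc k"] continuous_next_map[where n = n and k = k, OF xc]]
    by (intro closedin_continuous_maps_eq[OF assms(2) proj]) (simp add: o_def)
  have closed: "closedin ?P (Z m)" for m
  proof (induction m)
    case 0
    have "Z 0 = topspace ?P" by (simp add: Z_def)
    then show ?case using closedin_topspace by metis
  next
    case (Suc m)
    have "Z (Suc m) = Z m \<inter> {y \<in> topspace ?P. y m = next_map x n m (y (Suc m))}"
      by (auto simp: Z_def less_Suc_eq)
    then show ?case using closedin_Int[OF Suc eqn[of m]] by simp
  qed
  have ne: "Z m \<noteq> {}" for m
  proof -
    \<comment> \<open>The system truncated at \<open>m\<close>: through \<open>max j m\<close>, the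
      coordinates from \<open>m\<close> on are the identity.\<close>
    have "(\<lambda>j. iter_map x n j (max j m) \<one>) \<in> Z m"
      using iW W_cl unfolding Z_def
      by (auto simp: PiE_iff top iter_map_simps intro: W_cl[THEN subsetD] simp del: topspace_subtopology)
    then show ?thesis by blast
  qed
  have "decseq Z" by (auto simp: Z_def decseq_def)
  then have "(\<Inter>m. Z m) \<noteq> {}" by (rule compact_space_imp_nest[OF compact closed ne])
  then obtain y where y: "\<And>m. y \<in> Z m" by blast
  have "y k \<in> T closure_of W k" for k using y[of 0] by (auto simp: Z_def PiE_iff top simp del: topspace_subtopology)
  then have "y k \<in> Uf (map x [0..<k])" for k using WC[of k] by (auto simp: C_def)
  moreover have "y k = next_map x n k (y (Suc k))" for k using y[of "Suc k"] by (simp add: Z_def)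
  moreover have "x k \<in> S \<inter> Uf (map x [0..<k])" for k
    using xW W_cl WC[of k] by (auto simp: C_def)
  ultimately show "\<exists>x y. \<forall>k. x k \<in> S \<inter> Uf (map x [0..<k]) \<and> y k \<in> Uf (map x [0..<k]) \<and>
      y k = next_map x n k (y (Suc k))" by blast
qed

text \<open>A subgroup containing a neighbourhood of the identity contains a translate of it around
  each of its points, hence is open.\<close>

lemma openin_kernel_iff:
  assumes "group H" "\<phi> \<in> hom K H"
  shows "openin T (kernel K H \<phi>) \<longleftrightarrow> trivial_near nbhds H \<phi>"
proof
  interpret \<phi>: group_hom K H \<phi>
    using assms group_axioms by (simp add: group_hom_def group_hom_axioms_def)
  show "trivial_near nbhds H \<phi>" if "openin T (kernel K H \<phi>)"
    unfolding trivial_near_def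
    by (rule bexI[of _ "kernel K H \<phi>"]) (use that in \<open>auto simp: kernel_def nbhds_def\<close>)
  assume "trivial_near nbhds H \<phi>"
  then obtain U where U: "openin T U" "\<one> \<in> U" "\<And>x. x \<in> U \<Longrightarrow> \<phi> x = \<one>\<^bsub>H\<^esub>"
    by (auto simp: trivial_near_def nbhds_def)
  have "\<exists>B. openin T B \<and> x \<in> B \<and> B \<subseteq> kernel K H \<phi>" if "x \<in> kernel K H \<phi>" for x
  proof -
    have x: "x \<in> carrier K" "\<phi> x = \<one>\<^bsub>H\<^esub>" using that by (auto simp: kernel_def)
    have "continuous_map T T (\<lambda>y. inv x \<otimes> y)"
      by (intro continuous_mult) (use x in \<open>auto simp: topspace_T\<close>)
    then have "openin T {y \<in> topspace T. inv x \<otimes> y \<in> U}"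
      using U(1) by (rule openin_continuous_map_preimage)
    moreover have "y \<in> kernel K H \<phi>" if "y \<in> carrier K" "inv x \<otimes> y \<in> U" for y
      using U(3)[OF that(2)] that(1) x by (simp add: kernel_def)
    ultimately show ?thesis
      using x U(2) by (intro exI[of _ "{y \<in> topspace T. inv x \<otimes> y \<in> U}"]) (auto simp: topspace_T)
  qed
  then show "openin T (kernel K H \<phi>)" by (subst openin_subopen) blast
qed

end

section \<open>The Hawaiian earring group\<close>

lemma loops_iff:
  "p \<in> loops S a \<longleftrightarrow> path p \<and> path_image p \<subseteq> S \<and> pathstart p = a \<and> pathfinish p = a"
  by (simp add: loops_def)

lemma path_class_eq_iff:
  assumes "path p" "path_image p \<subseteq> S"
  shows "path_class S p = path_class S q \<longleftrightarrow> homotopic_paths S p q"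
  using assms unfolding path_class_def
  by (auto intro: homotopic_paths_trans homotopic_paths_sym)

lemma some_path_class:
  assumes "path p" "path_image p \<subseteq> S"
  shows "homotopic_paths S p (SOME q. q \<in> path_class S p)"
  using someI[of "\<lambda>q. q \<in> path_class S p" p] assms by (simp add: path_class_def)

lemma homotopic_loops_mem: "homotopic_paths S p q \<Longrightarrow> p \<in> loops S a \<Longrightarrow> q \<in> loops S a"
  unfolding loops_iff
  using homotopic_paths_imp_path homotopic_paths_imp_subset homotopic_paths_imp_pathstart
    homotopic_paths_imp_pathfinish by metis

lemma join_loops: "p \<in> loops S a \<Longrightarrow> q \<in> loops S a \<Longrightarrow> p +++ q \<in> loops S a"
  by (auto simp: loops_iff path_image_join)

lemma const_loop: "a \<in> S \<Longrightarrow> linepath a a \<in> loops S a"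
  by (simp add: loops_iff)

lemma zero_loop: "0 \<in> S \<Longrightarrow> (\<lambda>_. 0) \<in> loops S (0::'a::real_normed_vector)"
  using const_loop[of 0 S] by (simp add: linepath_def)

lemma reverse_loop: "p \<in> loops S a \<Longrightarrow> reversepath p \<in> loops S a"
  by (simp add: loops_iff)

lemma fundamental_group_mult:
  assumes "p \<in> loops S a" "q \<in> loops S a"
  shows "path_class S p \<otimes>\<^bsub>fundamental_group S a\<^esub> path_class S q = path_class S (p +++ q)"
proof -
  let ?p = "SOME p'. p' \<in> path_class S p" and ?q = "SOME q'. q' \<in> path_class S q"
  have "homotopic_paths S (p +++ q) (?p +++ ?q)"
    using assms by (intro homotopic_paths_join some_path_class) (auto simp: loops_iff)
  then have "path_class S (p +++ q) = path_class S (?p +++ ?q)"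
    using join_loops[OF assms] path_class_eq_iff unfolding loops_iff by blast
  then show ?thesis by (simp add: fundamental_group_def)
qed

lemma fundamental_group_one: "\<one>\<^bsub>fundamental_group S a\<^esub> = path_class S (linepath a a)"
  by (simp add: fundamental_group_def)

lemma fundamental_group_carrier: "carrier (fundamental_group S a) = path_class S ` loops S a"
  by (simp add: fundamental_group_def)

lemma group_fundamental_group:
  assumes "a \<in> S" shows "group (fundamental_group S a)"
proof (rule groupI)
  let ?K = "fundamental_group S a"
  have eq: "path_class S p = path_class S q" if "p \<in> loops S a" "homotopic_paths S p q" for p q
    using that path_class_eq_iff by (auto simp: loops_iff)
  note simps = fundamental_group_carrier fundamental_group_mult fundamental_group_one join_loops
    const_loop[OF assms] reverse_loop
  show "\<one>\<^bsub>?K\<^esub> \<in> carrier ?K" by (simp add: simps)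
  fix x assume "x \<in> carrier ?K"
  then obtain p where p: "p \<in> loops S a" "x = path_class S p" by (auto simp: simps)
  have p': "path p" "path_image p \<subseteq> S" "pathstart p = a" "pathfinish p = a"
    using p by (auto simp: loops_iff)
  have "homotopic_paths S (linepath a a +++ p) p"
    using homotopic_paths_lid'[OF p'(1,2)] p'(3) by simp
  then show "\<one>\<^bsub>?K\<^esub> \<otimes>\<^bsub>?K\<^esub> x = x" using p by (simp add: simps eq)
  have "homotopic_paths S (reversepath p +++ p) (linepath a a)"
    using homotopic_paths_linv[OF p'(1,2)] p'(4) by simp
  then have "path_class S (reversepath p) \<otimes>\<^bsub>?K\<^esub> x = \<one>\<^bsub>?K\<^esub>" using p by (simp add: simps eq)
  moreover have "path_class S (reversepath p) \<in> carrier ?K" using p by (simp add: simps)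
  ultimately show "\<exists>y\<in>carrier ?K. y \<otimes>\<^bsub>?K\<^esub> x = \<one>\<^bsub>?K\<^esub>" by blast
  fix y assume "y \<in> carrier ?K"
  then obtain q where q: "q \<in> loops S a" "y = path_class S q" by (auto simp: simps)
  show "x \<otimes>\<^bsub>?K\<^esub> y \<in> carrier ?K" using p q by (simp add: simps)
  fix z assume "z \<in> carrier ?K"
  then obtain r where r: "r \<in> loops S a" "z = path_class S r" by (auto simp: simps)
  have "homotopic_paths S ((p +++ q) +++ r) (p +++ (q +++ r))"
    by (rule homotopic_paths_sym[OF homotopic_paths_assoc]) (use p q r in \<open>auto simp: loops_iff\<close>)
  then show "x \<otimes>\<^bsub>?K\<^esub> y \<otimes>\<^bsub>?K\<^esub> z = x \<otimes>\<^bsub>?K\<^esub> (y \<otimes>\<^bsub>?K\<^esub> z)"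
    using p q r by (simp add: simps eq)
qed

text \<open>In this form the origin visibly lies on all circles, and any other point determines the
  index of its circle, so distinct circles meet only at the origin.\<close>

lemma hawaiian_circle_iff:
  assumes "k \<ge> 1"
  shows "z \<in> hawaiian_circle k \<longleftrightarrow> real k * (cmod z)\<^sup>2 = 2 * Im z"
proof -
  have "z \<in> hawaiian_circle k \<longleftrightarrow> (cmod (\<i> * of_real (1 / real k) - z))\<^sup>2 = (1 / real k)\<^sup>2"
    unfolding hawaiian_circle_def mem_sphere dist_norm
    by (metis norm_ge_zero power2_eq_iff_nonneg zero_le_divide_1_iff of_nat_0_le_iff)
  also have "\<dots> \<longleftrightarrow> (Re z)\<^sup>2 + (1 / real k - Im z)\<^sup>2 = (1 / real k)\<^sup>2"
    by (simp add: cmod_power2)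
  also have "\<dots> \<longleftrightarrow> (real k * (cmod z)\<^sup>2 - 2 * Im z) / real k = 0"
  proof -
    have "(Re z)\<^sup>2 + (1 / real k - Im z)\<^sup>2 - (1 / real k)\<^sup>2 = (real k * (cmod z)\<^sup>2 - 2 * Im z) / real k"
      using assms unfolding cmod_power2 by (simp add: field_simps power2_eq_square)
    then show ?thesis by (metis eq_iff_diff_eq_0)
  qed
  also have "\<dots> \<longleftrightarrow> real k * (cmod z)\<^sup>2 = 2 * Im z" using assms by simp
  finally show ?thesis .
qed

text \<open>Inserting the base point makes \<open>HE_below 0\<close> equal to \<open>{0}\<close>
  instead of the empty set.\<close>

definition HE_below :: "nat \<Rightarrow> complex set" where
  "HE_below N = insert 0 (\<Union>k\<in>{1..N}. hawaiian_circle k)"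

definition HE_above :: "nat \<Rightarrow> complex set" where
  "HE_above N = insert 0 (\<Union>k\<in>{N<..}. hawaiian_circle k)"

lemma HE_below_iff: "z \<in> HE_below N \<longleftrightarrow> z = 0 \<or> (\<exists>k\<ge>1. k \<le> N \<and> real k * (cmod z)\<^sup>2 = 2 * Im z)"
  by (auto simp: HE_below_def hawaiian_circle_iff)

lemma HE_above_iff: "z \<in> HE_above N \<longleftrightarrow> z = 0 \<or> (\<exists>k>N. real k * (cmod z)\<^sup>2 = 2 * Im z)"
proof -
  have "z \<in> hawaiian_circle k \<longleftrightarrow> real k * (cmod z)\<^sup>2 = 2 * Im z" if "k > N" for k
    using that by (intro hawaiian_circle_iff) simp
  then show ?thesis by (auto simp: HE_above_def)
qed

lemma hawaiian_earring_eq: "hawaiian_earring = HE_below N \<union> HE_above N"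
proof -
  have "{1..} = {1..N} \<union> {N<..}" by auto
  then have *: "hawaiian_earring = (\<Union>k\<in>{1..N}. hawaiian_circle k) \<union> (\<Union>k\<in>{N<..}. hawaiian_circle k)"
    by (simp add: hawaiian_earring_def UN_Un)
  have "0 \<in> hawaiian_circle 1" by (simp add: hawaiian_circle_iff)
  then have "0 \<in> hawaiian_earring" by (auto simp: hawaiian_earring_def)
  then show ?thesis unfolding HE_below_def HE_above_def using * by blast
qed

lemma zero_mem_HE [simp]: "0 \<in> HE_below N" "0 \<in> HE_above N" "0 \<in> hawaiian_earring"
  by (auto simp: HE_below_def HE_above_def hawaiian_earring_eq[of 0])

lemma HE_below_subset: "HE_below N \<subseteq> hawaiian_earring" and HE_above_subset: "HE_above N \<subseteq> hawaiian_earring"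
  by (auto simp: hawaiian_earring_eq[of N])

lemma HE_above_mono: "M \<le> N \<Longrightarrow> HE_above N \<subseteq> HE_above M"
  by (auto simp: HE_above_def)

lemma HE_below_Int_above:
  assumes "z \<in> HE_below N" "z \<in> HE_above N" shows "z = 0"
proof (rule ccontr)
  assume z: "z \<noteq> 0"
  then obtain k k' where "k \<le> N" "real k * (cmod z)\<^sup>2 = 2 * Im z" "N < k'" "real k' * (cmod z)\<^sup>2 = 2 * Im z"
    using assms by (auto simp: HE_below_iff HE_above_iff)
  then have "real k = real k'" using z by (metis mult_right_cancel norm_eq_zero zero_eq_power2)
  then show False using \<open>k \<le> N\<close> \<open>N < k'\<close> by simp
qed

lemma circle_norm_le:
  assumes "k > 0" "real k * (cmod z)\<^sup>2 = 2 * Im z" shows "cmod z \<le> 2 / real k"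
proof (cases "z = 0")
  case False
  have "real k * cmod z * cmod z \<le> 2 * cmod z"
    using assms abs_Im_le_cmod[of z] by (simp add: power2_eq_square mult.assoc)
  then have "real k * cmod z \<le> 2" using False by simp
  then show ?thesis using assms by (simp add: field_simps)
qed simp

text \<open>The bound is the diameter of the largest remaining circle, the one of index
  \<open>Suc N\<close>.\<close>

lemma HE_above_norm: "z \<in> HE_above N \<Longrightarrow> cmod z \<le> 2 / Suc N"
proof -
  assume "z \<in> HE_above N"
  then consider "z = 0" | k where "k > N" "real k * (cmod z)\<^sup>2 = 2 * Im z"
    by (auto simp: HE_above_iff)
  then show ?thesis
  proof cases
    case 2
    have "cmod z \<le> 2 / real k" using 2 circle_norm_le[of k z] by simp
    also have "\<dots> \<le> 2 / Suc N" using 2 by (intro divide_left_mono) auto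
    finally show ?thesis .
  qed simp
qed

lemma closed_HE_below: "closed (HE_below N)"
  by (auto simp: HE_below_def hawaiian_circle_def intro!: closed_Un closed_UN closed_insert)

text \<open>The union of circles is infinite, but for each \<open>M\<close> those of index greater
  than \<open>M\<close> lie in a disc whose radius tends to 0; so the set is an intersection of
  finite unions of circles with such a disc added.\<close>

lemma closed_HE_above: "closed (HE_above N)"
proof -
  have "HE_above N = (\<Inter>M. cball 0 (2 / Suc M) \<union> (\<Union>k\<in>{N<..M}. hawaiian_circle k))"
  proof (intro equalityI subsetI)
    fix z assume "z \<in> HE_above N"
    then consider "z = 0" | k where "k > N" "z \<in> hawaiian_circle k" by (auto simp: HE_above_def)
    then show "z \<in> (\<Inter>M. cball 0 (2 / Suc M) \<union> (\<Union>k\<in>{N<..M}. hawaiian_circle k))"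
    proof cases
      case 2
      show ?thesis
      proof
        fix M
        show "z \<in> cball 0 (2 / Suc M) \<union> (\<Union>k\<in>{N<..M}. hawaiian_circle k)"
        proof (cases "k \<le> M")
          case False
          have "z \<in> HE_above M" using 2 False by (auto simp: HE_above_def)
          then show ?thesis using HE_above_norm by simp
        qed (use 2 in auto)
      qed
    qed simp
  next
    fix z assume z: "z \<in> (\<Inter>M. cball 0 (2 / Suc M) \<union> (\<Union>k\<in>{N<..M}. hawaiian_circle k))"
    show "z \<in> HE_above N"
    proof (cases "z = 0")
      case False
      then obtain M where "inverse (Suc M) < cmod z / 2"
        using reals_Archimedean[of "cmod z / 2"] by auto
      then have "z \<notin> cball 0 (2 / Suc M)" by (simp add: field_simps)
      then show ?thesis using z by (auto simp: HE_above_def)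
    qed simp
  qed
  moreover have "closed (cball 0 (2 / Suc M) \<union> (\<Union>k\<in>{N<..M}. hawaiian_circle k))" for M
    by (intro closed_Un closed_UN) (auto simp: hawaiian_circle_def)
  ultimately show ?thesis by (simp add: closed_INT)
qed

section \<open>Tails of the earring group and solutions by infinite concatenation\<close>

abbreviation "HE_class \<equiv> path_class hawaiian_earring"

lemma group_HE: "group HE_group"
  unfolding HE_group_def by (rule group_fundamental_group) simp

lemmas HE_mult = fundamental_group_mult[of _ hawaiian_earring 0, folded HE_group_def]
  and HE_one = fundamental_group_one[of hawaiian_earring 0, folded HE_group_def]
  and HE_carrier = fundamental_group_carrier[of hawaiian_earring 0, folded HE_group_def]

lemma loops_mono: "S \<subseteq> S' \<Longrightarrow> loops S a \<subseteq> loops S' a"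
  unfolding loops_def by blast

lemmas above_loop = subsetD[OF loops_mono[OF HE_above_subset]]
lemmas below_loop = subsetD[OF loops_mono[OF HE_below_subset]]

text \<open>These sets take the place of the neighbourhoods of the identity in a topological
  group.\<close>

definition HE_tail :: "nat \<Rightarrow> (real \<Rightarrow> complex) set set" where
  "HE_tail N = HE_class ` loops (HE_above N) 0"

lemma HE_tail_mono: "M \<le> N \<Longrightarrow> HE_tail N \<subseteq> HE_tail M"
  unfolding HE_tail_def by (intro image_mono loops_mono HE_above_mono)

lemma HE_tail_carrier: "HE_tail N \<subseteq> carrier HE_group"
  unfolding HE_tail_def HE_carrier by (intro image_mono loops_mono HE_above_subset)

text \<open>Bracketed to the left like the power in a monoid, so that the class of a power is
  computed by the same recursion.\<close>

fun path_pow :: "(real \<Rightarrow> complex) \<Rightarrow> nat \<Rightarrow> real \<Rightarrow> complex" where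
  "path_pow p 0 = linepath 0 0"
| "path_pow p (Suc n) = path_pow p n +++ p"

lemma path_pow_loop: "0 \<in> S \<Longrightarrow> p \<in> loops S 0 \<Longrightarrow> path_pow p n \<in> loops S 0"
  by (induction n) (auto intro: join_loops simp: const_loop zero_loop)

lemma path_pow_class:
  "p \<in> loops hawaiian_earring 0 \<Longrightarrow> HE_class p [^]\<^bsub>HE_group\<^esub> n = HE_class (path_pow p n)"
proof (induction n)
  case 0
  interpret group HE_group by (rule group_HE)
  show ?case by (simp add: HE_one linepath_def)
next
  case (Suc n)
  interpret group HE_group by (rule group_HE)
  show ?case using Suc path_pow_loop[of hawaiian_earring p n] by (simp add: HE_mult)
qed

text \<open>Concatenation merely reparametrises the two pieces, so it does not increase the uniform
  distance, however often it is iterated; this is why the truncations of the system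
  converge.\<close>

lemma join_dist_le:
  assumes "\<And>t. t \<in> {0..1} \<Longrightarrow> dist (p t) (p' t) \<le> c" "\<And>t. t \<in> {0..1} \<Longrightarrow> dist (q t) (q' t) \<le> (c::real)"
    "t \<in> {0..1}"
  shows "dist ((p +++ q) t) ((p' +++ q') t) \<le> c"
  using assms(1)[of "2 * t"] assms(2)[of "2 * t - 1"] assms(3) by (auto simp: joinpaths_def)

lemma path_pow_dist_le:
  assumes "\<And>t. t \<in> {0..1} \<Longrightarrow> dist (p t) (p' t) \<le> c" "t \<in> {0..1}"
  shows "dist (path_pow p n t) (path_pow p' n t) \<le> c"
  using assms(2)
proof (induction n arbitrary: t)
  case 0
  have "0 \<le> dist (p t) (p' t)" by simp
  also have "\<dots> \<le> c" using assms(1) 0 by blast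
  finally show ?case by simp
next
  case (Suc n)
  then show ?case using join_dist_le[of "path_pow p n" "path_pow p' n" c p p' t] assms(1) by simp
qed

text \<open>The loops solving \<open>y\<^sub>k = x\<^sub>k y\<^sub>k\<^sub>+\<^sub>1\<^bsup>n\<^sub>k\<^esup>\<close> on the nose are uniform limits of the finite
  iterations, since these only differ inside circles of small diameter.\<close>
lemma HE_solve_loops:
  fixes \<alpha> :: "nat \<Rightarrow> real \<Rightarrow> complex" and n M :: "nat \<Rightarrow> nat"
  assumes \<alpha>: "\<And>k. \<alpha> k \<in> loops (HE_above (M k)) 0" and M: "mono M" "\<And>k. k \<le> M k"
  obtains y where "\<And>k. y k \<in> loops (HE_above (M k)) 0"
    "\<And>k t. t \<in> {0..1} \<Longrightarrow> y k t = (\<alpha> k +++ path_pow (y (Suc k)) (n k)) t"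
proof -
  define F where "F k p = \<alpha> k +++ path_pow p (n k)" for k p
  \<comment> \<open>The system truncated at stage \<open>m\<close> by the constant loop.\<close>
  define g where "g j m = foldr F [j..<m] (linepath 0 0)" for j m
  have g: "m \<le> j \<Longrightarrow> g j m = linepath 0 0" "j < m \<Longrightarrow> g j m = F j (g (Suc j) m)" for j m
    by (auto simp: g_def upt_conv_Cons)
  have F_loop: "F k p \<in> loops (HE_above (M k)) 0" if "p \<in> loops (HE_above (M (Suc k))) 0" for k p
  proof -
    have "p \<in> loops (HE_above (M k)) 0"
      using that loops_mono[OF HE_above_mono[OF monoD[OF M(1)]], of k "Suc k" 0] by auto
    then show ?thesis unfolding F_def by (intro join_loops \<alpha> path_pow_loop) auto
  qed
  have g_loop: "g j m \<in> loops (HE_above (M j)) 0" for j m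
  proof (cases "j \<le> m")
    case True
    then show ?thesis by (induction rule: inc_induct) (auto simp: g const_loop zero_loop F_loop)
  qed (simp add: g const_loop zero_loop)
  have F_dist: "dist (F k p t) (F k q t) \<le> c"
    if "\<And>t. t \<in> {0..1} \<Longrightarrow> dist (p t) (q t) \<le> c" "t \<in> {0..1}" for k p q c t
  proof -
    have "0 \<le> c" using that(1)[of 0] zero_le_dist order_trans by (metis atLeastAtMost_iff order_refl zero_le_one)
    then show ?thesis
      unfolding F_def using that(2) by (intro join_dist_le path_pow_dist_le[OF that(1)]) auto
  qed
  have g_mem: "g j m t \<in> HE_above (M j)" if "t \<in> {0..1}" for j m t
    using g_loop[of j m] that by (auto simp: loops_iff path_image_def)
  have g_norm: "cmod (g j m t) \<le> 2 / Suc j" if "t \<in> {0..1}" for j m t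
    using g_mem[OF that] HE_above_norm HE_above_mono[OF M(2)] by blast
  \<comment> \<open>At stage \<open>m\<close> the two truncations are the constant loop and a loop
    within \<open>2 / Suc m\<close> of the base point; by \<open>F_dist\<close> the earlier stages
    do not enlarge this distance.\<close>
  have g_dist: "dist (g j m t) (g j m' t) \<le> 2 / Suc m" if "j \<le> m" "m \<le> m'" "t \<in> {0..1}" for j m m' t
    using that(1,3)
  proof (induction arbitrary: t rule: inc_induct)
    case base
    then show ?case using g_norm[of t m m'] by (simp add: g dist_norm linepath_def)
  next
    case (step j)
    then show ?case using that(2) F_dist[of "g (Suc j) m" "g (Suc j) m'" "2 / Suc m" t j] by (simp add: g)
  qed
  have "uniformly_Cauchy_on {0..1} (\<lambda>m. g j m)" for j
  proof (rule uniformly_Cauchy_onI)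
    fix e :: real assume "e > 0"
    then obtain N where N: "inverse (Suc N) < e / 4" using reals_Archimedean[of "e / 4"] by auto
    define m0 where "m0 = max j N"
    have m0: "2 / Suc m0 < e / 2"
    proof -
      have "inverse (Suc m0) \<le> inverse (Suc N)" by (simp add: m0_def)
      moreover have "2 / Suc m0 = 2 * inverse (real (Suc m0))" by (simp only: divide_inverse)
      ultimately show ?thesis using N by linarith
    qed
    have "dist (g j m t) (g j m' t) < e" if "t \<in> {0..1}" "m0 \<le> m" "m0 \<le> m'" for t m m'
      using g_dist[of j m0 m t] g_dist[of j m0 m' t] that m0
        dist_triangle3[of "g j m t" "g j m' t" "g j m0 t"] by (simp add: m0_def)
    then show "\<exists>N. \<forall>t\<in>{0..1}. \<forall>m\<ge>N. \<forall>m'\<ge>N. dist (g j m t) (g j m' t) < e" by blast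
  qed
  then have "uniformly_convergent_on {0..1} (g j)" for j
    by (rule Cauchy_uniformly_convergent)
  then obtain y where y: "\<And>j. uniform_limit {0..1} (g j) (y j) sequentially"
    unfolding uniformly_convergent_on_def by metis
  have lim: "(\<lambda>m. g j m t) \<longlonglongrightarrow> y j t" if "t \<in> {0..1}" for j t
    by (rule tendsto_uniform_limitI[OF y that])
  have y_above: "y j t \<in> HE_above (M j)" if "t \<in> {0..1}" for j t
    by (rule closed_sequentially[OF closed_HE_above _ lim[OF that]]) (rule g_mem[OF that])
  have y_dist: "dist (g j m t) (y j t) \<le> 2 / Suc m" if "j \<le> m" "t \<in> {0..1}" for j m t
    by (rule Lim_bounded[OF tendsto_dist[OF tendsto_const lim[OF that(2)]], of m])
      (use g_dist that in auto)
  have y_ends: "y j 0 = 0" "y j 1 = 0" for j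
  proof -
    have "g j m 0 = 0" "g j m 1 = 0" for m
      using g_loop[of j m] by (auto simp: loops_iff pathstart_def pathfinish_def)
    then show "y j 0 = 0" "y j 1 = 0"
      using lim[of 0 j] lim[of 1 j] by (simp_all add: tendsto_const_iff)
  qed
  show ?thesis
  proof (rule that[of y])
    show "y k \<in> loops (HE_above (M k)) 0" for k
    proof -
      have "continuous_on {0..1} (y k)"
        by (rule uniform_limit_theorem[OF _ y]) (use g_loop in \<open>auto simp: loops_iff path_def\<close>)
      then show ?thesis
        using y_above y_ends by (auto simp: loops_iff path_def path_image_def pathstart_def pathfinish_def)
    qed
    fix k and t :: real assume t: "t \<in> {0..1}"
    have "dist (y k t) (F k (y (Suc k)) t) \<le> 4 / Suc m" if "k < m" for m
    proof -
      have "dist (g k m t) (F k (y (Suc k)) t) \<le> 2 / Suc m"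
        using F_dist[of "g (Suc k) m" "y (Suc k)" "2 / Suc m" t k] y_dist[of "Suc k" m] that t by (simp add: g)
      moreover have "dist (g k m t) (y k t) \<le> 2 / Suc m" using y_dist that t by simp
      ultimately show ?thesis
        using dist_triangle3[of "y k t" "F k (y (Suc k)) t" "g k m t"]
          add_divide_distrib[of 2 2 "real (Suc m)"] by linarith
    qed
    then have "\<forall>\<^sub>F m in sequentially. dist (y k t) (F k (y (Suc k)) t) \<le> 4 / Suc m"
      unfolding eventually_sequentially by (intro exI[of _ "Suc k"]) (auto simp: Suc_le_eq)
    moreover have "(\<lambda>m. 4 / Suc m) \<longlonglongrightarrow> (0::real)"
      using LIMSEQ_Suc[OF lim_const_over_n[of 4]] by simp
    ultimately have "dist (y k t) (F k (y (Suc k)) t) \<le> 0"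
      by (intro tendsto_lowerbound[where F = sequentially]) auto
    then show "y k t = (\<alpha> k +++ path_pow (y (Suc k)) (n k)) t" by (simp add: F_def)
  qed
qed

text \<open>The system is solved for loops rather than classes: the \<open>x k\<close> are
  represented by loops in smaller and smaller circles, and the equation between loops on the unit
  interval gives the one between classes.\<close>

lemma diag_base_HE: "diag_base HE_group (range HE_tail)"
  unfolding diag_base_def
proof (intro conjI allI impI)
  show "range HE_tail \<noteq> {}" by blast
  show "\<forall>U\<in>range HE_tail. U \<subseteq> carrier HE_group" using HE_tail_carrier by blast
  show "\<forall>U\<in>range HE_tail. \<forall>U'\<in>range HE_tail. \<exists>W\<in>range HE_tail. W \<subseteq> U \<inter> U'"
  proof (intro ballI)
    fix U U' assume "U \<in> range HE_tail" "U' \<in> range HE_tail"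
    then obtain m n where "U = HE_tail m" "U' = HE_tail n" by auto
    then have "HE_tail (max m n) \<subseteq> U \<inter> U'"
      using HE_tail_mono[of m "max m n"] HE_tail_mono[of n "max m n"] by simp
    then show "\<exists>W\<in>range HE_tail. W \<subseteq> U \<inter> U'" by (rule bexI[OF _ rangeI])
  qed
next
  fix S and Uf :: "(real \<Rightarrow> complex) set list \<Rightarrow> (real \<Rightarrow> complex) set set"
    and n :: "(real \<Rightarrow> complex) set list \<Rightarrow> nat"
  assume S: "\<forall>U\<in>range HE_tail. S \<inter> U \<noteq> {}" and Uf: "\<forall>l. Uf l \<in> range HE_tail"
  have "\<exists>N. Uf l = HE_tail N" for l using spec[OF Uf, of l] by (rule imageE) blast
  then obtain lv where lv: "\<And>l. Uf l = HE_tail (lv l)" by metis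
  have "\<exists>z. z \<in> S \<inter> HE_tail m" for m using S by blast
  then obtain pick where pick: "\<And>m. pick m \<in> S \<inter> HE_tail m" by metis
  \<comment> \<open>Summing the required levels over all prefixes makes the chosen levels monotone
    and at least as large as each required one; adding \<open>length l\<close> makes them at least
    \<open>k\<close>, so that the circles shrink.\<close>
  define lev where "lev l = length l + (\<Sum>i\<le>length l. lv (take i l))" for l
  define L where "L = rec_nat [] (\<lambda>k l. l @ [pick (lev l)])"
  define x where "x k = pick (lev (L k))" for k
  have L: "L k = map x [0..<k]" for k
    by (induction k) (simp_all add: L_def x_def)
  define M where "M k = lev (L k)" for k
  have M_eq: "M k = k + (\<Sum>i\<le>k. lv (L i))" for k
  proof -
    have "take i (L k) = L i" if "i \<le> k" for i using that by (simp add: L take_map)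
    then show ?thesis by (simp add: M_def lev_def L)
  qed
  have M: "mono M" "\<And>k. k \<le> M k" "\<And>k. lv (L k) \<le> M k"
    unfolding M_eq by (auto simp: incseq_Suc_iff mono_iff_le_Suc intro: trans_le_add2 member_le_sum)
  have tail_Uf: "HE_tail (M k) \<subseteq> Uf (map x [0..<k])" for k
    using HE_tail_mono[OF M(3)] by (simp add: lv L)
  have "\<exists>\<alpha>. \<alpha> \<in> loops (HE_above (M k)) 0 \<and> x k = HE_class \<alpha>" for k
    using pick[of "M k"] by (auto simp: x_def M_def HE_tail_def)
  then obtain \<alpha> where \<alpha>: "\<And>k. \<alpha> k \<in> loops (HE_above (M k)) 0" "\<And>k. x k = HE_class (\<alpha> k)" by metis
  obtain y where y: "\<And>k. y k \<in> loops (HE_above (M k)) 0"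
    "\<And>k t. t \<in> {0..1} \<Longrightarrow> y k t = (\<alpha> k +++ path_pow (y (Suc k)) (n (map x [0..<Suc k]))) t"
    using HE_solve_loops[OF \<alpha>(1) M(1,2), of "\<lambda>k. n (map x [0..<Suc k])"] by blast
  have "x k \<in> S \<inter> Uf (map x [0..<k])" for k
    using pick[of "M k"] tail_Uf[of k] by (auto simp: x_def M_def)
  moreover have "HE_class (y k) \<in> Uf (map x [0..<k])" for k
    using y(1)[of k] tail_Uf[of k] by (auto simp: HE_tail_def)
  moreover have "HE_class (y k) = x k \<otimes>\<^bsub>HE_group\<^esub> HE_class (y (Suc k)) [^]\<^bsub>HE_group\<^esub> n (map x [0..<Suc k])" for k
  proof -
    have yE: "y k \<in> loops hawaiian_earring 0" for k using y(1) above_loop by blast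
    have \<alpha>E: "\<alpha> k \<in> loops hawaiian_earring 0" using \<alpha>(1) above_loop by blast
    have "homotopic_paths hawaiian_earring (y k) (\<alpha> k +++ path_pow (y (Suc k)) (n (map x [0..<Suc k])))"
      by (rule homotopic_paths_eq) (use yE[of k] y(2) in \<open>auto simp: loops_iff simp del: upt_Suc\<close>)
    then have "HE_class (y k) = HE_class (\<alpha> k +++ path_pow (y (Suc k)) (n (map x [0..<Suc k])))"
      using yE[of k] path_class_eq_iff by (auto simp: loops_iff)
    then show ?thesis
      using yE[of "Suc k"] \<alpha>E path_pow_loop[OF _ yE[of "Suc k"]]
      by (simp add: \<alpha>(2) path_pow_class HE_mult del: upt_Suc)
  qed
  ultimately show "\<exists>x y. \<forall>k. x k \<in> S \<inter> Uf (map x [0..<k]) \<and> y k \<in> Uf (map x [0..<k]) \<and>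
      y k = x k \<otimes>\<^bsub>HE_group\<^esub> y (Suc k) [^]\<^bsub>HE_group\<^esub> n (map x [0..<Suc k])"
    by (intro exI[of _ x] exI[of _ "\<lambda>k. HE_class (y k)"]) blast
qed

section \<open>Decomposition of loops in the Hawaiian earring\<close>

lemma HE_retraction_below: "z \<in> HE_below N \<Longrightarrow> HE_retraction N z = z"
  by (auto simp: HE_retraction_def HE_below_def)

lemma HE_retraction_above: "z \<in> HE_above N \<Longrightarrow> HE_retraction N z = 0"
  using HE_below_Int_above[of z N] by (auto simp: HE_retraction_def HE_below_def)

lemma continuous_HE_retraction: "continuous_on hawaiian_earring (HE_retraction N)"
  unfolding hawaiian_earring_eq[of N]
proof (rule continuous_on_closed_Un[OF closed_HE_below closed_HE_above])
  show "continuous_on (HE_below N) (HE_retraction N)"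
    by (rule continuous_on_eq[OF continuous_on_id]) (simp add: HE_retraction_below)
  show "continuous_on (HE_above N) (HE_retraction N)"
    by (rule continuous_on_eq[OF continuous_on_const[of _ 0]]) (simp add: HE_retraction_above)
qed

lemma HE_retraction_mem: "HE_retraction N z \<in> HE_below N"
  by (auto simp: HE_retraction_def HE_below_def)

lemma HE_retraction_loop:
  assumes "p \<in> loops hawaiian_earring 0" shows "HE_retraction N \<circ> p \<in> loops hawaiian_earring 0"
proof -
  have "path (HE_retraction N \<circ> p)"
    using assms continuous_on_subset[OF continuous_HE_retraction]
    by (intro path_continuous_image) (auto simp: loops_iff)
  moreover have "path_image (HE_retraction N \<circ> p) \<subseteq> hawaiian_earring"
    using HE_retraction_mem HE_below_subset by (auto simp: path_image_def)
  moreover have "HE_retraction N 0 = 0" by (simp add: HE_retraction_above)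
  ultimately show ?thesis
    using assms by (simp add: loops_iff pathstart_compose pathfinish_compose)
qed

lemma HE_p_class:
  assumes "p \<in> loops hawaiian_earring 0" shows "HE_p N (HE_class p) = HE_class (HE_retraction N \<circ> p)"
proof -
  have "homotopic_paths hawaiian_earring p (SOME q. q \<in> HE_class p)"
    using assms some_path_class by (auto simp: loops_iff)
  then have "homotopic_paths hawaiian_earring (HE_retraction N \<circ> p) (HE_retraction N \<circ> (SOME q. q \<in> HE_class p))"
    by (rule homotopic_paths_continuous_image[OF _ continuous_HE_retraction])
      (use HE_retraction_mem HE_below_subset in blast)
  then show ?thesis
    using HE_retraction_loop[OF assms] path_class_eq_iff unfolding HE_p_def loops_iff by metis
qed

lemma HE_p_hom: "HE_p N \<in> hom HE_group HE_group"
proof (rule homI)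
  show "HE_p N x \<in> carrier HE_group" if "x \<in> carrier HE_group" for x
    using that HE_retraction_loop by (auto simp: HE_carrier HE_p_class)
  show "HE_p N (x \<otimes>\<^bsub>HE_group\<^esub> y) = HE_p N x \<otimes>\<^bsub>HE_group\<^esub> HE_p N y"
    if "x \<in> carrier HE_group" "y \<in> carrier HE_group" for x y
    using that HE_retraction_loop by (auto simp: HE_carrier HE_p_class HE_mult join_loops path_compose_join)
qed

lemma HE_p_above:
  assumes "p \<in> loops (HE_above N) 0" shows "HE_p N (HE_class p) = \<one>\<^bsub>HE_group\<^esub>"
proof -
  have p: "p \<in> loops hawaiian_earring 0" using assms above_loop by blast
  have "homotopic_paths hawaiian_earring (HE_retraction N \<circ> p) (linepath 0 0)"
  proof (rule homotopic_paths_eq)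
    show "(HE_retraction N \<circ> p) t = linepath 0 0 t" if "t \<in> {0..1}" for t
    proof -
      have "p t \<in> HE_above N" using assms that by (auto simp: loops_iff path_image_def)
      then show ?thesis by (simp add: HE_retraction_above linepath_def)
    qed
  qed (use HE_retraction_loop[OF p] in \<open>auto simp: loops_iff\<close>)
  then show ?thesis
    using HE_retraction_loop[OF p] path_class_eq_iff unfolding HE_p_class[OF p] HE_one loops_iff by metis
qed

lemma HE_p_below:
  assumes "p \<in> loops (HE_below N) 0" shows "HE_p N (HE_class p) = HE_class p"
proof -
  have p: "p \<in> loops hawaiian_earring 0" using assms below_loop by blast
  have "homotopic_paths hawaiian_earring p (HE_retraction N \<circ> p)"
  proof (rule homotopic_paths_eq)
    show "p t = (HE_retraction N \<circ> p) t" if "t \<in> {0..1}" for t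
    proof -
      have "p t \<in> HE_below N" using assms that by (auto simp: loops_iff path_image_def)
      then show ?thesis by (simp add: HE_retraction_below)
    qed
  qed (use p in \<open>auto simp: loops_iff\<close>)
  then show ?thesis
    using p path_class_eq_iff unfolding HE_p_class[OF p] loops_iff by metis
qed

lemma n_slender_imp_trivial_near:
  assumes "group H" "n_slender H" "\<phi> \<in> hom HE_group H"
  shows "trivial_near (range HE_tail) H \<phi>"
proof -
  interpret \<phi>: group_hom HE_group H \<phi>
    using assms group_HE by (simp add: group_hom_def group_hom_axioms_def)
  obtain N where N: "\<And>x. x \<in> carrier HE_group \<Longrightarrow> \<phi> x = \<phi> (HE_p N x)"
    using assms unfolding n_slender_def by blast
  have "\<phi> x = \<one>\<^bsub>H\<^esub>" if "x \<in> HE_tail N" for x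
  proof -
    have "HE_p N x = \<one>\<^bsub>HE_group\<^esub>" using that HE_p_above by (auto simp: HE_tail_def)
    then show ?thesis using N[of x] that HE_tail_carrier[of N] \<phi>.hom_one by auto
  qed
  then show ?thesis unfolding trivial_near_def by blast
qed

text \<open>In the coordinate \<open>1/z = x - i k/2\<close> on the circle of index \<open>k\<close>, this is \<open>x \<mapsto> x / D\<close> with
  \<open>D = 1 - s min(1, x\<^sup>2)\<close> and \<open>x/0 = \<infinity>\<close>: for \<open>s = 1\<close> it collapses a neighbourhood of the base point.
  At \<open>z = 0\<close> all quotients are \<open>0/0 = 0\<close>.\<close>
definition squeeze_factor :: "real \<Rightarrow> complex \<Rightarrow> real" where
  "squeeze_factor s z = 1 - s * min 1 ((Re z)\<^sup>2 / (cmod z) ^ 4)"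

definition squeeze :: "real \<Rightarrow> complex \<Rightarrow> complex" where
  "squeeze s z = of_real (squeeze_factor s z * (cmod z)\<^sup>2 / ((Re z)\<^sup>2 + (squeeze_factor s z)\<^sup>2 * (Im z)\<^sup>2))
     * Complex (Re z) (squeeze_factor s z * Im z)"

lemma squeeze_factor_bounds: "0 \<le> s \<Longrightarrow> s \<le> 1 \<Longrightarrow> 0 \<le> squeeze_factor s z \<and> squeeze_factor s z \<le> 1"
  by (simp add: squeeze_factor_def mult_le_one)

lemma squeeze_zero: "squeeze s 0 = 0"
  by (simp add: squeeze_def)

lemma squeeze_start: "squeeze 0 z = z"
proof (cases "z = 0")
  case False
  have "(Re z)\<^sup>2 + (Im z)\<^sup>2 \<noteq> 0" using False by (simp add: complex_eq_iff)
  then show ?thesis by (simp add: squeeze_def squeeze_factor_def cmod_power2)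
    (simp add: complex_eq_iff)
qed (simp add: squeeze_zero)

lemma cmod_squeeze:
  fixes s z defines "D \<equiv> squeeze_factor s z"
  shows "(cmod (squeeze s z))\<^sup>2 = D\<^sup>2 * ((cmod z)\<^sup>2)\<^sup>2 / ((Re z)\<^sup>2 + D\<^sup>2 * (Im z)\<^sup>2)"
proof -
  define e where "e = D * (cmod z)\<^sup>2 / ((Re z)\<^sup>2 + D\<^sup>2 * (Im z)\<^sup>2)"
  have "(cmod (squeeze s z))\<^sup>2 = e\<^sup>2 * (cmod (Complex (Re z) (D * Im z)))\<^sup>2"
    unfolding squeeze_def D_def[symmetric] e_def[symmetric]
    by (simp only: norm_mult norm_of_real power_mult_distrib power2_abs)
  also have "(cmod (Complex (Re z) (D * Im z)))\<^sup>2 = (Re z)\<^sup>2 + D\<^sup>2 * (Im z)\<^sup>2"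
    by (simp add: cmod_power2 power_mult_distrib)
  finally have "(cmod (squeeze s z))\<^sup>2
      = (D * (cmod z)\<^sup>2 / ((Re z)\<^sup>2 + D\<^sup>2 * (Im z)\<^sup>2))\<^sup>2 * ((Re z)\<^sup>2 + D\<^sup>2 * (Im z)\<^sup>2)"
    by (simp only: e_def)
  \<comment> \<open>If the denominator vanishes, both sides are 0 because division by 0 gives
    0.\<close>
  then show ?thesis
    by (cases "(Re z)\<^sup>2 + D\<^sup>2 * (Im z)\<^sup>2 = 0") (simp_all add: power2_eq_square)
qed

text \<open>Only the real part of \<open>1/z\<close> is changed, while the index of the circle is
  determined by the imaginary part.\<close>

lemma squeeze_below:
  assumes "z \<in> HE_below N" shows "squeeze s z \<in> HE_below N"
proof (cases "z = 0")
  case False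
  then obtain k where k: "k \<ge> 1" "k \<le> N" "real k * (cmod z)\<^sup>2 = 2 * Im z"
    using assms by (auto simp: HE_below_iff)
  define D where "D = squeeze_factor s z"
  define d where "d = (Re z)\<^sup>2 + D\<^sup>2 * (Im z)\<^sup>2"
  have "real k * (cmod (squeeze s z))\<^sup>2 = D\<^sup>2 * (cmod z)\<^sup>2 * (real k * (cmod z)\<^sup>2) / d"
    unfolding cmod_squeeze D_def[symmetric] d_def by (simp add: power2_eq_square)
  also have "\<dots> = 2 * (D * (cmod z)\<^sup>2 / d * (D * Im z))"
    unfolding k(3) by (simp add: power2_eq_square)
  also have "D * (cmod z)\<^sup>2 / d * (D * Im z) = Im (squeeze s z)"
    by (simp add: squeeze_def D_def d_def)
  finally show ?thesis using k by (auto simp: HE_below_iff)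
qed (simp add: squeeze_zero)

text \<open>The radius \<open>1 / Suc N\<close> is chosen so that \<open>r (1 + k^2) \<le> 1\<close>
  for the squared modulus \<open>r\<close> and every index \<open>k\<close> up to \<open>N\<close>.
  For nonzero \<open>z\<close> the first conclusion says that the real part of \<open>1/z\<close>
  has modulus at least 1, so that \<open>squeeze 1\<close> collapses \<open>z\<close>; the second
  bounds the denominator in \<open>squeeze\<close> from below.\<close>

lemma below_near_zero:
  assumes "z \<in> HE_below N" "cmod z < 1 / Suc N"
  shows "((cmod z)\<^sup>2)\<^sup>2 \<le> (Re z)\<^sup>2" "3 / 4 * (cmod z)\<^sup>2 \<le> (Re z)\<^sup>2"
proof -
  define r where "r = (cmod z)\<^sup>2"
  have "r\<^sup>2 \<le> (Re z)\<^sup>2 \<and> 3 / 4 * r \<le> (Re z)\<^sup>2"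
  proof (cases "z = 0")
    case False
    then obtain k where k: "k \<ge> 1" "k \<le> N" "real k * r = 2 * Im z"
      using assms by (auto simp: HE_below_iff r_def)
    have "cmod z * Suc N < 1" using assms(2) by (simp add: field_simps)
    then have "(cmod z * Suc N)\<^sup>2 \<le> 1" by (intro power_le_one) auto
    then have 1: "r * (Suc N)\<^sup>2 \<le> 1" by (simp add: r_def power_mult_distrib)
    have r: "r \<ge> 0" by (simp add: r_def)
    have "1 + (real k)\<^sup>2 \<le> (real (Suc N))\<^sup>2"
    proof -
      have "(real k)\<^sup>2 \<le> (real N)\<^sup>2" using k by (intro power_mono) auto
      then show ?thesis by (simp add: power2_eq_square algebra_simps)
    qed
    then have "r * (1 + (real k)\<^sup>2) \<le> r * (real (Suc N))\<^sup>2" using r by (intro mult_left_mono) auto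
    then have "r * (1 + (real k)\<^sup>2) \<le> 1" using 1 by simp
    then have "r * (r * (1 + (real k)\<^sup>2)) \<le> r * 1" using r by (intro mult_left_mono) auto
    then have 2: "r\<^sup>2 + (real k * r)\<^sup>2 \<le> r" by (simp add: power2_eq_square algebra_simps)
    have "r = (Re z)\<^sup>2 + (Im z)\<^sup>2" by (simp add: r_def cmod_power2)
    moreover have "(real k * r)\<^sup>2 = 4 * (Im z)\<^sup>2" by (simp add: k(3) power_mult_distrib)
    \<comment> \<open>Substitution gives \<open>r^2 + 4 (Im z)^2 \<le> (Re z)^2 + (Im z)^2\<close>,
      from which both bounds follow linearly.\<close>
    ultimately show ?thesis
      using 2 zero_le_power2[of r] zero_le_power2[of "Im z"] by (intro conjI; linarith)
  qed (simp add: r_def)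
  then show "((cmod z)\<^sup>2)\<^sup>2 \<le> (Re z)\<^sup>2" "3 / 4 * (cmod z)\<^sup>2 \<le> (Re z)\<^sup>2" by (auto simp: r_def)
qed

lemma squeeze_end:
  assumes "z \<in> HE_below N" "cmod z < 1 / Suc N" shows "squeeze 1 z = 0"
proof (cases "z = 0")
  case False
  have "(cmod z) ^ 4 \<le> (Re z)\<^sup>2"
    using below_near_zero(1)[OF assms] by (simp flip: power_mult)
  then have "1 \<le> (Re z)\<^sup>2 / (cmod z) ^ 4" using False by (simp add: le_divide_eq)
  then have "squeeze_factor 1 z = 0" by (simp add: squeeze_factor_def)
  then show ?thesis by (simp add: squeeze_def)
qed (simp add: squeeze_zero)

text \<open>Uniformity in \<open>s\<close> yields joint continuity at the base point. The lower
  bound on the denominator would even give the factor \<open>4/3\<close> for the squares; 2 is a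
  convenient constant.\<close>

lemma squeeze_le:
  assumes "z \<in> HE_below N" "cmod z < 1 / Suc N" "0 \<le> s" "s \<le> 1"
  shows "cmod (squeeze s z) \<le> 2 * cmod z"
proof (cases "z = 0")
  case False
  define D where "D = squeeze_factor s z"
  define r where "r = (cmod z)\<^sup>2"
  define d where "d = (Re z)\<^sup>2 + D\<^sup>2 * (Im z)\<^sup>2"
  have r: "r > 0" using False by (simp add: r_def)
  have d: "3 / 4 * r \<le> d" using below_near_zero(2)[OF assms(1,2)] by (simp add: d_def r_def add_increasing2)
  have D: "D\<^sup>2 \<le> 1" using squeeze_factor_bounds[OF assms(3,4), of z] by (simp add: D_def power_le_one)
  have "D\<^sup>2 * r\<^sup>2 \<le> 1 * r\<^sup>2" using D by (intro mult_right_mono) auto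
  also have "\<dots> \<le> 4 * r * d" using mult_left_mono[OF d, of "4 * r"] r by (simp add: power2_eq_square)
  finally have "D\<^sup>2 * r\<^sup>2 / d \<le> 4 * r" using d r by (simp add: divide_le_eq)
  then have "(cmod (squeeze s z))\<^sup>2 \<le> (2 * cmod z)\<^sup>2"
    unfolding cmod_squeeze D_def[symmetric] by (simp add: r_def d_def power_mult_distrib)
  then show ?thesis by (rule power2_le_imp_le) simp
qed (simp add: squeeze_zero)

lemma continuous_squeeze: "continuous_on ({0..1::real} \<times> HE_below N) (\<lambda>x. squeeze (fst x) (snd x))"
  unfolding continuous_on_def
proof
  fix x :: "real \<times> complex" assume x: "x \<in> {0..1} \<times> HE_below N"
  obtain s z where sz: "x = (s, z)" by fastforce
  let ?F = "at x within {0..1} \<times> HE_below N"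
  show "((\<lambda>x. squeeze (fst x) (snd x)) \<longlongrightarrow> squeeze (fst x) (snd x)) ?F"
  proof (cases "z = 0")
    case True
    have "((\<lambda>y. 2 * cmod (snd y)) \<longlongrightarrow> 2 * cmod (snd x)) ?F" by (intro tendsto_intros)
    moreover have "2 * cmod (snd x) = 0" by (simp add: sz True)
    ultimately have lim: "((\<lambda>y. 2 * cmod (snd y)) \<longlongrightarrow> 0) ?F" by metis
    have "\<forall>\<^sub>F y in ?F. cmod (squeeze (fst y) (snd y)) \<le> 2 * cmod (snd y)"
    proof -
      have "((\<lambda>y. cmod (snd y)) \<longlongrightarrow> cmod (snd x)) ?F" by (intro tendsto_intros)
      then have "\<forall>\<^sub>F y in ?F. cmod (snd y) < 1 / Suc N"
        by (rule order_tendstoD) (simp add: sz True)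
      moreover have "\<forall>\<^sub>F y in ?F. y \<in> {0..1} \<times> HE_below N" by (simp add: eventually_at_filter)
      ultimately show ?thesis
        by eventually_elim (auto intro: squeeze_le)
    qed
    then have "((\<lambda>y. squeeze (fst y) (snd y)) \<longlongrightarrow> 0) ?F"
      by (rule Lim_null_comparison[OF _ lim])
    moreover have "squeeze (fst x) (snd x) = 0" by (simp add: sz True squeeze_zero)
    ultimately show ?thesis by metis
  next
    case False
    have Im: "Im z \<noteq> 0" using x False by (auto simp: sz HE_below_iff)
    \<comment> \<open>If \<open>Re z = 0\<close> then the squeeze factor is 1, so the two summands
      cannot vanish together.\<close>
    have den: "(Re z)\<^sup>2 + (squeeze_factor s z)\<^sup>2 * (Im z)\<^sup>2 \<noteq> 0"
      using Im by (auto simp: add_nonneg_eq_0_iff squeeze_factor_def)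
    have "((\<lambda>y. squeeze_factor (fst y) (snd y)) \<longlongrightarrow> squeeze_factor (fst x) (snd x)) ?F"
      unfolding squeeze_factor_def by (intro tendsto_intros) (simp add: sz False)
    then show ?thesis
      unfolding squeeze_def
    proof (intro tendsto_intros)
      show "(Re (snd x))\<^sup>2 + (squeeze_factor (fst x) (snd x))\<^sup>2 * (Im (snd x))\<^sup>2 \<noteq> 0"
        unfolding sz fst_conv snd_conv by (rule den)
    qed
  qed
qed

text \<open>The two branches fit together continuously, since the parts meet only at the base point,
  which \<open>squeeze\<close> fixes.\<close>

definition pinch :: "nat \<Rightarrow> real \<Rightarrow> complex \<Rightarrow> complex" where
  "pinch N s z = (if z \<in> HE_above N then z else squeeze s z)"

lemma continuous_pinch: "continuous_on ({0..1::real} \<times> hawaiian_earring) (\<lambda>x. pinch N (fst x) (snd x))"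
proof -
  have "continuous_on ({0..1::real} \<times> HE_above N \<union> {0..1} \<times> HE_below N)
      (\<lambda>x. if snd x \<in> HE_above N then snd x else squeeze (fst x) (snd x))"
    by (rule continuous_on_cases[OF _ _ _ continuous_squeeze])
      (auto intro!: closed_Times closed_HE_above closed_HE_below continuous_intros
        dest: HE_below_Int_above simp: squeeze_zero)
  moreover have "{0..1} \<times> HE_above N \<union> {0..1} \<times> HE_below N = {0..1::real} \<times> hawaiian_earring"
    unfolding hawaiian_earring_eq[of N] by blast
  ultimately show ?thesis by (simp add: pinch_def)
qed

lemma pinch_mem:
  assumes "z \<in> hawaiian_earring" shows "pinch N s z \<in> hawaiian_earring"
  using assms squeeze_below[of z N s] by (auto simp: pinch_def hawaiian_earring_eq[of N])

lemma pinch_homotopic: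
  assumes "p \<in> loops hawaiian_earring 0"
  shows "homotopic_paths hawaiian_earring p (pinch N 1 \<circ> p)"
proof -
  have p: "continuous_on {0..1} p" "\<And>t. t \<in> {0..1} \<Longrightarrow> p t \<in> hawaiian_earring" "p 0 = 0" "p 1 = 0"
    using assms by (auto simp: loops_iff path_def path_image_def pathstart_def pathfinish_def)
  have zero: "pinch N s 0 = 0" for s by (simp add: pinch_def)
  have start: "pinch N 0 z = z" for z by (simp add: pinch_def squeeze_start)
  have "continuous_on ({0..1} \<times> {0..1}) (\<lambda>x. (fst x, p (snd x)))"
    by (intro continuous_intros continuous_on_compose2[OF p(1)]) auto
  moreover have "(\<lambda>x. (fst x, p (snd x))) ` ({0..1::real} \<times> {0..1}) \<subseteq> {0..1} \<times> hawaiian_earring"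
    using p(2) by auto
  ultimately have "continuous_on ({0..1} \<times> {0..1}) (\<lambda>x. pinch N (fst x) (p (snd x)))"
    using continuous_on_compose2[OF continuous_pinch, of "{0..1} \<times> {0..1}" "\<lambda>x. (fst x, p (snd x))" N]
    by simp
  then show ?thesis
    unfolding homotopic_paths
    by (intro exI[of _ "\<lambda>x. pinch N (fst x) (p (snd x))"])
      (use p pinch_mem in \<open>auto simp: pathstart_def pathfinish_def zero start\<close>)
qed

section \<open>Cutting a loop into finitely many pieces\<close>

lemma homotopic_paths_cancel_middle:
  fixes p :: "real \<Rightarrow> 'a::real_normed_vector"
  assumes "path p" "path_image p \<subseteq> S" "path q" "path_image q \<subseteq> S" "path u" "path_image u \<subseteq> S"
    "path w" "path_image w \<subseteq> S" "pathfinish p = pathstart q" "pathfinish q = pathstart u"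
    "pathstart w = pathstart u"
  shows "homotopic_paths S ((p +++ (q +++ u)) +++ (reversepath u +++ w)) (p +++ (q +++ w))"
proof -
  note simps = assms path_image_join
  have "homotopic_paths S ((p +++ (q +++ u)) +++ (reversepath u +++ w)) (p +++ ((q +++ u) +++ (reversepath u +++ w)))"
    by (rule homotopic_paths_sym[OF homotopic_paths_assoc]) (simp_all add: simps)
  also have "homotopic_paths S \<dots> (p +++ (q +++ (u +++ (reversepath u +++ w))))"
    by (intro homotopic_paths_join homotopic_paths_sym[OF homotopic_paths_assoc]) (simp_all add: simps)
  also have "homotopic_paths S \<dots> (p +++ (q +++ ((u +++ reversepath u) +++ w)))"
    by (intro homotopic_paths_join homotopic_paths_assoc) (simp_all add: simps)
  also have "homotopic_paths S \<dots> (p +++ (q +++ (linepath (pathstart u) (pathstart u) +++ w)))"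
    by (intro homotopic_paths_join homotopic_paths_rinv) (simp_all add: simps)
  also have "homotopic_paths S \<dots> (p +++ (q +++ w))"
    by (intro homotopic_paths_join homotopic_paths_lid') (simp_all add: simps)
  finally show ?thesis .
qed

text \<open>The connecting paths stay in the part that contains \<open>w\<close>, so closing up a
  piece of a loop does not leave that part. At the base point the path is constant, so nothing is
  added at the two ends of the whole loop except constant paths.\<close>

lemma path_to_zero:
  assumes "w \<in> hawaiian_earring"
  obtains c where "path c" "pathstart c = w" "pathfinish c = 0" "path_image c \<subseteq> hawaiian_earring"
    "w \<in> HE_above N \<Longrightarrow> path_image c \<subseteq> HE_above N" "w \<in> HE_below N \<Longrightarrow> path_image c \<subseteq> HE_below N"
    "w = 0 \<Longrightarrow> c = linepath 0 0"
proof (cases "w = 0")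
  case True
  show ?thesis by (rule that[of "linepath 0 0"]) (auto simp: True)
next
  case False
  have circle: "\<exists>c. path c \<and> path_image c \<subseteq> hawaiian_circle k \<and> pathstart c = w \<and> pathfinish c = 0"
    if "k \<ge> 1" "w \<in> hawaiian_circle k" for k
  proof -
    have "path_connected (hawaiian_circle k)"
      unfolding hawaiian_circle_def by (rule path_connected_sphere) simp
    moreover have "0 \<in> hawaiian_circle k" using that by (simp add: hawaiian_circle_iff)
    ultimately show ?thesis using that unfolding path_connected_def by blast
  qed
  show ?thesis
  proof (cases "w \<in> HE_above N")
    case True
    then obtain k where "k > N" "w \<in> hawaiian_circle k" using False by (auto simp: HE_above_def)
    with circle[of k] obtain c where c: "path c" "path_image c \<subseteq> HE_above N" "pathstart c = w" "pathfinish c = 0"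
      by (auto simp: HE_above_def)
    show ?thesis
      by (rule that[of c]) (use c False True HE_above_subset HE_below_Int_above[of w N] in auto)
  next
    case nabove: False
    then have wb: "w \<in> HE_below N" using assms hawaiian_earring_eq[of N] by blast
    then obtain k where "k \<ge> 1" "k \<le> N" "w \<in> hawaiian_circle k" using False by (auto simp: HE_below_def)
    with circle[of k] obtain c where c: "path c" "path_image c \<subseteq> HE_below N" "pathstart c = w" "pathfinish c = 0"
      unfolding HE_below_def by fastforce
    show ?thesis
      by (rule that[of c]) (use c False nabove HE_below_subset in auto)
  qed
qed

lemma path_eventually_in:
  fixes p :: "real \<Rightarrow> 'a::metric_space"
  assumes "path p" "open U" "x \<in> {0..1}" "p x \<in> U"
  obtains \<delta> where "\<delta> > 0" "\<And>t. t \<in> {0..1} \<Longrightarrow> dist t x < \<delta> \<Longrightarrow> p t \<in> U"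
proof -
  obtain e where "e > 0" "ball (p x) e \<subseteq> U" using assms(2,4) openE by blast
  moreover obtain \<delta> where "\<delta> > 0" "\<And>t. t \<in> {0..1} \<Longrightarrow> dist t x < \<delta> \<Longrightarrow> dist (p t) (p x) < e"
    using assms(1,3) \<open>e > 0\<close> unfolding path_def continuous_on_iff by blast
  ultimately show ?thesis by (intro that[of \<delta>]) (auto simp: dist_commute)
qed

text \<open>The pinched loop is a finite product of loops in the first \<open>N\<close> circles and loops in the
  remaining circles: locally it stays in one of the two parts.\<close>
lemma HE_generated:
  assumes x: "x \<in> carrier HE_group"
    and mult: "\<And>x y. x \<in> A \<Longrightarrow> y \<in> A \<Longrightarrow> x \<otimes>\<^bsub>HE_group\<^esub> y \<in> A"
    and above: "\<And>p. p \<in> loops (HE_above N) 0 \<Longrightarrow> HE_class p \<in> A"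
    and below: "\<And>p. p \<in> loops (HE_below N) 0 \<Longrightarrow> HE_class p \<in> A"
  shows "x \<in> A"
proof -
  interpret group HE_group by (rule group_HE)
  obtain p where p: "p \<in> loops hawaiian_earring 0" "x = HE_class p" using x by (auto simp: HE_carrier)
  define q where "q = pinch N 1 \<circ> p"
  have pq: "homotopic_paths hawaiian_earring p q" unfolding q_def by (rule pinch_homotopic[OF p(1)])
  then have q: "q \<in> loops hawaiian_earring 0" using p(1) homotopic_loops_mem by blast
  have q': "path q" "path_image q \<subseteq> hawaiian_earring" "q 0 = 0" "q 1 = 0"
    using q by (auto simp: loops_iff pathstart_def pathfinish_def)
  have xq: "x = HE_class q" using p pq path_class_eq_iff by (auto simp: loops_iff)
  have qE: "q t \<in> hawaiian_earring" if "t \<in> {0..1}" for t using q'(2) that by (auto simp: path_image_def)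
  have "\<exists>c. t \<in> {0..1} \<longrightarrow> path c \<and> pathstart c = q t \<and> pathfinish c = 0 \<and> path_image c \<subseteq> hawaiian_earring
    \<and> (q t \<in> HE_above N \<longrightarrow> path_image c \<subseteq> HE_above N) \<and> (q t \<in> HE_below N \<longrightarrow> path_image c \<subseteq> HE_below N)
    \<and> (q t = 0 \<longrightarrow> c = linepath 0 0)" for t
    using path_to_zero[OF qE[of t], of N] by metis
  then obtain c where c: "\<And>t. t \<in> {0..1} \<Longrightarrow> path (c t) \<and> pathstart (c t) = q t \<and> pathfinish (c t) = 0
    \<and> path_image (c t) \<subseteq> hawaiian_earring
    \<and> (q t \<in> HE_above N \<longrightarrow> path_image (c t) \<subseteq> HE_above N) \<and> (q t \<in> HE_below N \<longrightarrow> path_image (c t) \<subseteq> HE_below N)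
    \<and> (q t = 0 \<longrightarrow> c t = linepath 0 0)"
    by metis
  \<comment> \<open>Closing up all pieces with the same connecting paths makes neighbouring pieces
    multiply to the combined one, since the paths at the common endpoint cancel.\<close>
  define l where "l a b = reversepath (c a) +++ (subpath a b q +++ c b)" for a b
  have sub: "path (subpath a b q)" "path_image (subpath a b q) \<subseteq> hawaiian_earring"
    if "a \<in> {0..1}" "b \<in> {0..1}" for a b
    using that q'(1,2) path_image_subpath_subset[of a b q] by auto
  have l_loop: "l a b \<in> loops S 0"
    if "a \<in> {0..1}" "b \<in> {0..1}" "path_image (c a) \<subseteq> S" "path_image (c b) \<subseteq> S" "path_image (subpath a b q) \<subseteq> S"
    for a b S
    using that c[of a] c[of b] sub[of a b] by (auto simp: loops_iff l_def path_image_join)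
  have cE: "path_image (c t) \<subseteq> hawaiian_earring" if "t \<in> {0..1}" for t
    using c[OF that] by blast
  have l_mult: "HE_class (l a b) \<otimes>\<^bsub>HE_group\<^esub> HE_class (l b d) = HE_class (l a d)"
    if abd: "a \<in> {0..1}" "b \<in> {0..1}" "d \<in> {0..1}" for a b d
  proof -
    have ll: "l a b \<in> loops hawaiian_earring 0" "l b d \<in> loops hawaiian_earring 0"
      by (intro l_loop sub(2) cE abd)+
    note ca = c[OF abd(1)] and cb = c[OF abd(2)] and cd = c[OF abd(3)]
    note simps = ca cb cd sub abd path_image_join
    have "homotopic_paths hawaiian_earring (l a b +++ l b d)
        (reversepath (c a) +++ (subpath a b q +++ (subpath b d q +++ c d)))"
      unfolding l_def by (rule homotopic_paths_cancel_middle) (simp_all add: simps del: atLeastAtMost_iff)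
    also have "homotopic_paths hawaiian_earring \<dots>
        (reversepath (c a) +++ ((subpath a b q +++ subpath b d q) +++ c d))"
      by (intro homotopic_paths_join homotopic_paths_assoc) (simp_all add: simps del: atLeastAtMost_iff)
    also have "homotopic_paths hawaiian_earring \<dots> (l a d)"
      unfolding l_def by (intro homotopic_paths_join homotopic_join_subpaths)
        (simp_all add: simps q' del: atLeastAtMost_iff)
    finally have "HE_class (l a b +++ l b d) = HE_class (l a d)"
      using join_loops[OF ll] path_class_eq_iff unfolding loops_iff by metis
    then show ?thesis by (simp add: HE_mult ll)
  qed
  \<comment> \<open>Bisection replaces an explicit subdivision: the property passes to the union of
    adjoining intervals by \<open>l_mult\<close> and holds for all short intervals around any given
    point.\<close>
  have "0 \<le> (0::real) \<and> (1::real) \<le> 1 \<and> (0::real) \<le> 1 \<longrightarrow> HE_class (l 0 1) \<in> A"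
  proof (rule Bolzano[where P = "\<lambda>a b. 0 \<le> a \<and> b \<le> 1 \<and> a \<le> b \<longrightarrow> HE_class (l a b) \<in> A"])
    show "(0::real) \<le> 1" by simp
  next
    fix a b d :: real
    assume "0 \<le> a \<and> b \<le> 1 \<and> a \<le> b \<longrightarrow> HE_class (l a b) \<in> A"
      "0 \<le> b \<and> d \<le> 1 \<and> b \<le> d \<longrightarrow> HE_class (l b d) \<in> A" "a \<le> b" "b \<le> d"
    then show "0 \<le> a \<and> d \<le> 1 \<and> a \<le> d \<longrightarrow> HE_class (l a d) \<in> A"
      using mult[of "HE_class (l a b)" "HE_class (l b d)"] l_mult[of a b d] by auto
  next
    fix t :: real assume "0 \<le> t" "t \<le> 1"
    then have t: "t \<in> {0..1}" by simp
    have pt: "path p" "p u \<in> hawaiian_earring" if "u \<in> {0..1}" for u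
      using p(1) that by (auto simp: loops_iff path_image_def)
    obtain \<delta> where \<delta>: "\<delta> > 0"
      "(\<forall>u\<in>{0..1}. dist u t < \<delta> \<longrightarrow> q u \<in> HE_above N) \<or> (\<forall>u\<in>{0..1}. dist u t < \<delta> \<longrightarrow> q u \<in> HE_below N)"
    proof (cases "p t \<in> HE_above N")
      case False
      obtain \<delta> where "\<delta> > 0" "\<And>u. u \<in> {0..1} \<Longrightarrow> dist u t < \<delta> \<Longrightarrow> p u \<in> - HE_above N"
        using path_eventually_in[OF pt(1)[OF t], of "- HE_above N" t] t False closed_HE_above
        by (auto simp: open_Compl)
      then have "q u \<in> HE_below N" if "u \<in> {0..1}" "dist u t < \<delta>" for u
        using that pt(2)[of u] squeeze_below[of "p u" N 1] hawaiian_earring_eq[of N]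
        by (auto simp: q_def pinch_def)
      then show ?thesis using that \<open>\<delta> > 0\<close> by blast
    next
      case True
      \<comment> \<open>Near \<open>t\<close> the path \<open>p\<close> avoids this closed set, so
        it is either in \<open>HE_above N\<close> already or in the neighbourhood of the base point
        in \<open>HE_below N\<close> that the pinch sends to 0. Hence \<open>q\<close> stays in
        \<open>HE_above N\<close>, although \<open>p\<close> may oscillate.\<close>
      let ?B = "HE_below N \<inter> {z. 1 / Suc N \<le> cmod z}"
      have "closed ?B" by (intro closed_Int closed_HE_below closed_Collect_le continuous_intros)
      then have "open (- ?B)" by (rule open_Compl)
      moreover have "p t \<in> - ?B" using HE_below_Int_above[OF _ True] by auto
      ultimately obtain \<delta> where "\<delta> > 0" "\<And>u. u \<in> {0..1} \<Longrightarrow> dist u t < \<delta> \<Longrightarrow> p u \<in> - ?B"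
        using path_eventually_in[OF pt(1)[OF t] _ t] by metis
      then have "q u \<in> HE_above N" if "u \<in> {0..1}" "dist u t < \<delta>" for u
        using that pt(2)[of u] squeeze_end[of "p u" N] hawaiian_earring_eq[of N]
        by (force simp: q_def pinch_def)
      then show ?thesis using that \<open>\<delta> > 0\<close> by blast
    qed
    have "HE_class (l a b) \<in> A" if "0 \<le> a" "b \<le> 1" "a \<le> t" "t \<le> b" "b - a < \<delta>" for a b
    proof -
      have ab: "a \<in> {0..1}" "b \<in> {0..1}" using that t by auto
      have near: "u \<in> {0..1}" "dist u t < \<delta>" if "u \<in> {a..b}" for u
        using that ab \<open>a \<le> t\<close> \<open>t \<le> b\<close> \<open>b - a < \<delta>\<close> by (auto simp: dist_real_def)
      have im: "path_image (subpath a b q) = q ` {a..b}"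
        using that by (simp add: path_image_subpath)
      from \<delta>(2) show ?thesis
      proof
        assume *: "\<forall>u\<in>{0..1}. dist u t < \<delta> \<longrightarrow> q u \<in> HE_above N"
        then have "q u \<in> HE_above N" if "u \<in> {a..b}" for u using near[OF that] by blast
        then show ?thesis
          using c[OF ab(1)] c[OF ab(2)] that ab by (intro above l_loop) (auto simp: im)
      next
        assume *: "\<forall>u\<in>{0..1}. dist u t < \<delta> \<longrightarrow> q u \<in> HE_below N"
        then have "q u \<in> HE_below N" if "u \<in> {a..b}" for u using near[OF that] by blast
        then show ?thesis
          using c[OF ab(1)] c[OF ab(2)] that ab by (intro below l_loop) (auto simp: im)
      qed
    qed
    then show "\<exists>\<delta>>0. \<forall>a b. a \<le> t \<and> t \<le> b \<and> b - a < \<delta> \<longrightarrow> 0 \<le> a \<and> b \<le> 1 \<and> a \<le> b \<longrightarrow> HE_class (l a b) \<in> A"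
      using \<delta>(1) by blast
  qed
  moreover have "HE_class (l 0 1) = x"
  proof -
    have "c 0 = linepath 0 0" "c 1 = linepath 0 0" using c[of 0] c[of 1] q' by auto
    then have "l 0 1 = linepath 0 0 +++ (q +++ linepath 0 0)" by (simp add: l_def subpath_trivial)
    then have "HE_class (l 0 1) = \<one>\<^bsub>HE_group\<^esub> \<otimes>\<^bsub>HE_group\<^esub> (HE_class q \<otimes>\<^bsub>HE_group\<^esub> \<one>\<^bsub>HE_group\<^esub>)"
      using q const_loop[of 0 hawaiian_earring] join_loops[OF q, of "linepath 0 0"]
      by (simp add: HE_mult HE_one)
    then show ?thesis using x xq by simp
  qed
  ultimately show ?thesis by simp
qed

text \<open>On loops in the circles beyond \<open>N\<close> both \<phi> and its composite with
  \<open>HE_p N\<close> are trivial; on loops in the first \<open>N\<close> circles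
  \<open>HE_p N\<close> is the identity. The set of agreement is closed under products, so
  \<open>HE_generated\<close> applies.\<close>

lemma trivial_near_imp_factor:
  assumes "group H" "\<phi> \<in> hom HE_group H" "trivial_near (range HE_tail) H \<phi>"
  shows "\<exists>N. \<forall>x\<in>carrier HE_group. \<phi> x = \<phi> (HE_p N x)"
proof -
  interpret \<phi>: group_hom HE_group H \<phi>
    using assms group_HE by (simp add: group_hom_def group_hom_axioms_def)
  obtain N where N: "\<And>x. x \<in> HE_tail N \<Longrightarrow> \<phi> x = \<one>\<^bsub>H\<^esub>"
    using assms(3) unfolding trivial_near_def by blast
  define A where "A = {x \<in> carrier HE_group. \<phi> x = \<phi> (HE_p N x)}"
  have p: "HE_p N x \<in> carrier HE_group" if "x \<in> carrier HE_group" for x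
    using HE_p_hom that by (auto simp: hom_def)
  have "x \<in> A" if "x \<in> carrier HE_group" for x
  proof (rule HE_generated[OF that, where N = N])
    show "y \<otimes>\<^bsub>HE_group\<^esub> z \<in> A" if "y \<in> A" "z \<in> A" for y z
      using that p by (simp add: A_def hom_mult[OF HE_p_hom])
    show "HE_class q \<in> A" if "q \<in> loops (HE_above N) 0" for q
      using that N[of "HE_class q"] HE_tail_carrier[of N] by (auto simp: A_def HE_p_above HE_tail_def)
    show "HE_class q \<in> A" if "q \<in> loops (HE_below N) 0" for q
      using that below_loop by (auto simp: A_def HE_p_below HE_carrier)
  qed
  then show ?thesis by (auto simp: A_def)
qed

section \<open>The three classes of slender groups\<close>

lemma (in graph_of_groups) n_slender_graph_product:
  assumes "\<And>v. v \<in> V \<Longrightarrow> n_slender (G v)"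
  shows "n_slender (graph_product V adj G)"
  unfolding n_slender_def
proof
  fix \<phi> assume \<phi>: "\<phi> \<in> hom HE_group \<Gamma>"
  have "trivial_near (range HE_tail) \<Gamma> \<phi>"
    by (rule trivial_near_graph_product[OF group_HE diag_base_HE \<phi>])
      (rule n_slender_imp_trivial_near[OF vertex_group assms])
  then show "\<exists>N. \<forall>x\<in>carrier HE_group. \<phi> x = \<phi> (HE_p N x)"
    by (rule trivial_near_imp_factor[OF gp.group_axioms \<phi>])
qed

text \<open>Common to both topological classes: completeness and local compactness enter through
  \<open>diag_base\<close>, and openness of a kernel becomes \<open>trivial_near\<close>.\<close>

lemma (in graph_of_groups) open_kernel_graph_product:
  assumes "topological_group K T" "diag_base K (top_group.nbhds K T)" "\<phi> \<in> hom K \<Gamma>"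
    and "\<And>v \<psi>. v \<in> V \<Longrightarrow> \<psi> \<in> hom K (G v) \<Longrightarrow> openin T (kernel K (G v) \<psi>)"
  shows "openin T (kernel K \<Gamma> \<phi>)"
proof -
  interpret K: top_group K T by unfold_locales (rule assms(1))
  have "trivial_near K.nbhds \<Gamma> \<phi>"
    by (rule trivial_near_graph_product[OF K.group_axioms assms(2,3)])
      (use K.openin_kernel_iff vertex_group assms(4) in blast)
  then show ?thesis using K.openin_kernel_iff[OF gp.group_axioms assms(3)] by blast
qed

theorem theorem3p3:
  fixes V :: "'v set" and adj :: "'v \<Rightarrow> 'v \<Rightarrow> bool" and G :: "'v \<Rightarrow> 'g monoid"
  assumes "simple_graph V adj"
    and "\<forall>v\<in>V. group (G v)"
  shows "((\<forall>v\<in>V. n_slender (G v)) \<longrightarrow> n_slender (graph_product V adj G))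
       \<and> ((\<forall>v\<in>V. cm_slender TYPE('a) (G v)) \<longrightarrow> cm_slender TYPE('a) (graph_product V adj G))
       \<and> ((\<forall>v\<in>V. lcH_slender TYPE('b) (G v)) \<longrightarrow> lcH_slender TYPE('b) (graph_product V adj G))"
proof (intro conjI impI)
  interpret graph_of_groups V adj G
    by (rule graph_of_groups.intro) (use assms in auto)
  show "n_slender (graph_product V adj G)" if "\<forall>v\<in>V. n_slender (G v)"
    using that by (intro n_slender_graph_product) blast
  show "cm_slender TYPE('a) (graph_product V adj G)" if cm: "\<forall>v\<in>V. cm_slender TYPE('a) (G v)"
    unfolding cm_slender_def
  proof (intro allI impI, elim conjE)
    fix K :: "'a monoid" and T \<phi>
    assume K: "topological_group K T" and T: "completely_metrizable_space T" and \<phi>: "\<phi> \<in> hom K \<Gamma>"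
    interpret K: top_group K T by unfold_locales (rule K)
    show "openin T (kernel K \<Gamma> \<phi>)"
      by (rule open_kernel_graph_product[OF K K.diag_base_completely_metrizable[OF T] \<phi>])
        (use cm K T in \<open>unfold cm_slender_def, blast\<close>)
  qed
  show "lcH_slender TYPE('b) (graph_product V adj G)" if lcH: "\<forall>v\<in>V. lcH_slender TYPE('b) (G v)"
    unfolding lcH_slender_def
  proof (intro allI impI, elim conjE)
    fix K :: "'b monoid" and T \<phi>
    assume K: "topological_group K T" and T: "locally_compact_space T" "Hausdorff_space T"
      and \<phi>: "\<phi> \<in> hom K \<Gamma>"
    interpret K: top_group K T by unfold_locales (rule K)
    show "openin T (kernel K \<Gamma> \<phi>)"
      by (rule open_kernel_graph_product[OF K K.diag_base_locally_compact[OF T] \<phi>])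
        (use lcH K T in \<open>unfold lcH_slender_def, blast\<close>)
  qed
qed

end
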